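(* Let $G$ be a finite group of odd order $n$. If $\psi(G) > \frac{271}{3647}\,\psi(C_n)$, then $G$ is supersolvable.
   Context: All groups are finite. For a finite group $G$, $\psi(G)=\sum_{g\in G} o(g)$, where $o(g)$ is the order of $g$. $C_n$ denotes the cyclic group of order $n$. *)

theory Defs
  imports "HOL-Algebra.Algebra"
begin

definition psi :: "('a, 'b) monoid_scheme \<Rightarrow> nat" where
  "psi G = (\<Sum>g\<in>carrier G. group.ord G g)"

definition supersolvable :: "('a, 'b) monoid_scheme \<Rightarrow> bool" where
  "supersolvable G \<longleftrightarrow>
     (\<exists>(H :: nat \<Rightarrow> 'a set) k.
        H 0 = {\<one>\<^bsub>G\<^esub>} \<and> H k = carrier G \<and>
        (\<forall>i\<le>k. H i \<lhd> G) \<and>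
        (\<forall>i<k. H i \<subseteq> H (Suc i) \<and>
               cyclic_group ((G\<lparr>carrier := H (Suc i)\<rparr>) Mod (H i))))"

end

theory Submission
  imports Defs "HOL-Number_Theory.Cong"
begin

text \<open>Let \<open>x\<close> be an element of maximal order, \<open>A = \<langle>x\<rangle>\<close> and \<open>k = |G : A|\<close>. Then \<open>k \<psi>(G) \<le> n\<^sup>2\<close>,
  whereas \<open>\<psi>(C\<^sub>n) \<ge> n\<^sup>2 \<Prod> q / (q + 1)\<close> over the primes \<open>q\<close> dividing \<open>n\<close>, so \<open>k\<close> is bounded in
  terms of the largest prime \<open>p\<close> dividing \<open>n\<close>. Since \<open>\<psi>(G) \<le> \<psi>(P) \<psi>(G / P)\<close> for a cyclic normal
  Sylow subgroup \<open>P\<close>, induction disposes of such \<open>P\<close>; otherwise every prime \<open>r\<close> dividing \<open>n\<close> but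
  not \<open>k\<close> yields a divisor \<open>d > 1\<close> of \<open>k\<close> with \<open>d \<equiv> 1\<close> modulo \<open>2 r\<close>. If \<open>k\<close> is prime, \<open>G\<close> is
  supersolvable. Hence \<open>k \<ge> 2 p + 1\<close>, and only \<open>k = 15\<close> and \<open>k = 21\<close> survive the numerical bound.

  The cosets of \<open>A\<close> whose \<open>A\<close>-orbit has length dividing \<open>m\<close> make up \<open>N(\<langle>x\<^sup>m\<rangle>) / A\<close>, so their number
  divides \<open>k\<close>, while the number of cosets with orbit length \<open>s\<close> is a multiple of \<open>s\<close>. For
  \<open>k = 15, 21\<close> this forces some \<open>\<langle>x\<^sup>m\<rangle>\<close> to be normal with quotient of order 15, 45, 75 or 105.
  Order 105 contradicts the number of Sylow subgroups, orders 15 and 45 give supersolvability, and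
  order 75, where the extremal group \<open>C\<^sub>5\<^sup>2 : C\<^sub>3\<close> occurs, is settled by bounding \<open>\<psi>\<close> directly.\<close>

section \<open>Quotients and chains of normal subgroups\<close>

text \<open>The constant comes from C_5^2 : C_3 of order 75. It is not supersolvable and has 24
  elements of order 5 and 50 of order 3, so its sum is 1 + 24 * 5 + 50 * 3 = 271, while \<psi>(C_75)
  = \<psi>(C_3) \<psi>(C_25) = 7 * 521 = 3647. Hence the strict inequality, and hence the estimate
  for a quotient of order 75 has no slack. The induction works with one fixed constant because
  \<psi>(C_n) is multiplicative over coprime factors, while \<psi>(G) is at least submultiplicative
  over a cyclic normal Sylow subgroup. The upper bound on k grows only like the square root of p,
  while 2 p + 1 is linear in p; this is why p < 17. Oddness gives 2 r + 1 instead of r + 1 as the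
  least nontrivial Sylow number. The remaining indices are too small for crude estimates. What
  replaces them is that a cyclic group A has only one subgroup of each order: the length of the
  A-orbit of a coset A g then decides which subgroups of A are normalised by g, so counting cosets
  by orbit length computes normalisers.\<close>

locale group_epi = group_hom +
  assumes surj: "h ` carrier G = carrier H"

text \<open>Quotients are realised on coset representatives, so that an induction over
  groups can pass to a quotient without leaving the type of its elements.\<close>

lemma (in group) quotient_epi:
  assumes "N \<lhd> G"
  obtains H :: "'a monoid" and h where "group_epi G H h" "kernel G H h = N"
proof -
  interpret N: normal N G by fact
  \<comment> \<open>The chosen element depends on the coset \<open>N #> x\<close> alone, so
    \<open>f\<close> is constant on each coset and separates different ones; its range is a
    transversal of \<open>N\<close>.\<close>
  define f where "f = (\<lambda>x. SOME y. y \<in> N #> x)"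
  have f: "f x \<in> N #> x" if "x \<in> carrier G" for x
    unfolding f_def using someI_ex[of "\<lambda>y. y \<in> N #> x"] rcos_self[OF that N.is_subgroup] by blast
  have eq: "N #> x = N #> f x" if "x \<in> carrier G" for x
    using repr_independence[OF f[OF that] that N.is_subgroup] by simp
  have "weak_group_morphism f N G"
  proof (rule weak_group_morphismsI[OF assms])
    fix a b assume ab: "a \<in> carrier G" "b \<in> carrier G"
    have "f a = f b \<longleftrightarrow> N #> a = N #> b"
      using eq[OF ab(1)] eq[OF ab(2)] f_def by metis
    also have "\<dots> \<longleftrightarrow> a \<otimes> inv b \<in> N"
      using ab N.rcos_module[OF is_group, of b a] repr_independenceD[OF N.is_subgroup, of a b]
        repr_independence[OF _ _ N.is_subgroup, of a b]
      by (metis N.is_subgroup rcos_self)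
    finally show "f a = f b \<longleftrightarrow> a \<otimes> inv b \<in> N" .
  qed
  then have "group_hom G (image_group f G) f" "kernel G (image_group f G) f = N"
    using weak_group_morphism_ker weak_group_morphism_group_hom by auto
  moreover have "f ` carrier G = carrier (image_group f G)" by (simp add: image_group_carrier)
  ultimately show ?thesis using that[of "image_group f G" f]
    by (simp add: group_epi_def group_epi_axioms_def)
qed

context group_epi
begin

abbreviation "Ker \<equiv> kernel G H h"

lemma fibre: assumes "x \<in> carrier G"
  shows "{y \<in> carrier G. h y = h x} = Ker #> x"
proof -
  interpret N: normal Ker G by (rule normal_kernel)
  show ?thesis
  proof safe
    fix y assume y: "y \<in> carrier G" "h y = h x"
    have "h (y \<otimes> inv x) = h x \<otimes>\<^bsub>H\<^esub> inv\<^bsub>H\<^esub> h x"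
      by (metis assms y hom_mult hom_inv G.inv_closed)
    also have "\<dots> = \<one>\<^bsub>H\<^esub>" using assms H.r_inv hom_closed by blast
    finally have "y \<otimes> inv x \<in> Ker" using assms y unfolding kernel_def by blast
    then show "y \<in> Ker #> x" using N.rcos_module[OF _ assms y(1)] G.is_group by simp
  next
    fix y assume y: "y \<in> Ker #> x"
    then show "y \<in> carrier G" using assms N.subset G.r_coset_subset_G by blast
    obtain k where k: "k \<in> Ker" "y = k \<otimes> x" using y unfolding r_coset_def by blast
    then have "k \<in> carrier G" "h k = \<one>\<^bsub>H\<^esub>" unfolding kernel_def by blast+
    then show "h y = h x" using k(2) assms by (metis hom_mult H.l_one hom_closed)
  qed
qed

lemma card_fibre:
  assumes "y \<in> carrier H" shows "card {x \<in> carrier G. h x = y} = card Ker"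
proof -
  obtain x where x: "x \<in> carrier G" "y = h x" using surj assms by auto
  show ?thesis unfolding x(2) fibre[OF x(1)]
    using G.card_rcosets_equal[of "Ker #> x" Ker] x(1) normal_kernel
    by (metis G.rcosetsI normal_imp_subgroup subgroup.subset)
qed

lemma card_vimage:
  assumes "M \<subseteq> carrier H" "finite (carrier G)"
  shows "card {x \<in> carrier G. h x \<in> M} = card M * card Ker"
proof -
  have fin: "finite M" using assms surj by (metis finite_imageI finite_subset)
  have "{x \<in> carrier G. h x \<in> M} = (\<Union>y\<in>M. {x \<in> carrier G. h x = y})" by auto
  also have "card \<dots> = (\<Sum>y\<in>M. card {x \<in> carrier G. h x = y})"
    using fin assms(2) by (intro card_UN_disjoint) auto
  also have "\<dots> = (\<Sum>y\<in>M. card Ker)" using assms(1) by (intro sum.cong) (auto simp: card_fibre)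
  finally show ?thesis by simp
qed

lemma order_epi: "finite (carrier G) \<Longrightarrow> order G = order H * card Ker"
proof -
  assume fin: "finite (carrier G)"
  have "{x \<in> carrier G. h x \<in> carrier H} = carrier G" by auto
  then show ?thesis using card_vimage[of "carrier H"] fin unfolding order_def by simp
qed

lemma finite_image: "finite (carrier G) \<Longrightarrow> finite (carrier H)"
  using surj by (metis finite_imageI)

lemma subgroup_vimage:
  assumes "subgroup M H" shows "subgroup {x \<in> carrier G. h x \<in> M} G"
proof -
  interpret M: subgroup M H by fact
  show ?thesis by (rule G.subgroupI) (auto intro: exI[of _ \<one>])
qed

lemma normal_vimage:
  assumes "M \<lhd> H" shows "{x \<in> carrier G. h x \<in> M} \<lhd> G"
proof -
  interpret M: normal M H by fact
  show ?thesis unfolding G.normal_inv_iff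
    using subgroup_vimage[OF M.is_subgroup] M.inv_op_closed2 by auto
qed

lemma card_image_subgroup:
  assumes "subgroup A G" "Ker \<subseteq> A" "finite (carrier G)"
  shows "card A = card (h ` A) * card Ker"
proof -
  interpret A: subgroup A G by fact
  have "{x \<in> carrier G. h x \<in> h ` A} = A"
  proof safe
    fix x a assume x: "x \<in> carrier G" "a \<in> A" "h x = h a"
    then have "x \<in> Ker #> a" using fibre[of a] A.subset by blast
    then show "x \<in> A" using assms(2) x(2) unfolding r_coset_def by auto
  qed (use A.subset in auto)
  moreover have "h ` A \<subseteq> carrier H" using A.subset surj by blast
  ultimately show ?thesis using card_vimage[of "h ` A"] assms(3) by simp
qed

end

text \<open>A supersolvable series that may stop below the whole group: every member is normal in
  all of \<open>G\<close>. Cyclicity of E / F is stated on elements (each \<open>y\<close> lies in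
  some F x^j), so neither a factor group nor an indexed family has to be carried through
  inductions.\<close>

inductive sschain :: "('a, 'b) monoid_scheme \<Rightarrow> 'a set \<Rightarrow> bool" for G (structure) where
  one: "sschain G {\<one>}"
| step: "\<lbrakk>sschain G F; E \<lhd> G; F \<subseteq> E; x \<in> E; \<And>y. y \<in> E \<Longrightarrow> \<exists>j::int. y \<in> F #> (x [^] j)\<rbrakk> \<Longrightarrow> sschain G E"

lemma (in group) sschain_normal: "sschain G E \<Longrightarrow> E \<lhd> G"
  by (induction rule: sschain.induct) (auto simp: one_is_normal)

lemma (in group) cyclic_factor_iff:
  assumes "F \<lhd> G" "E \<lhd> G" "F \<subseteq> E"
  shows "cyclic_group ((G\<lparr>carrier := E\<rparr>) Mod F) \<longleftrightarrow>
    (\<exists>x\<in>E. \<forall>y\<in>E. \<exists>j::int. y \<in> F #> (x [^] j))"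
proof -
  interpret E: normal E G by fact
  interpret F: normal F G by fact
  let ?K = "G\<lparr>carrier := E\<rparr>"
  interpret K: group ?K by (rule E.subgroup_is_group[OF is_group])
  have nF: "F \<lhd> ?K" using assms normal_restrict_supergroup E.is_subgroup by blast
  interpret FK: normal F ?K by (rule nF)
  interpret Q: group "?K Mod F" by (rule FK.factorgroup_is_group)
  have car: "carrier (?K Mod F) = (\<lambda>x. F #> x) ` E" by (simp add: carrier_FactGroup)
  have pw: "(F #> x) [^]\<^bsub>?K Mod F\<^esub> j = F #> (x [^] j)" if "x \<in> E" for x and j :: int
    using FK.FactGroup_int_pow[of x j] that int_pow_consistent[OF E.is_subgroup that, of j] by simp
  have sub: "E \<subseteq> carrier G" by (rule E.subset)
  have mem: "y \<in> F #> z \<longleftrightarrow> F #> y = F #> z" if "y \<in> carrier G" "z \<in> carrier G" for y z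
    using that repr_independence[OF _ _ F.is_subgroup] rcos_self F.is_subgroup by blast
  have xj: "x [^] j \<in> E" if "x \<in> E" for x and j :: int
    using that subgroup_int_pow_closed[OF E.is_subgroup] by blast
  let ?Q = "?K Mod F"
  show ?thesis unfolding Q.cyclic_group
  proof
    assume "\<exists>z\<in>carrier ?Q. carrier ?Q = range (\<lambda>n::int. (z [^]\<^bsub>?Q\<^esub> n))"
    then obtain x where x: "x \<in> E" "(\<lambda>x. F #> x) ` E = range (\<lambda>n::int. F #> (x [^] n))"
      by (auto simp: car pw)
    then show "\<exists>x\<in>E. \<forall>y\<in>E. \<exists>j::int. y \<in> F #> (x [^] j)"
    proof (intro bexI[OF _ x(1)] ballI)
      fix y assume y: "y \<in> E"
      then have "F #> y \<in> range (\<lambda>n::int. F #> (x [^] n))" using x(2) by blast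
      then show "\<exists>j::int. y \<in> F #> (x [^] j)" using mem[of y] sub xj[OF x(1)] y by auto
    qed
  next
    assume "\<exists>x\<in>E. \<forall>y\<in>E. \<exists>j::int. y \<in> F #> (x [^] j)"
    then obtain x where x: "x \<in> E" "\<And>y. y \<in> E \<Longrightarrow> \<exists>j::int. y \<in> F #> (x [^] j)" by auto
    have "(\<lambda>x. F #> x) ` E = range (\<lambda>n::int. F #> (x [^] n))"
    proof safe
      fix y assume "y \<in> E"
      then obtain j :: int where "y \<in> F #> (x [^] j)" using x(2) by blast
      then have "F #> y = F #> (x [^] j)" using mem sub xj[OF x(1)] \<open>y \<in> E\<close> by blast
      then show "F #> y \<in> range (\<lambda>n::int. F #> (x [^] n))" by auto
    qed (use xj[OF x(1)] in auto)
    then show "\<exists>z\<in>carrier ?Q. carrier ?Q = range (\<lambda>n::int. (z [^]\<^bsub>?Q\<^esub> n))"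
    proof (intro bexI[of _ "F #> x"])
      show "carrier ?Q = range (\<lambda>n::int. ((F #> x) [^]\<^bsub>?Q\<^esub> n))"
        unfolding pw[OF x(1)] car by fact
      show "F #> x \<in> carrier ?Q" unfolding car using x(1) by (rule imageI)
    qed
  qed
qed

lemma (in group) supersolvable_iff_sschain: "supersolvable G \<longleftrightarrow> sschain G (carrier G)"
proof
  assume "supersolvable G"
  then obtain H :: "nat \<Rightarrow> 'a set" and k where H: "H 0 = {\<one>}" "H k = carrier G" "\<forall>i\<le>k. H i \<lhd> G"
    "\<forall>i<k. H i \<subseteq> H (Suc i) \<and> cyclic_group ((G\<lparr>carrier := H (Suc i)\<rparr>) Mod (H i))"
    unfolding supersolvable_def by blast
  have "sschain G (H i)" if "i \<le> k" for i
    using that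
  proof (induction i)
    case 0 then show ?case using H(1) sschain.one by metis
  next
    case (Suc i)
    have "H i \<lhd> G" "H (Suc i) \<lhd> G" "H i \<subseteq> H (Suc i)" "cyclic_group ((G\<lparr>carrier := H (Suc i)\<rparr>) Mod (H i))"
      using H Suc by auto
    then show ?case using cyclic_factor_iff[of "H i" "H (Suc i)"] sschain.step[OF Suc.IH] Suc.prems by (metis Suc_leD)
  qed
  then show "sschain G (carrier G)" using H(2) by (metis order_refl)
next
  have "\<exists>(H::nat \<Rightarrow> 'a set) k. H 0 = {\<one>} \<and> H k = E \<and> (\<forall>i\<le>k. H i \<lhd> G) \<and>
        (\<forall>i<k. H i \<subseteq> H (Suc i) \<and> cyclic_group ((G\<lparr>carrier := H (Suc i)\<rparr>) Mod (H i)))" if "sschain G E" for E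
    using that
  proof (induction rule: sschain.induct)
    case one
    then show ?case by (intro exI[of _ "\<lambda>_. {\<one>}"] exI[of _ 0]) (auto simp: one_is_normal)
  next
    case (step F E x)
    then obtain H k where H: "H 0 = {\<one>}" "H k = F" "\<forall>i\<le>k. H i \<lhd> G"
      "\<forall>i<k. H i \<subseteq> H (Suc i) \<and> cyclic_group ((G\<lparr>carrier := H (Suc i)\<rparr>) Mod (H i))" by blast
    have cyc: "cyclic_group ((G\<lparr>carrier := E\<rparr>) Mod F)"
      using step sschain_normal[OF step(1)] by (subst cyclic_factor_iff) auto
    let ?H = "\<lambda>i. if i \<le> k then H i else E"
    have "?H 0 = {\<one>}" "?H (Suc k) = E" "\<forall>i\<le>Suc k. ?H i \<lhd> G" using H step by auto
    moreover have "\<forall>i<Suc k. ?H i \<subseteq> ?H (Suc i) \<and> cyclic_group ((G\<lparr>carrier := ?H (Suc i)\<rparr>) Mod (?H i))"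
      using H step(3) cyc by (auto simp: less_Suc_eq)
    ultimately show ?case by (intro exI[of _ ?H] exI[of _ "Suc k"]) (intro conjI)
  qed
  moreover assume "sschain G (carrier G)"
  ultimately show "supersolvable G" unfolding supersolvable_def by blast
qed

text \<open>The factors of the preimages are isomorphic to those of the chain in \<open>H\<close>, a
  lift of \<open>x\<close> serving as generator. The base \<open>{\<one>}\<close> pulls back to the
  kernel, so the given chain up to the kernel supplies the lower part.\<close>

lemma (in group_epi) sschain_vimage:
  assumes "sschain H M" "sschain G Ker"
  shows "sschain G {x \<in> carrier G. h x \<in> M}"
  using assms(1)
proof (induction rule: sschain.induct)
  case one
  have "{x \<in> carrier G. h x \<in> {\<one>\<^bsub>H\<^esub>}} = Ker" by (auto simp: kernel_def)
  then show ?case using assms(2) by simp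
next
  case (step F E x)
  interpret F: normal F H using H.sschain_normal[OF step(1)] .
  interpret E: normal E H by (rule step)
  obtain x' where x': "x' \<in> carrier G" "x = h x'" using step(4) E.subset surj by blast
  show ?case
  proof (rule sschain.step[where x = x'])
    show "sschain G {x \<in> carrier G. h x \<in> F}" by (rule step)
    show "{x \<in> carrier G. h x \<in> E} \<lhd> G" by (rule normal_vimage[OF step(2)])
    show "{x \<in> carrier G. h x \<in> F} \<subseteq> {x \<in> carrier G. h x \<in> E}" using step(3) by auto
    show "x' \<in> {x \<in> carrier G. h x \<in> E}" using step(4) x' by auto
    fix y assume y: "y \<in> {x \<in> carrier G. h x \<in> E}"
    then obtain j :: int where "h y \<in> F #>\<^bsub>H\<^esub> (x [^]\<^bsub>H\<^esub> j)" using step(5) by blast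
    then obtain f where f: "f \<in> F" "h y = f \<otimes>\<^bsub>H\<^esub> (x [^]\<^bsub>H\<^esub> j)" by (auto simp: r_coset_def)
    have fc: "f \<in> carrier H" using f(1) F.subset by blast
    have "h (y \<otimes> inv (x' [^] j)) = f"
      using f y x' fc by (simp add: hom_int_pow H.m_assoc)
    then have "y \<otimes> inv (x' [^] j) \<in> {x \<in> carrier G. h x \<in> F}" using f(1) y x'
      by (metis (mono_tags, lifting) G.int_pow_closed G.inv_closed G.m_closed mem_Collect_eq)
    moreover have "y = (y \<otimes> inv (x' [^] j)) \<otimes> x' [^] j"
      using y x'(1) by (simp only: mem_Collect_eq G.m_assoc G.int_pow_closed G.inv_closed G.l_inv G.r_one)
    ultimately show "\<exists>j::int. y \<in> {x \<in> carrier G. h x \<in> F} #> (x' [^] j)"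
      unfolding r_coset_def by blast
  qed
qed

text \<open>It would not be enough for the kernel to be supersolvable as a group: the chain below it
  must be normal in \<open>G\<close>. In every application the kernel is cyclic.\<close>

lemma (in group_epi) supersolvable_vimage:
  assumes "supersolvable H" "sschain G Ker"
  shows "supersolvable G"
proof -
  have "{x \<in> carrier G. h x \<in> carrier H} = carrier G" by auto
  then show ?thesis using sschain_vimage[of "carrier H"] assms
    by (simp add: G.supersolvable_iff_sschain H.supersolvable_iff_sschain)
qed

section \<open>The sum of element orders of a cyclic group\<close>

hide_const (open) Divisibility.prime

text \<open>The element order sum of C_n as a function of numbers: \<open>n div gcd n j\<close> is
  the order of \<open>j\<close> in Z / n.\<close>

definition cyc_psi :: "nat \<Rightarrow> nat" where
  "cyc_psi n = (\<Sum>j<n. n div gcd n j)"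

lemma (in group) pow_mod_ord:
  assumes "x \<in> carrier G" shows "x [^] (j mod ord x) = x [^] (j :: nat)"
proof -
  have "x [^] j = x [^] (ord x * (j div ord x) + j mod ord x)" by simp
  also have "\<dots> = (x [^] ord x) [^] (j div ord x) \<otimes> x [^] (j mod ord x)"
    using assms by (simp only: nat_pow_mult nat_pow_pow)
  finally show ?thesis using assms by simp
qed

lemma (in group) sum_ord_generate:
  assumes "x \<in> carrier G" "ord x > 0"
  shows "(\<Sum>y\<in>generate G {x}. ord y) = cyc_psi (ord x)"
proof -
  let ?d = "ord x"
  have gen: "generate G {x} = (\<lambda>j::nat. x [^] j) ` {..<?d}"
  proof -
    have "generate G {x} = range (\<lambda>j::nat. x [^] j)"
      using generate_pow_nat[OF assms(1)] assms(2) by auto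
    moreover have "x [^] j \<in> (\<lambda>j::nat. x [^] j) ` {..<?d}" for j :: nat
    proof (rule image_eqI)
      show "x [^] j = x [^] (j mod ?d)"
        using pow_mod_ord[OF assms(1)] by simp
    qed (use assms in auto)
    ultimately show ?thesis by auto
  qed
  have inj: "inj_on (\<lambda>j::nat. x [^] j) {..<?d}"
    using gen generate_pow_card[OF assms(1)] by (intro eq_card_imp_inj_on) auto
  have "(\<Sum>y\<in>generate G {x}. ord y) = (\<Sum>j<?d. ord (x [^] j))"
    unfolding gen by (subst sum.reindex[OF inj]) simp
  also have "\<dots> = cyc_psi ?d" unfolding cyc_psi_def
    using assms by (intro sum.cong) (auto simp: ord_pow_gen)
  finally show ?thesis .
qed

lemma psi_integer_mod_group:
  assumes "n > 0" shows "psi (integer_mod_group n) = cyc_psi n"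
proof -
  let ?Z = "integer_mod_group n"
  interpret Z: group ?Z by simp
  have one: "1 mod int n \<in> carrier ?Z" using assms by (simp add: carrier_integer_mod_group)
  have ord: "Z.ord (1 mod int n) = n"
    unfolding Z.ord_unique[OF one] using assms
    by (auto simp: mod_mult_right_eq mod_eq_0_iff_dvd)
  have "carrier ?Z = generate ?Z {1 mod int n}"
  proof -
    have "generate ?Z {1 mod int n} \<subseteq> carrier ?Z" using Z.generate_incl one by auto
    moreover have "card (carrier ?Z) = card (generate ?Z {1 mod int n})"
      using Z.generate_pow_card[OF one] ord assms by (simp add: carrier_integer_mod_group)
    moreover have "finite (carrier ?Z)" using assms by (simp add: carrier_integer_mod_group)
    ultimately show ?thesis by (metis card_subset_eq)
  qed
  then show ?thesis using Z.sum_ord_generate[OF one] ord assms by (simp add: psi_def)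
qed

lemma gcd_mult_coprime_nat:
  fixes m k j :: nat
  assumes "coprime m k" shows "gcd (m * k) j = gcd m j * gcd k j"
proof (rule dvd_antisym)
  have "coprime (gcd m j) (gcd k j)"
    using assms by (meson coprime_divisors gcd_dvd1)
  then show "gcd m j * gcd k j dvd gcd (m * k) j"
    by (auto intro!: divides_mult mult_dvd_mono)
  have "gcd m j * gcd k j = gcd (gcd m j * k) (gcd m j * j)"
    by (simp add: gcd_mult_distrib_nat)
  also have "\<dots> = gcd (gcd (k * m) (k * j)) (gcd (j * m) (j * j))"
    by (simp only: gcd_mult_distrib_nat mult.commute[of "gcd m j"])
  finally show "gcd (m * k) j dvd gcd m j * gcd k j"
    by (auto simp: mult.commute)
qed

text \<open>Chinese remainder theorem: \<open>j\<close> corresponds to its pair of residues, and the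
  order of \<open>j\<close> modulo m k is the product of the orders of the two residues.\<close>

lemma cyc_psi_mult:
  assumes "coprime m k" "m > 0" "k > 0"
  shows "cyc_psi (m * k) = cyc_psi m * cyc_psi k"
proof -
  let ?f = "\<lambda>j. (j mod m, j mod k)"
  have "bij_betw ?f {..<m * k} ({..<m} \<times> {..<k})"
  proof -
    have inj: "inj_on ?f {..<m * k}"
    proof (rule inj_onI)
      fix i j assume ij: "i \<in> {..<m * k}" "j \<in> {..<m * k}" "?f i = ?f j"
      then have "[i = j] (mod m)" "[i = j] (mod k)" by (auto simp: cong_def)
      then have "[i = j] (mod m * k)" using assms(1) by (rule coprime_cong_mult_nat)
      then show "i = j" using ij by (auto intro: cong_less_modulus_unique_nat)
    qed
    moreover have "?f ` {..<m * k} = {..<m} \<times> {..<k}"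
      using assms inj by (intro card_subset_eq) (auto simp: card_image)
    ultimately show ?thesis by (simp add: bij_betw_def)
  qed
  then have "cyc_psi m * cyc_psi k = (\<Sum>j<m * k. m div gcd m (j mod m) * (k div gcd k (j mod k)))"
    unfolding cyc_psi_def sum_product sum.cartesian_product
    by (subst sum.reindex_bij_betw[symmetric]) auto
  also have "\<dots> = cyc_psi (m * k)" unfolding cyc_psi_def
  proof (intro sum.cong refl)
    fix j
    have "gcd (m * k) j = gcd m j * gcd k j"
      by (rule gcd_mult_coprime_nat[OF assms(1)])
    moreover have "m div gcd m j * (k div gcd k j) = (m * k) div (gcd m j * gcd k j)"
      by (rule div_mult_div_if_dvd) auto
    ultimately show "m div gcd m (j mod m) * (k div gcd k (j mod k)) = m * k div gcd (m * k) j"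
      by (simp add: gcd_red_nat[symmetric] gcd.commute)
  qed
  finally show ?thesis by simp
qed

lemma cyc_psi_1 [simp]: "cyc_psi (Suc 0) = 1"
  by (simp add: cyc_psi_def)

text \<open>The multiples of \<open>p\<close> form the subgroup of index \<open>p\<close>, which
  contributes the previous value; all other residues are generators.\<close>

lemma cyc_psi_prime_power_Suc:
  assumes "prime p"
  shows "cyc_psi (p ^ Suc a) = cyc_psi (p ^ a) + (p - 1) * p ^ (2 * a + 1)"
proof -
  have p: "p > 0" using assms prime_gt_0_nat by blast
  let ?N = "p ^ Suc a" and ?M = "(\<lambda>i. p * i) ` {..<p ^ a}"
  have sub: "?M \<subseteq> {..<?N}" using p by auto
  have M: "j \<in> ?M" if "p dvd j" "j < ?N" for j
    using that p by (auto simp: dvd_def)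
  have inj: "inj_on (\<lambda>i. p * i) {..<p ^ a}" using p by (auto simp: inj_on_def)
  have "cyc_psi ?N = (\<Sum>j\<in>?M. ?N div gcd ?N j) + (\<Sum>j\<in>{..<?N} - ?M. ?N div gcd ?N j)"
    unfolding cyc_psi_def by (rule trans[OF sum.subset_diff[OF sub finite_lessThan] add.commute])
  also have "(\<Sum>j\<in>?M. ?N div gcd ?N j) = cyc_psi (p ^ a)"
    unfolding cyc_psi_def using p
    by (subst sum.reindex[OF inj]) (auto intro!: sum.cong simp: gcd_mult_distrib_nat[symmetric])
  also have "(\<Sum>j\<in>{..<?N} - ?M. ?N div gcd ?N j) = (\<Sum>j\<in>{..<?N} - ?M. ?N)"
  proof (intro sum.cong refl)
    fix j assume "j \<in> {..<?N} - ?M"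
    then have "\<not> p dvd j" using M by auto
    then have "coprime ?N j" using assms by (metis coprime_power_left_iff prime_imp_coprime)
    then have "gcd ?N j = 1" by (simp only: coprime_iff_gcd_eq_1)
    then show "?N div gcd ?N j = ?N" by simp
  qed
  also have "\<dots> = (?N - p ^ a) * ?N"
    using sub by (simp add: card_Diff_subset card_image[OF inj])
  also have "\<dots> = (p - 1) * p ^ (2 * a + 1)"
  proof -
    have "?N - p ^ a = (p - 1) * p ^ a" by (simp add: diff_mult_distrib)
    moreover have "p ^ a * ?N = p ^ (2 * a + 1)" by (simp add: mult_2 flip: power_add)
    ultimately show ?thesis by (simp only: mult.assoc)
  qed
  finally show ?thesis .
qed

lemma cyc_psi_prime_power:
  assumes "prime p"
  shows "real (cyc_psi (p ^ a)) = (real p ^ (2 * a + 1) + 1) / (real p + 1)"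
proof (induction a)
  case 0 then show ?case by simp
next
  case (Suc a)
  have p: "p \<ge> 1" using assms prime_gt_0_nat[of p] by simp
  show ?case unfolding cyc_psi_prime_power_Suc[OF assms] of_nat_add Suc using p
    by (simp add: field_simps of_nat_diff power_add power2_eq_square mult_2)
qed

text \<open>For a prime power, (q^(2a+1) + 1) / (q + 1) is at least q^(2a) times q / (q + 1). This
  also holds for a = 0, so \<open>S\<close> may contain primes that do not divide \<open>n\<close>;
  the bound is then merely weaker.\<close>

lemma cyc_psi_lower_bound:
  assumes "finite S" "\<And>p. p \<in> S \<Longrightarrow> prime p" "n > 0"
    "\<And>p. prime p \<Longrightarrow> p dvd n \<Longrightarrow> p \<in> S"
  shows "real (cyc_psi n) \<ge> real n ^ 2 * (\<Prod>p\<in>S. real p / (real p + 1))"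
  using assms
proof (induction S arbitrary: n rule: finite_induct)
  case empty
  then have "n = 1" using prime_factor_nat[of n] by blast
  then show ?case by simp
next
  case (insert q F)
  have q: "prime q" by (rule insert.prems(1)) simp
  obtain m a where m: "n = m * q ^ a" "\<not> q dvd m"
    using prime_power_canonical[OF q insert.prems(2)] by blast
  have m0: "m > 0" using m insert(5) by (cases m) auto
  have IH: "real (cyc_psi m) \<ge> real m ^ 2 * (\<Prod>p\<in>F. real p / (real p + 1))"
  proof (rule insert.IH)
    fix p assume p: "prime p" "p dvd m"
    then have "p \<in> insert q F" using insert.prems(3)[of p] m by auto
    then show "p \<in> F" using p m(2) by auto
  qed (use insert.prems m0 in auto)
  have "coprime m (q ^ a)" using prime_imp_power_coprime_nat[OF q m(2)] by (simp only: coprime_commute)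
  then have eq: "cyc_psi n = cyc_psi m * cyc_psi (q ^ a)"
    unfolding m(1) using m0 prime_gt_0_nat[OF q] by (intro cyc_psi_mult) auto
  have qa: "real (cyc_psi (q ^ a)) \<ge> real (q ^ a) ^ 2 * (real q / (real q + 1))"
    unfolding cyc_psi_prime_power[OF q]
    by (simp add: divide_right_mono power_add power_mult power2_eq_square mult.commute power_mult_distrib[symmetric])
  have "real n ^ 2 * (\<Prod>p\<in>insert q F. real p / (real p + 1)) =
    (real m ^ 2 * (\<Prod>p\<in>F. real p / (real p + 1))) * (real (q ^ a) ^ 2 * (real q / (real q + 1)))"
    using insert(1,2) m(1) by (simp add: power_mult_distrib)
  also have "\<dots> \<le> real (cyc_psi m) * real (cyc_psi (q ^ a))"
    using IH qa by (intro mult_mono) (auto intro!: mult_nonneg_nonneg prod_nonneg)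
  finally show ?case using eq by simp
qed

section \<open>The product of q / (q + 1) over odd primes\<close>

definition oprimes :: "nat \<Rightarrow> nat set" where
  "oprimes N = {p. prime p \<and> odd p \<and> p \<le> N}"

lemma finite_oprimes [simp]: "finite (oprimes N)"
  unfolding oprimes_def by (rule finite_subset[of _ "{..N}"]) auto

text \<open>A lower bound for \<psi>(C_n) / n^2 when \<open>n\<close> is odd and has no prime factor
  above \<open>N\<close>; a finite product of the kind studied by Mertens.\<close>

definition mertens :: "nat \<Rightarrow> real" where
  "mertens N = (\<Prod>p\<in>oprimes N. real p / (real p + 1))"

lemma mertens_pos: "mertens N > 0"
  unfolding mertens_def oprimes_def by (rule prod_pos) (auto dest: prime_gt_0_nat)

text \<open>Only N + 2 can be a new odd prime. If it is composite the product does not change, and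
  the claim holds because the extra factor is below 1.\<close>

lemma mertens_Suc_Suc:
  assumes "odd N" shows "mertens (N + 2) \<ge> mertens N * (real (N + 2) / real (N + 3))"
proof -
  have odd: "p \<le> N \<or> p = N + 2" if "p \<le> N + 2" "odd p" for p
    using that assms by (metis Suc_1 add_2_eq_Suc' even_Suc le_SucE)
  show ?thesis
  proof (cases "prime (N + 2)")
    case True
    then have "oprimes (N + 2) = insert (N + 2) (oprimes N)"
      unfolding oprimes_def using odd assms by auto
    moreover have "N + 2 \<notin> oprimes N" by (auto simp: oprimes_def)
    ultimately show ?thesis unfolding mertens_def by (simp add: algebra_simps)
  next
    case False
    then have "oprimes (N + 2) = oprimes N"
      unfolding oprimes_def using odd assms by auto
    then have "mertens (N + 2) = mertens N" by (simp add: mertens_def)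
    moreover have "mertens N * (real (N + 2) / real (N + 3)) \<le> mertens N * 1"
      using mertens_pos[of N] by (intro mult_left_mono) auto
    ultimately show ?thesis by simp
  qed
qed

lemma oprimes_small:
  "oprimes 5 = {3,5}" "oprimes 7 = {3,5,7}" "oprimes 9 = {3,5,7}"
proof -
  have "oprimes 9 = {p \<in> {..9}. prime p \<and> odd p}" by (auto simp: oprimes_def)
  also have "\<dots> = {p \<in> set [0..<10]. prime p \<and> odd p}" by auto
  also have "\<dots> = set (filter (\<lambda>p. prime p \<and> odd p) [0..<10])" by auto
  also have "[0..<10] = [0,1,2,3,4,5,6,7,8,9::nat]" by (simp add: upt_rec)
  finally show 9: "oprimes 9 = {3,5,7}" by (simp add: prime_nat_numeral_eq)
  have "oprimes N = {p \<in> oprimes 9. p \<le> N}" if "N \<le> 9" for N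
    using that by (auto simp: oprimes_def)
  then have "oprimes N = {p \<in> {3,5,7}. p \<le> N}" if "N \<le> 9" for N
    using that unfolding 9 by blast
  from this[of 5] this[of 7]
  show "oprimes 5 = {3,5}" "oprimes 7 = {3,5,7}" by auto
qed

lemma mertens_small: "mertens 5 = 5 / 8" "mertens 7 = 35 / 64" "mertens 9 = 35 / 64"
  by (simp_all add: mertens_def oprimes_small)

text \<open>The product telescopes, since \<^term>\<open>(q / (q + 1))\<^sup>2 \<ge> (q - 1) / (q + (1::real))\<close>.\<close>

lemma mertens_lower_bound:
  assumes "odd N" "N \<ge> 9"
  shows "mertens N ^ 2 * real (N + 1) \<ge> (35 / 64) ^ 2 * 10"
proof -
  have "mertens (9 + 2 * i) ^ 2 * real (9 + 2 * i + 1) \<ge> (35 / 64) ^ 2 * 10" for i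
  proof (induction i)
    case 0 then show ?case by (simp add: mertens_small)
  next
    case (Suc i)
    define M where "M = 9 + 2 * i"
    have M: "odd M" "9 + 2 * Suc i = M + 2" by (auto simp: M_def)
    have "mertens M ^ 2 * real (M + 1) \<le> mertens M ^ 2 * ((real (M + 2) / real (M + 3)) ^ 2 * real (M + 3))"
    proof (rule mult_left_mono)
      have "(real M + 1) * (real M + 3) \<le> (real M + 2) ^ 2" by (simp add: power2_eq_square algebra_simps)
      then show "real (M + 1) \<le> (real (M + 2) / real (M + 3)) ^ 2 * real (M + 3)"
        by (simp add: power_divide power2_eq_square[of "real M + 3"] pos_le_divide_eq add.commute)
    qed simp
    also have "\<dots> = (mertens M * (real (M + 2) / real (M + 3))) ^ 2 * real (M + 3)"
      by (simp only: power_mult_distrib mult.assoc)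
    also have "\<dots> \<le> mertens (M + 2) ^ 2 * real (M + 3)"
      using mertens_Suc_Suc[OF M(1)] mertens_pos[of M]
      by (intro mult_right_mono power_mono) auto
    finally show ?case using Suc unfolding M(2) M_def[symmetric] by (simp add: add.commute)
  qed
  from this[of "(N - 9) div 2"] show ?thesis using assms by (auto elim!: oddE)
qed

section \<open>Actions and Sylow subgroups\<close>

text \<open>The acting group is a subgroup of \<open>G\<close>, which covers the three uses: a Sylow
  subgroup on cosets of its normaliser, a cyclic subgroup on its own cosets, and
  conjugation.\<close>

locale finite_right_action = group G for G (structure) +
  fixes B :: "'a set" and E :: "'e set" and act :: "'e \<Rightarrow> 'a \<Rightarrow> 'e"
  assumes subgroup_B: "subgroup B G" and finite_B: "finite B" and finite_E: "finite E"
    and act_closed: "\<lbrakk>e \<in> E; b \<in> B\<rbrakk> \<Longrightarrow> act e b \<in> E"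
    and act_one: "e \<in> E \<Longrightarrow> act e \<one> = e"
    and act_mult: "\<lbrakk>e \<in> E; b \<in> B; c \<in> B\<rbrakk> \<Longrightarrow> act (act e b) c = act e (b \<otimes> c)"
begin

sublocale B: subgroup B G by (rule subgroup_B)

definition orb :: "'e \<Rightarrow> 'e set" where "orb e = act e ` B"
definition stab :: "'e \<Rightarrow> 'a set" where "stab e = {b \<in> B. act e b = e}"
definition fixpoints :: "'e set" where "fixpoints = {e \<in> E. \<forall>b\<in>B. act e b = e}"

lemma act_inv: "\<lbrakk>e \<in> E; b \<in> B\<rbrakk> \<Longrightarrow> act (act e b) (inv b) = e"
  by (simp add: act_mult act_one)

lemma orb_eq:
  assumes "e \<in> E" "f \<in> orb e" shows "orb f = orb e"
proof -
  obtain b where b: "b \<in> B" "f = act e b" using assms(2) by (auto simp: orb_def)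
  have "act f c \<in> orb e" if "c \<in> B" for c
    using that b assms by (auto simp: orb_def act_mult)
  moreover have "act e c \<in> orb f" if "c \<in> B" for c
  proof -
    have "act f (inv b \<otimes> c) = act (act (act e b) (inv b)) c"
      unfolding b(2) by (rule act_mult[symmetric]) (use that b assms act_closed in auto)
    also have "\<dots> = act e c" using b assms by (simp add: act_inv)
    finally show ?thesis using that b unfolding orb_def by (metis B.m_closed B.m_inv_closed image_eqI)
  qed
  ultimately show ?thesis by (auto simp: orb_def)
qed

lemma orb_self: "e \<in> E \<Longrightarrow> e \<in> orb e"
  unfolding orb_def using act_one B.one_closed by (metis image_eqI)

lemma subgroup_stab: "e \<in> E \<Longrightarrow> subgroup (stab e) G"
proof (rule subgroupI)
  fix a assume e: "e \<in> E" and a: "a \<in> stab e"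
  then have "act e (inv a) = act (act e a) (inv a)" by (simp add: stab_def)
  also have "\<dots> = e" using e a unfolding stab_def by (intro act_inv) auto
  finally show "inv a \<in> stab e" using a by (simp add: stab_def)
next
  fix a b assume "e \<in> E" "a \<in> stab e" "b \<in> stab e"
  then show "a \<otimes> b \<in> stab e" by (auto simp: stab_def simp flip: act_mult)
next
  assume "e \<in> E"
  then have "\<one> \<in> stab e" by (simp add: stab_def act_one)
  then show "stab e \<noteq> {}" by blast
qed (auto simp: stab_def)

lemma card_orb_stab:
  assumes e: "e \<in> E" shows "card (orb e) * card (stab e) = card B"
proof -
  have fib: "card {b \<in> B. act e b = f} = card (stab e)" if f: "f \<in> orb e" for f
  proof -
    obtain c where c: "c \<in> B" "f = act e c" using f by (auto simp: orb_def)
    have "{b \<in> B. act e b = f} = (\<lambda>s. s \<otimes> c) ` stab e"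
    proof safe
      fix b assume b: "b \<in> B" "f = act e b"
      then have "act e (b \<otimes> inv c) = act (act e c) (inv c)"
        using c e act_mult[of e b "inv c"] by simp
      then have "b \<otimes> inv c \<in> stab e" using b c e by (simp add: stab_def act_inv)
      moreover have "b = b \<otimes> inv c \<otimes> c" using b c by (simp add: m_assoc)
      ultimately show "b \<in> (\<lambda>s. s \<otimes> c) ` stab e" by blast
    qed (use c e in \<open>auto simp: stab_def simp flip: act_mult\<close>)
    moreover have "inj_on (\<lambda>s. s \<otimes> c) (stab e)"
      using c by (auto simp: inj_on_def stab_def)
    ultimately show ?thesis by (simp add: card_image)
  qed
  have "B = (\<Union>f\<in>orb e. {b \<in> B. act e b = f})" by (auto simp: orb_def)
  then have "card B = card (\<Union>f\<in>orb e. {b \<in> B. act e b = f})" by simp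
  also have "\<dots> = (\<Sum>f\<in>orb e. card {b \<in> B. act e b = f})"
    using finite_B by (intro card_UN_disjoint) (auto simp: orb_def)
  also have "\<dots> = card (orb e) * card (stab e)" by (simp add: fib)
  finally show ?thesis by simp
qed

text \<open>An invariant set is a disjoint union of orbits. Besides the fixed point congruence, this
  gives that cosets with orbit length \<open>s\<close> come in multiples of
  \<open>s\<close>.\<close>

lemma dvd_card_invariant:
  assumes "S \<subseteq> E" "\<And>e b. e \<in> S \<Longrightarrow> b \<in> B \<Longrightarrow> act e b \<in> S" "\<And>e. e \<in> S \<Longrightarrow> q dvd card (orb e)"
  shows "q dvd card S"
proof -
  have U: "\<Union> (orb ` S) = S"
  proof
    show "\<Union> (orb ` S) \<subseteq> S" using assms(2) by (auto simp: orb_def)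
    show "S \<subseteq> \<Union> (orb ` S)" using assms(1) orb_self by auto
  qed
  have "q dvd card (\<Union> (orb ` S))"
  proof (rule dvd_partition)
    show "finite (\<Union> (orb ` S))" using U assms(1) finite_E finite_subset by metis
    show "\<forall>c\<in>orb ` S. q dvd card c" using assms(3) by auto
    show "\<forall>c1\<in>orb ` S. \<forall>c2\<in>orb ` S. c1 \<noteq> c2 \<longrightarrow> c1 \<inter> c2 = {}"
    proof (intro ballI impI)
      fix c1 c2 assume c: "c1 \<in> orb ` S" "c2 \<in> orb ` S" "c1 \<noteq> c2"
      then obtain e1 e2 where e: "e1 \<in> S" "e2 \<in> S" "c1 = orb e1" "c2 = orb e2" by auto
      show "c1 \<inter> c2 = {}" using orb_eq[of e1] orb_eq[of e2] e c(3) assms(1) by blast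
    qed
  qed
  then show ?thesis using U by simp
qed

text \<open>Every orbit outside the fixed points has a length that divides p^a and is not 1, hence
  is divisible by \<open>p\<close>.\<close>

lemma card_fixpoints_mod:
  assumes "prime p" "card B = p ^ a"
  shows "card E mod p = card fixpoints mod p"
proof -
  have "p dvd card (E - fixpoints)"
  proof (rule dvd_card_invariant)
    fix e b assume eb: "e \<in> E - fixpoints" "b \<in> B"
    have "act e b \<notin> fixpoints"
    proof
      assume f: "act e b \<in> fixpoints"
      then have "act (act e b) (inv b) = act e b" using eb by (simp add: fixpoints_def)
      then have "act e b = e" using eb act_inv by auto
      then show False using f eb by auto
    qed
    then show "act e b \<in> E - fixpoints" using eb act_closed by auto
  next
    fix e assume e: "e \<in> E - fixpoints"
    have dvd: "card (orb e) dvd p ^ a" using card_orb_stab[of e] e assms(2) by (metis DiffD1 dvd_triv_left)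
    have "card (orb e) \<noteq> 1"
    proof
      assume "card (orb e) = 1"
      then obtain f where "orb e = {f}" by (auto simp: card_1_singleton_iff)
      then have "act e b = e" if "b \<in> B" for b
        using orb_self[of e] e that unfolding orb_def by (metis DiffD1 image_eqI singletonD)
      then show False using e by (auto simp: fixpoints_def)
    qed
    moreover obtain i where i: "card (orb e) = p ^ i"
      using dvd divides_primepow_nat[OF assms(1)] by blast
    ultimately have "i \<noteq> 0" by auto
    then show "p dvd card (orb e)" using i by simp
  qed auto
  then obtain q where "card (E - fixpoints) = p * q" by (auto elim!: dvdE)
  moreover have "card E = card (E - fixpoints) + card fixpoints"
    using finite_E by (subst card_Diff_subset) (auto simp: fixpoints_def card_mono finite_subset)
  ultimately show ?thesis by simp
qed

end

section \<open>Coset actions, normalisers, Sylow numbers and p-groups\<close>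

context group
begin

lemma finite_subgroup: "finite (carrier G) \<Longrightarrow> subgroup H G \<Longrightarrow> finite H"
  by (meson finite_subset subgroup.subset)

lemma coset_action:
  assumes "finite (carrier G)" "subgroup M G" "subgroup B G"
  shows "finite_right_action G B (rcosets M) (\<lambda>C b. C #> b)"
proof -
  interpret M: subgroup M G by fact
  interpret B: subgroup B G by fact
  show ?thesis
  proof unfold_locales
    show "finite (rcosets M)" using assms(1) by (simp add: RCOSETS_def)
    show "finite B" using finite_subgroup assms by auto
    fix C b c assume C: "C \<in> rcosets M"
    then obtain g where g: "g \<in> carrier G" "C = M #> g" by (auto simp: RCOSETS_def)
    show "C #> \<one> = C" using g by (simp add: coset_mult_assoc M.subset)
    assume b: "b \<in> B"
    then have bc: "b \<in> carrier G" using B.subset by auto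
    show "C #> b \<in> rcosets M" using g bc by (simp add: coset_mult_assoc M.subset rcosetsI)
    assume "c \<in> B"
    then have "c \<in> carrier G" using B.subset by auto
    then show "C #> b #> c = C #> (b \<otimes> c)"
      using g bc by (simp add: coset_mult_assoc M.subset m_assoc)
  qed
qed

lemma rcoset_fixed_iff:
  assumes "subgroup M G" "g \<in> carrier G" "b \<in> carrier G"
  shows "M #> g #> b = M #> g \<longleftrightarrow> g \<otimes> b \<otimes> inv g \<in> M"
proof -
  interpret M: subgroup M G by fact
  have "M #> g #> b = M #> g \<longleftrightarrow> M #> (g \<otimes> b) = M #> g"
    using assms by (simp add: coset_mult_assoc M.subset)
  also have "\<dots> \<longleftrightarrow> g \<otimes> b \<in> M #> g"
    using assms repr_independence[of "g \<otimes> b" M g] rcos_self[of "g \<otimes> b" M] by auto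
  also have "\<dots> \<longleftrightarrow> g \<otimes> b \<otimes> inv g \<in> M"
    using assms M.rcos_module[OF is_group, of g "g \<otimes> b"] by auto
  finally show ?thesis .
qed

lemma lagrange_subgroup:
  assumes "subgroup S G" "subgroup M G" "S \<subseteq> M"
  shows "card ((\<lambda>g. S #> g) ` M) * card S = card M"
proof -
  interpret M: subgroup M G by fact
  interpret K: group "G\<lparr>carrier := M\<rparr>" by (rule M.subgroup_is_group[OF is_group])
  have "rcosets\<^bsub>G\<lparr>carrier := M\<rparr>\<^esub> S = (\<lambda>g. S #> g) ` M" by (auto simp: RCOSETS_def)
  then show ?thesis using K.lagrange[OF subgroup_incl[OF assms]] by (simp add: order_def)
qed

lemma conj_pow:
  assumes "g \<in> carrier G" "b \<in> carrier G"
  shows "(g \<otimes> b \<otimes> inv g) [^] (i::nat) = g \<otimes> b [^] i \<otimes> inv g"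
proof (induction i)
  case 0 then show ?case using assms by simp
next
  case (Suc i)
  have "(g \<otimes> b [^] i \<otimes> inv g) \<otimes> (g \<otimes> b \<otimes> inv g) = g \<otimes> b [^] i \<otimes> (inv g \<otimes> g) \<otimes> b \<otimes> inv g"
    using assms by (simp only: m_assoc m_closed inv_closed nat_pow_closed)
  also have "\<dots> = g \<otimes> b [^] Suc i \<otimes> inv g" using assms by (simp add: m_assoc)
  finally show ?case using Suc by simp
qed

text \<open>An inclusion in place of \<open>g P g\<inverse> = P\<close>; the two agree for finite \<open>P\<close> only.\<close>

definition nmz :: "'a set \<Rightarrow> 'a set" where
  "nmz P = {g \<in> carrier G. \<forall>x\<in>P. g \<otimes> x \<otimes> inv g \<in> P}"

lemma subgroup_nmz:
  assumes "P \<subseteq> carrier G" "finite P" shows "subgroup (nmz P) G"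
proof (rule subgroupI)
  show "nmz P \<noteq> {}" using assms(1) by (auto simp: nmz_def intro!: exI[of _ \<one>])
  fix a b assume a: "a \<in> nmz P"
  have ac: "a \<in> carrier G" using a by (simp add: nmz_def)
  show "inv a \<in> nmz P"
  proof -
    let ?c = "\<lambda>x. a \<otimes> x \<otimes> inv a"
    \<comment> \<open>Conjugation by \<open>a\<close> is an injective self-map of the finite set
      \<open>P\<close>, hence onto; this is what makes \<open>inv a\<close> normalise
      \<open>P\<close> as well.\<close>
    have "inj_on ?c P"
      by (rule inj_onI) (metis ac assms(1) inv_closed l_cancel m_closed r_cancel subsetD)
    moreover have "?c ` P \<subseteq> P" using a by (auto simp: nmz_def)
    ultimately have surj: "?c ` P = P" using assms(2) by (simp add: endo_inj_surj)
    have "inv a \<otimes> x \<otimes> inv (inv a) \<in> P" if "x \<in> P" for x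
    proof -
      obtain y where y: "y \<in> P" "x = ?c y" using surj \<open>x \<in> P\<close> by blast
      have yc: "y \<in> carrier G" using y assms(1) by auto
      have "inv a \<otimes> (a \<otimes> y \<otimes> inv a) \<otimes> a = (inv a \<otimes> a) \<otimes> y \<otimes> (inv a \<otimes> a)"
        using ac yc by (simp only: m_assoc m_closed inv_closed)
      then show ?thesis using y ac yc by simp
    qed
    then show ?thesis using ac by (simp add: nmz_def)
  qed
  assume b: "b \<in> nmz P"
  have bc: "b \<in> carrier G" using b by (simp add: nmz_def)
  have "a \<otimes> b \<otimes> x \<otimes> inv (a \<otimes> b) \<in> P" if "x \<in> P" for x
  proof -
    have xc: "x \<in> carrier G" using that assms(1) by auto
    have "a \<otimes> b \<otimes> x \<otimes> inv (a \<otimes> b) = a \<otimes> (b \<otimes> x \<otimes> inv b) \<otimes> inv a"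
      using ac bc xc by (simp add: m_assoc inv_mult_group)
    then show ?thesis using that a b by (simp add: nmz_def)
  qed
  then show "a \<otimes> b \<in> nmz P" using ac bc by (simp add: nmz_def)
qed (auto simp: nmz_def)

lemma subgroup_subset_nmz: "subgroup P G \<Longrightarrow> P \<subseteq> nmz P"
  by (auto simp: nmz_def subgroup.mem_carrier intro!: subgroup.m_closed subgroup.m_inv_closed)

lemma nmz_eq_carrier: "subgroup P G \<Longrightarrow> nmz P = carrier G \<Longrightarrow> P \<lhd> G"
  unfolding normal_inv_iff nmz_def by blast

lemma pow_card_subgroup:
  assumes "subgroup S G" "y \<in> S" shows "y [^] card S = \<one>"
proof -
  interpret S: subgroup S G by fact
  interpret K: group "G\<lparr>carrier := S\<rparr>" by (rule S.subgroup_is_group[OF is_group])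
  show ?thesis using K.pow_order_eq_1[of y] assms(2)
    by (simp add: order_def nat_pow_consistent[symmetric])
qed

lemma pow_index_normal:
  assumes "S \<lhd> G" "finite (carrier G)" "y \<in> carrier G" "order G = card S * m"
  shows "y [^] m \<in> S"
proof -
  obtain H :: "'a monoid" and h where h: "group_epi G H h" "kernel G H h = S"
    using quotient_epi[OF assms(1)] .
  interpret h: group_epi G H h by fact
  have "card S > 0" using assms(1,2) normal_imp_subgroup subgroup.finite_imp_card_positive by blast
  then have m: "order H = m" using h.order_epi[OF assms(2)] h(2) assms(4) by (simp add: mult.commute)
  have "h (y [^] m) = h y [^]\<^bsub>H\<^esub> m" using assms(3) by (rule h.hom_nat_pow)
  also have "\<dots> = \<one>\<^bsub>H\<^esub>" using h.H.pow_order_eq_1[of "h y"] assms(3) m by simp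
  finally show ?thesis using h(2) assms(3) by (auto simp: kernel_def)
qed

lemma pow_index_subgroup:
  assumes "subgroup S G" "subgroup M G" "S \<subseteq> M" "finite (carrier G)" "y \<in> M" "M \<subseteq> nmz S" "card M = card S * m"
  shows "y [^] m \<in> S"
proof -
  interpret M: subgroup M G by fact
  interpret K: group "G\<lparr>carrier := M\<rparr>" by (rule M.subgroup_is_group[OF is_group])
  have "subgroup S (G\<lparr>carrier := M\<rparr>)" using subgroup_incl[OF assms(1,2,3)] .
  moreover have "inv\<^bsub>G\<lparr>carrier := M\<rparr>\<^esub> x = inv x" if "x \<in> M" for x
    using that assms(2) by (simp add: m_inv_consistent)
  ultimately have "S \<lhd> G\<lparr>carrier := M\<rparr>"
    unfolding K.normal_inv_iff using assms(6) by (auto simp: nmz_def)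
  then have "y [^]\<^bsub>G\<lparr>carrier := M\<rparr>\<^esub> m \<in> S"
    using assms finite_subgroup[OF assms(4,2)] by (intro K.pow_index_normal) (auto simp: order_def)
  then show ?thesis by (simp add: nat_pow_consistent[symmetric])
qed

lemma coprime_pow_mem:
  assumes "subgroup S G" "y \<in> carrier G" "y [^] (i::nat) \<in> S" "y [^] (j::nat) \<in> S" "coprime i j"
  shows "y \<in> S"
\<comment> \<open>For i = 0 coprimality forces j = 1. The case is split off because
  \<open>bezout_nat\<close> needs a nonzero first argument.\<close>
proof (cases "i = 0")
  case True
  then show ?thesis using assms by simp
next
  case False
  obtain u v where "u * i = v * j + gcd i j" using bezout_nat[OF False, of j] by (metis mult.commute)
  then have uv: "i * u = j * v + 1" using assms(5) by (simp add: mult.commute)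
  interpret S: subgroup S G by fact
  have mem: "(y [^] i) [^] u \<in> S" "(y [^] j) [^] v \<in> S"
    using assms(3,4) subgroup_int_pow_closed[OF assms(1)] by (metis int_pow_int)+
  have "(y [^] i) [^] u = (y [^] j) [^] v \<otimes> y"
    using assms(2) uv by (simp add: nat_pow_pow)
  then have "y = inv ((y [^] j) [^] v) \<otimes> (y [^] i) [^] u"
    using assms(2) by (simp add: inv_solve_left)
  then show ?thesis using mem by (metis S.m_closed S.m_inv_closed)
qed

text \<open>\<open>P\<close> acts on the cosets of its normaliser N, and N itself is the only fixed
  point: if N g is fixed, each conjugate g b g^-1 lies in N; its power with exponent |N : P| lies in
  \<open>P\<close>, and so does its power with exponent p^a, which is 1. The exponents are coprime,
  so the conjugate lies in \<open>P\<close> and g is in N.\<close>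

theorem sylow_index_mod:
  assumes fin: "finite (carrier G)" and P: "subgroup P G" "card P = p ^ a" "prime p"
    and n: "order G = p ^ a * m" "\<not> p dvd m"
  shows "card (rcosets (nmz P)) mod p = 1" "card (rcosets (nmz P)) dvd m"
proof -
  interpret P: subgroup P G by fact
  note N = subgroup_nmz[OF P.subset finite_subgroup[OF fin P(1)]]
  interpret N: subgroup "nmz P" G by (rule N)
  interpret A: finite_right_action G P "rcosets (nmz P)" "\<lambda>C b. C #> b"
    by (rule coset_action[OF fin N P(1)])
  have "card (nmz P) dvd p ^ a * m" using lagrange[OF N] n(1) by (metis dvd_triv_right)
  moreover have "p ^ a dvd card (nmz P)"
    using lagrange_subgroup[OF P(1) N subgroup_subset_nmz[OF P(1)]] P(2) by (metis dvd_triv_right)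
  ultimately have "\<exists>k. card (nmz P) = card P * k \<and> k dvd m"
  proof -
    assume *: "card (nmz P) dvd p ^ a * m" "p ^ a dvd card (nmz P)"
    then obtain k where k: "card (nmz P) = p ^ a * k" by (auto elim!: dvdE)
    moreover have "k dvd m" using *(1) prime_gt_0_nat[OF P(3)] unfolding k by simp
    ultimately show ?thesis using P(2) by auto
  qed
  then obtain k where k: "card (nmz P) = card P * k" "k dvd m" by blast
  have cop: "coprime (p ^ a) k"
    using k(2) n(2) P(3) by (metis coprime_power_left_iff dvd_trans prime_imp_coprime)
  have "A.fixpoints = {nmz P}"
  proof (intro equalityI subsetI)
    fix C assume C: "C \<in> A.fixpoints"
    then have "C \<in> rcosets (nmz P)" by (simp add: A.fixpoints_def)
    then obtain g where g: "g \<in> carrier G" "C = nmz P #> g" by (auto simp: RCOSETS_def)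
    have "g \<otimes> b \<otimes> inv g \<in> P" if b: "b \<in> P" for b
    proof -
      have bc: "b \<in> carrier G" using b P.subset by auto
      let ?y = "g \<otimes> b \<otimes> inv g"
      have y: "?y \<in> nmz P" using C b g rcoset_fixed_iff[OF N g(1) bc] by (simp add: A.fixpoints_def)
      have yk: "?y [^] k \<in> P"
        by (rule pow_index_subgroup[OF P(1) N subgroup_subset_nmz[OF P(1)] fin y _ k(1)]) simp
      have "?y [^] (p ^ a) = \<one>"
        using conj_pow[OF g(1) bc, of "p ^ a"] pow_card_subgroup[OF P(1) b] P(2) g by simp
      then have "?y [^] (p ^ a) \<in> P" by (simp only: P.one_closed)
      moreover have "?y \<in> carrier G" using g(1) bc by blast
      ultimately show ?thesis using yk coprime_pow_mem[OF P(1) _ _ _ cop] by blast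
    qed
    then have "g \<in> nmz P" using g(1) unfolding nmz_def by blast
    then show "C \<in> {nmz P}" using g by (simp add: N.rcos_const[OF is_group])
  next
    fix C assume "C \<in> {nmz P}"
    moreover
    have "nmz P #> b = nmz P" if "b \<in> P" for b
      using that subgroup_subset_nmz[OF P(1)] by (auto intro!: N.rcos_const[OF is_group])
    ultimately show "C \<in> A.fixpoints"
      unfolding A.fixpoints_def using N.subgroup_in_rcosets[OF is_group] by simp
  qed
  then show "card (rcosets (nmz P)) mod p = 1"
    using A.card_fixpoints_mod[OF P(3,2)] prime_gt_1_nat[OF P(3)] by simp
  have "card (rcosets (nmz P)) * k * p ^ a = m * p ^ a"
    using lagrange[OF N] k(1) n(1) P(2) by (simp add: ac_simps)
  then show "card (rcosets (nmz P)) dvd m"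
    using prime_gt_0_nat[OF P(3)] by (metis dvd_triv_left mult_cancel2 power_eq_0_iff not_gr_zero)
qed

lemma nmz_index_1:
  assumes "finite (carrier G)" "subgroup P G" "card (rcosets (nmz P)) = 1"
  shows "P \<lhd> G"
proof -
  have N: "subgroup (nmz P) G"
    using subgroup_nmz finite_subgroup assms subgroup.subset by metis
  have "card (nmz P) = card (carrier G)" using lagrange[OF N] assms(3) by (simp add: order_def)
  then have "nmz P = carrier G" using assms(1) by (intro card_subset_eq) (auto simp: nmz_def)
  then show ?thesis using nmz_eq_carrier assms(2) by blast
qed

lemma sylow_normal:
  assumes fin: "finite (carrier G)" and P: "subgroup P G" "card P = p ^ a" "prime p"
    and n: "order G = p ^ a * m" "\<not> p dvd m" "\<And>d. d dvd m \<Longrightarrow> d mod p = 1 \<Longrightarrow> d = 1"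
  shows "P \<lhd> G"
  using n(3) sylow_index_mod[OF fin P n(1,2)] nmz_index_1[OF fin P(1)] by blast

text \<open>The fixed points of conjugation are the centre, whose order is divisible by
  \<open>p\<close>.\<close>

lemma center_p_group:
  assumes fin: "finite (carrier G)" and n: "order G = p ^ a" "prime p" "a > 0"
  obtains z where "z \<in> carrier G" "z \<noteq> \<one>" "\<And>g. g \<in> carrier G \<Longrightarrow> g \<otimes> z = z \<otimes> g"
proof -
  interpret A: finite_right_action G "carrier G" "carrier G" "\<lambda>e b. inv b \<otimes> e \<otimes> b"
    by unfold_locales (auto simp: fin subgroup_self m_assoc inv_mult_group)
  have o: "card (carrier G) = p ^ a" using n(1) unfolding order_def .
  then have "p dvd card (carrier G)" using n(3) by (simp add: dvd_power)
  then have dvd: "p dvd card A.fixpoints"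
    using A.card_fixpoints_mod[OF n(2) o] by (simp only: dvd_eq_mod_eq_0)
  have "finite A.fixpoints" using fin by (simp add: A.fixpoints_def)
  moreover have one: "\<one> \<in> A.fixpoints" by (simp add: A.fixpoints_def)
  ultimately have "card A.fixpoints \<ge> p" using dvd by (auto intro!: dvd_imp_le simp: card_gt_0_iff)
  then have "A.fixpoints \<noteq> {\<one>}" using prime_gt_1_nat[OF n(2)] by auto
  then obtain z where z: "z \<in> A.fixpoints" "z \<noteq> \<one>" using one by auto
  have "g \<otimes> z = z \<otimes> g" if "g \<in> carrier G" for g
  proof -
    have "inv g \<otimes> z \<otimes> g = z" "z \<in> carrier G" using z that by (auto simp: A.fixpoints_def)
    then show ?thesis using that by (metis inv_solve_left m_assoc m_closed inv_closed)
  qed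
  then show ?thesis using that z by (auto simp: A.fixpoints_def)
qed

lemma sschain_generate:
  assumes "finite (carrier G)" "x \<in> carrier G" "generate G {x} \<lhd> G"
  shows "sschain G (generate G {x})"
proof (rule sschain.step[OF sschain.one assms(3)])
  interpret N: normal "generate G {x}" G by fact
  show "{\<one>} \<subseteq> generate G {x}" by simp
  show "x \<in> generate G {x}" by (simp add: generate.incl)
  fix y assume y: "y \<in> generate G {x}"
  then obtain j :: int where j: "y = x [^] j" using generate_pow[OF assms(2)] by auto
  then show "\<exists>j::int. y \<in> {\<one>} #> x [^] j" using assms(2) by (auto simp: r_coset_def)
qed

text \<open>Generated by a central element, the subgroup is both normal and cyclic, so it can be the
  bottom step of a chain.\<close>

lemma normal_central_p_group:
  assumes fin: "finite (carrier G)" and n: "order G = p ^ a" "prime p" "a > 0"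
  obtains N where "N \<lhd> G" "sschain G N" "card N \<noteq> 1"
proof -
  obtain z where z: "z \<in> carrier G" "z \<noteq> \<one>" "\<And>g. g \<in> carrier G \<Longrightarrow> g \<otimes> z = z \<otimes> g"
    using center_p_group[OF assms] by blast
  let ?Z = "generate G {z}"
  have sub: "subgroup ?Z G" using z by (intro generate_is_subgroup) auto
  have nrm: "?Z \<lhd> G" unfolding normal_inv_iff
  proof (intro conjI sub ballI)
    fix g y assume g: "g \<in> carrier G" and y: "y \<in> ?Z"
    then obtain j :: nat where j: "y = z [^] j"
      using generate_pow_nat[OF z(1)] ord_ge_1[OF fin z(1)] by auto
    have "g \<otimes> z [^] i = z [^] i \<otimes> g" for i :: nat
    proof (induction i)
      case (Suc i)
      have "g \<otimes> z [^] Suc i = z [^] i \<otimes> (g \<otimes> z)" using Suc z(1) g by (simp flip: m_assoc)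
      then show ?case using z(1) z(3)[OF g] g by (simp add: m_assoc)
    qed (use g in simp)
    then have "g \<otimes> y \<otimes> inv g = y" using j g z(1) by (simp add: m_assoc)
    then show "g \<otimes> y \<otimes> inv g \<in> ?Z" using y by simp
  qed
  have "card ?Z \<noteq> 1"
  proof
    assume "card ?Z = 1"
    then obtain u where "?Z = {u}" by (auto simp: card_1_singleton_iff)
    moreover have "z \<in> ?Z" "\<one> \<in> ?Z" by (auto simp: generate.incl generate.one)
    ultimately show False using z(2) by auto
  qed
  then show ?thesis using that nrm sschain_generate[OF fin z(1) nrm] by blast
qed

end

lemma p_group_supersolvable:
  fixes G :: "'a monoid"
  assumes "group G" "finite (carrier G)" "order G = p ^ a" "prime p"
  shows "supersolvable G"
  using assms(1-3)
proof (induction a arbitrary: G rule: less_induct)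
  case (less a)
  interpret group G by (rule less.prems)
  show ?case
  proof (cases "a = 0")
    case True
    then have "carrier G = {\<one>\<^bsub>G\<^esub>}" using less.prems order_one_triv_iff by simp
    then show ?thesis unfolding supersolvable_iff_sschain using sschain.one[of G] by simp
  next
    case False
    then obtain N where N: "N \<lhd> G" "sschain G N" "card N \<noteq> 1"
      using normal_central_p_group[OF less.prems(2,3) assms(4)] by blast
    obtain H :: "'a monoid" and h where h: "group_epi G H h" "kernel G H h = N"
      using quotient_epi[OF N(1)] .
    interpret h: group_epi G H h by fact
    have o: "order G = order H * card N" using h.order_epi[OF less.prems(2)] h(2) by simp
    then have "order H dvd p ^ a" using less.prems(3) by (metis dvd_triv_left)
    then obtain b where b: "b \<le> a" "order H = p ^ b" using divides_primepow_nat[OF assms(4)] by blast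
    have "b \<noteq> a" using o b(2) less.prems(3) prime_gt_0_nat[OF assms(4)] N(3) by auto
    then have "supersolvable H"
      using b less.IH[of b H] h.finite_image[OF less.prems(2)] h.H.group_axioms by auto
    then show ?thesis using h.supersolvable_vimage h(2) N(2) by simp
  qed
qed

section \<open>Cyclic subgroups and their cosets\<close>

text \<open>Every fibre is a coset Ker x in which \<open>x\<close> can be chosen with the same order
  bound as its image \<open>y\<close>. For \<open>u\<close> in the kernel, the power of u x with
  exponent \<open>H.ord y\<close> is a product of conjugates of \<open>u\<close>; these commute and
  are killed by \<open>G.ord u\<close>. Hence the order of u x divides the product of the orders of
  \<open>u\<close> and \<open>y\<close>. The lift is chosen for each fibre separately, not as a
  homomorphism.\<close>

theorem (in group_epi) psi_le_mult:
  assumes fin: "finite (carrier G)" and comm: "\<And>u v. u \<in> Ker \<Longrightarrow> v \<in> Ker \<Longrightarrow> u \<otimes> v = v \<otimes> u"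
    and cop: "coprime (card Ker) (order H)"
  shows "psi G \<le> (\<Sum>u\<in>Ker. G.ord u) * psi H"
proof -
  interpret N: normal Ker G by (rule normal_kernel)
  have finH: "finite (carrier H)" by (rule finite_image[OF fin])
  have fib: "(\<Sum>x | x \<in> carrier G \<and> h x = y. G.ord x) \<le> (\<Sum>u\<in>Ker. G.ord u) * H.ord y"
    if y: "y \<in> carrier H" for y
  proof -
    let ?m = "H.ord y"
    obtain x0 where x0: "x0 \<in> carrier G" "h x0 = y" using surj y by (metis imageE)
    have "card Ker \<noteq> 0" using N.finite_imp_card_positive[OF fin] by simp
    \<comment> \<open>The exponent s = |Ker| u is 1 modulo the order of \<open>H\<close> and 0
      modulo |Ker|: raising \<open>x0\<close> to it keeps the image \<open>y\<close> and removes the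
      part of the order that comes from the kernel.\<close>
    then obtain u v where uv: "card Ker * u = order H * v + 1"
      using bezout_nat[of "card Ker" "order H"] cop by auto
    define s where "s = card Ker * u"
    define x where "x = x0 [^] s"
    have x: "x \<in> carrier G" using x0 by (simp add: x_def)
    have "h x = y [^]\<^bsub>H\<^esub> (order H * v + 1)" using x0 by (simp add: x_def s_def uv hom_nat_pow)
    also have "\<dots> = (y [^]\<^bsub>H\<^esub> order H) [^]\<^bsub>H\<^esub> v \<otimes>\<^bsub>H\<^esub> y" using y by (simp add: H.nat_pow_pow)
    also have "\<dots> = y" using y H.pow_order_eq_1[OF y] by simp
    finally have hx: "h x = y" .
    have "h (x0 [^] ?m) = \<one>\<^bsub>H\<^esub>" using hom_nat_pow[OF x0(1), of ?m] x0(2) H.pow_ord_eq_1[OF y] by simp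
    then have "x0 [^] ?m \<in> Ker" using x0(1) unfolding kernel_def by blast
    then have "(x0 [^] ?m) [^] card Ker = \<one>" by (rule G.pow_card_subgroup[OF N.is_subgroup])
    then have "((x0 [^] ?m) [^] card Ker) [^] u = \<one>" by simp
    then have xm: "x [^] ?m = \<one>" using x0 unfolding x_def s_def
      by (simp add: G.nat_pow_pow mult.commute mult.left_commute)
    have le: "G.ord (u \<otimes> x) \<le> G.ord u * ?m" if u: "u \<in> Ker" for u
    proof -
      let ?e = "G.ord u"
      have uc: "u \<in> carrier G" using u N.subset by auto
      \<comment> \<open>The witness \<open>v\<close> is the product of the conjugates of
        \<open>u\<close> by x^0, ..., x^(j-1).\<close>
      have "\<exists>v\<in>Ker. v [^] ?e = \<one> \<and> (u \<otimes> x) [^] j = v \<otimes> x [^] j" for j :: nat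
      proof (induction j)
        case 0
        show ?case by (intro bexI[of _ \<one>]) auto
      next
        case (Suc j)
        then obtain v where v: "v \<in> Ker" "v [^] ?e = \<one>" "(u \<otimes> x) [^] j = v \<otimes> x [^] j" by blast
        have vc: "v \<in> carrier G" using v N.subset by auto
        let ?w = "x [^] j \<otimes> u \<otimes> inv (x [^] j)"
        have w: "?w \<in> Ker" using u x N.inv_op_closed2 by simp
        have wc: "?w \<in> carrier G" using w N.subset by auto
        have "?w [^] ?e = \<one>" using G.conj_pow[of "x [^] j" u ?e] x uc by simp
        then have e: "(v \<otimes> ?w) [^] ?e = \<one>"
          using G.pow_mult_distrib[of v ?w ?e] comm[OF v(1) w] vc wc v(2) by simp
        have "(u \<otimes> x) [^] Suc j = (v \<otimes> x [^] j) \<otimes> (u \<otimes> x)" using v(3) by simp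
        also have "\<dots> = v \<otimes> (x [^] j \<otimes> u \<otimes> (inv (x [^] j) \<otimes> x [^] j)) \<otimes> x" using x uc vc by (simp add: G.m_assoc)
        also have "\<dots> = (v \<otimes> ?w) \<otimes> x [^] Suc j" using x uc vc by (simp only: G.m_assoc G.m_closed G.inv_closed G.nat_pow_closed G.nat_pow_Suc)
        finally show ?case using e v(1) w N.m_closed by (intro bexI[of _ "v \<otimes> ?w"]) auto
      qed
      from this[of ?m] obtain v where v: "v \<in> Ker" "v [^] ?e = \<one>" "(u \<otimes> x) [^] ?m = v \<otimes> x [^] ?m" by blast
      then have "(u \<otimes> x) [^] ?m = v" using xm N.subset by auto
      then have "(u \<otimes> x) [^] (?m * ?e) = \<one>" using v(2) uc x by (simp flip: G.nat_pow_pow)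
      then have "G.ord (u \<otimes> x) dvd ?m * ?e" using uc x by (simp add: G.pow_eq_id)
      moreover have "?m * ?e > 0" using G.ord_ge_1[OF fin uc] H.ord_ge_1[OF finH y] by auto
      ultimately show ?thesis by (simp add: dvd_imp_le mult.commute)
    qed
    have "{x \<in> carrier G. h x = y} = (\<lambda>u. u \<otimes> x) ` Ker"
      using fibre[OF x] hx by (auto simp: r_coset_def)
    moreover have "inj_on (\<lambda>u. u \<otimes> x) Ker" using x N.subset by (auto simp: inj_on_def)
    ultimately have "(\<Sum>x | x \<in> carrier G \<and> h x = y. G.ord x) = (\<Sum>u\<in>Ker. G.ord (u \<otimes> x))"
      by (simp add: sum.reindex)
    also have "\<dots> \<le> (\<Sum>u\<in>Ker. G.ord u * ?m)" by (intro sum_mono le)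
    finally show ?thesis by (simp add: sum_distrib_right)
  qed
  have "psi G = (\<Sum>y\<in>carrier H. \<Sum>x | x \<in> carrier G \<and> h x = y. G.ord x)"
    unfolding psi_def by (rule sum.group[symmetric]) (use fin finH in auto)
  also have "\<dots> \<le> (\<Sum>y\<in>carrier H. (\<Sum>u\<in>Ker. G.ord u) * H.ord y)"
    by (intro sum_mono fib)
  finally show ?thesis by (simp add: psi_def sum_distrib_left)
qed

section \<open>A cyclic subgroup acting on its own cosets\<close>

locale cyclic_subgroup = group G for G (structure) + fixes x
  assumes finite_G: "finite (carrier G)" and x_closed [simp]: "x \<in> carrier G"
begin

definition "A = generate G {x}"
text \<open>If \<open>m\<close> divides the order of \<open>x\<close>, this is the subgroup of index
  \<open>m\<close> in \<open>A\<close>; in particular \<open>K 1\<close> is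
  \<open>A\<close>.\<close>

definition "K m = generate G {x [^] (m::nat)}"

lemma ord_pos: "ord y > 0" if "y \<in> carrier G"
  using ord_ge_1[OF finite_G that] by simp

lemma generate_range: "y \<in> carrier G \<Longrightarrow> generate G {y} = range (\<lambda>j::nat. y [^] j)"
  using generate_pow_nat[of y] ord_pos[of y] by auto

lemma A_range: "A = range (\<lambda>j::nat. x [^] j)"
  unfolding A_def by (rule generate_range) simp

lemma subgroup_A: "subgroup A G"
  unfolding A_def by (rule generate_is_subgroup) simp

lemma subgroup_K: "subgroup (K m) G"
  unfolding K_def by (rule generate_is_subgroup) simp

lemma x_in_A: "x \<in> A"
  by (simp add: A_def generate.incl)

lemma card_A: "card A = ord x"
  unfolding A_def using generate_pow_card[of x] by simp

lemma card_K: "card (K m) = ord (x [^] m)"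
  unfolding K_def using generate_pow_card[of "x [^] m"] by simp

lemma A_comm: "a \<in> A \<Longrightarrow> b \<in> A \<Longrightarrow> a \<otimes> b = b \<otimes> a"
proof -
  assume "a \<in> A" "b \<in> A"
  then obtain i j :: nat where "a = x [^] i" "b = x [^] j" unfolding A_range by blast
  then show ?thesis by (simp add: nat_pow_mult add.commute)
qed

lemma K_subset_A: "K m \<subseteq> A"
proof
  fix y assume "y \<in> K m"
  then obtain j :: nat where "y = (x [^] m) [^] j"
    using generate_range[of "x [^] m"] by (auto simp: K_def)
  then have "y = x [^] (m * j)" by (simp add: nat_pow_pow)
  then show "y \<in> A" unfolding A_range by blast
qed

lemma A_subset_nmz: assumes "S \<subseteq> A" shows "A \<subseteq> nmz S"
proof
  fix a assume a: "a \<in> A"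
  have ac: "a \<in> carrier G" by (rule subgroup.mem_carrier[OF subgroup_A a])
  have "a \<otimes> b \<otimes> inv a = b" if "b \<in> S" for b
  proof -
    have bA: "b \<in> A" using assms that by auto
    then have "b \<in> carrier G" by (rule subgroup.mem_carrier[OF subgroup_A])
    then show ?thesis using A_comm[OF a bA] ac by (simp add: m_assoc)
  qed
  then show "a \<in> nmz S" using ac by (simp add: nmz_def)
qed

lemma ord_pow_gcd: "ord (x [^] m) = ord x div gcd (ord x) m"
  using ord_pow_gen[of x m] ord_pos[of x] by auto

sublocale act: finite_right_action G A "rcosets A" "\<lambda>C b. C #> b"
  by (rule coset_action[OF finite_G subgroup_A subgroup_A])

text \<open>The stabiliser of A g is the part of \<open>A\<close> that conjugation by
  \<open>g\<close> maps into \<open>A\<close>. Its index is the orbit length, and in a cyclic group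
  the subgroup of index s contains x^m exactly when s divides \<open>m\<close>.\<close>

lemma card_orb_dvd_iff:
  assumes g: "g \<in> carrier G"
  shows "card (act.orb (A #> g)) dvd m \<longleftrightarrow> g \<otimes> x [^] m \<otimes> inv g \<in> A"
proof -
  let ?C = "A #> g" and ?S = "act.stab (A #> g)"
  have C: "?C \<in> rcosets A" using g subgroup.subset[OF subgroup_A] rcosetsI by simp
  have S: "y \<in> ?S \<longleftrightarrow> y \<in> A \<and> g \<otimes> y \<otimes> inv g \<in> A" for y
    unfolding act.stab_def using rcoset_fixed_iff[OF subgroup_A g] subgroup.mem_carrier[OF subgroup_A] by blast
  have sub: "subgroup ?S G" "?S \<subseteq> A" using act.subgroup_stab[OF C] S by auto
  have card: "card (act.orb ?C) * card ?S = ord x" using act.card_orb_stab[OF C] card_A by simp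
  have xm: "x [^] m \<in> A" by (auto simp: A_range)
  have "card (act.orb ?C) dvd m \<longleftrightarrow> x [^] m \<in> ?S"
  proof
    assume "card (act.orb ?C) dvd m"
    then obtain j where j: "m = card (act.orb ?C) * j" by (auto elim!: dvdE)
    have "x [^] card (act.orb ?C) \<in> ?S"
      by (rule pow_index_subgroup[OF sub(1) subgroup_A sub(2) finite_G x_in_A A_subset_nmz[OF sub(2)]])
        (simp add: card_A card[symmetric] mult.commute)
    then have "(x [^] card (act.orb ?C)) [^] j \<in> ?S"
      using subgroup_int_pow_closed[OF sub(1), of _ "int j"] by (simp add: int_pow_int)
    then show "x [^] m \<in> ?S" by (simp add: nat_pow_pow j)
  next
    assume "x [^] m \<in> ?S"
    then have "(x [^] m) [^] card ?S = \<one>" by (rule pow_card_subgroup[OF sub(1)])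
    then have "ord x dvd m * card ?S" by (simp add: nat_pow_pow pow_eq_id)
    then have "card (act.orb ?C) * card ?S dvd m * card ?S" by (simp only: card)
    moreover have "card ?S \<noteq> 0" using card ord_pos[of x] by (metis mult_0_right not_gr_zero x_closed)
    ultimately show "card (act.orb ?C) dvd m" by simp
  qed
  then show ?thesis using S xm by blast
qed

text \<open>Equal orders give equal gcds with the order of \<open>x\<close>, and by Bezout the power
  of \<open>x\<close> with that gcd as exponent already lies in \<open>K m\<close>.\<close>

lemma mem_K_iff:
  assumes "y \<in> A" "ord y = ord (x [^] m)" shows "y \<in> K m"
proof -
  obtain j :: nat where j: "y = x [^] j" using assms(1) by (auto simp: A_range)
  have "ord x div gcd (ord x) j = ord x div gcd (ord x) m"
    using assms(2) j by (simp add: ord_pow_gcd)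
  then have g: "gcd (ord x) j = gcd (ord x) m"
    using ord_pos[of x] by (metis dvd_div_mult_self dvd_mult_div_cancel gcd_dvd1 mult_cancel2 mult_is_0 not_gr_zero x_closed)
  have "m = 0 \<or> (\<exists>u v. m * u = ord x * v + gcd m (ord x))" using bezout_nat[of m "ord x"] by blast
  then obtain u v where "m * u = ord x * v + gcd m (ord x) \<or> m = 0" by blast
  then have "x [^] gcd (ord x) m \<in> K m"
  proof
    assume "m = 0"
    then show ?thesis by (simp add: K_def generate.one)
  next
    assume e: "m * u = ord x * v + gcd m (ord x)"
    have "(x [^] m) [^] u = (x [^] ord x) [^] v \<otimes> x [^] gcd m (ord x)"
      by (simp add: nat_pow_pow nat_pow_mult e del: pow_ord_eq_1)
    then have "x [^] gcd (ord x) m = (x [^] m) [^] u" by (simp add: gcd.commute)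
    then show ?thesis by (auto simp: K_def generate_range)
  qed
  moreover obtain i where "j = gcd (ord x) m * i" using g by (metis dvdE gcd_dvd2)
  ultimately show ?thesis
    using subgroup_int_pow_closed[OF subgroup_K, of "x [^] gcd (ord x) m" m "int i"] j
    by (simp add: int_pow_int nat_pow_pow)
qed

text \<open>If the conjugate of x^m lies in \<open>A\<close> at all, it generates the only subgroup
  of \<open>A\<close> of its order, which is \<open>K m\<close>. So the condition on orbit lengths
  becomes a statement about a normaliser.\<close>

lemma nmz_K: "nmz (K m) = {g \<in> carrier G. g \<otimes> x [^] m \<otimes> inv g \<in> A}"
proof (intro equalityI subsetI)
  fix g assume "g \<in> nmz (K m)"
  moreover have "x [^] m \<in> K m" by (simp add: K_def generate.incl)
  ultimately show "g \<in> {g \<in> carrier G. g \<otimes> x [^] m \<otimes> inv g \<in> A}"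
    using K_subset_A by (auto simp: nmz_def)
next
  fix g assume "g \<in> {g \<in> carrier G. g \<otimes> x [^] m \<otimes> inv g \<in> A}"
  then have g: "g \<in> carrier G" "g \<otimes> x [^] m \<otimes> inv g \<in> A" by auto
  let ?y = "g \<otimes> x [^] m \<otimes> inv g"
  have one: "g \<otimes> z \<otimes> inv g = \<one> \<longleftrightarrow> z = \<one>" if "z \<in> carrier G" for z
    using that g(1) by (metis inv_closed inv_inv inv_solve_right l_cancel m_closed one_closed r_inv r_one)
  have "?y [^] i = \<one> \<longleftrightarrow> (x [^] m) [^] i = \<one>" for i :: nat
    using conj_pow[OF g(1), of "x [^] m" i] one[of "(x [^] m) [^] i"] by simp
  then have "ord ?y = ord (x [^] m)"
    using g(1) by (subst ord_unique) (auto simp: pow_eq_id)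
  then have y: "?y \<in> K m" using mem_K_iff g(2) by blast
  have "g \<otimes> z \<otimes> inv g \<in> K m" if "z \<in> K m" for z
  proof -
    obtain i :: nat where i: "z = (x [^] m) [^] i" using \<open>z \<in> K m\<close> by (auto simp: K_def generate_range)
    have "?y [^] i \<in> K m"
      using subgroup_int_pow_closed[OF subgroup_K y, of "int i"] by (simp add: int_pow_int)
    then show ?thesis using conj_pow[OF g(1), of "x [^] m" i] i by simp
  qed
  then show "g \<in> nmz (K m)" using g(1) by (simp add: nmz_def)
qed

definition index :: nat where "index = card (rcosets A)"
definition ncos :: "nat \<Rightarrow> nat" where "ncos s = card {C \<in> rcosets A. card (act.orb C) = s}"
text \<open>By \<open>card_nmz_K\<close> below, this is the index of \<open>A\<close> in the
  normaliser of \<open>K m\<close>. The value \<open>index\<close> therefore means that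
  \<open>K m\<close> is normal, and \<open>ncosdvd 1 = 1\<close> that \<open>A\<close> is
  self-normalising.\<close>

definition ncosdvd :: "nat \<Rightarrow> nat" where "ncosdvd m = card {C \<in> rcosets A. card (act.orb C) dvd m}"

lemma subgroup_nmz_K: "subgroup (nmz (K m)) G"
  by (rule subgroup_nmz[OF subgroup.subset[OF subgroup_K] finite_subgroup[OF finite_G subgroup_K]])

lemma card_nmz_K: "ncosdvd m * ord x = card (nmz (K m))"
proof -
  have "{C \<in> rcosets A. card (act.orb C) dvd m} = (\<lambda>g. A #> g) ` nmz (K m)"
    by (auto simp: nmz_K RCOSETS_def card_orb_dvd_iff)
  then show ?thesis
    using lagrange_subgroup[OF subgroup_A subgroup_nmz_K A_subset_nmz[OF K_subset_A]]
    by (simp add: ncosdvd_def card_A)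
qed

lemma index_mult: "index * ord x = order G"
  using lagrange[OF subgroup_A] by (simp add: index_def card_A)

lemma ncosdvd_dvd: "ncosdvd m dvd index"
proof -
  have "card (nmz (K m)) dvd order G" using lagrange[OF subgroup_nmz_K] by (metis dvd_triv_right)
  then have "ncosdvd m * ord x dvd index * ord x" by (simp only: card_nmz_K index_mult)
  then show ?thesis using ord_pos[of x] by simp
qed

lemma normal_K: assumes "ncosdvd m = index" shows "K m \<lhd> G"
proof -
  have "card (nmz (K m)) = card (carrier G)"
    using card_nmz_K[of m] index_mult assms by (simp add: order_def)
  then have "nmz (K m) = carrier G" using finite_G by (intro card_subset_eq) (auto simp: nmz_def)
  then show ?thesis using nmz_eq_carrier subgroup_K by blast
qed

lemma orb_act: "C \<in> rcosets A \<Longrightarrow> b \<in> A \<Longrightarrow> act.orb (C #> b) = act.orb C"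
  by (rule act.orb_eq) (auto simp: act.orb_def)

lemma dvd_ncos: "s dvd ncos s"
  unfolding ncos_def by (rule act.dvd_card_invariant) (auto simp: orb_act act.act_closed)

lemma card_orb_pos: "C \<in> rcosets A \<Longrightarrow> card (act.orb C) > 0"
  using act.card_orb_stab[of C] card_A ord_pos[of x] by (metis gr_zeroI mult_0 x_closed)

lemma finite_rcosets: "finite (rcosets A)"
  by (rule act.finite_E)

lemma ncosdvd_eq_sum:
  assumes "m > 0" shows "ncosdvd m = (\<Sum>s | s dvd m. ncos s)"
proof -
  have "{C \<in> rcosets A. card (act.orb C) dvd m} = (\<Union>s\<in>{s. s dvd m}. {C \<in> rcosets A. card (act.orb C) = s})"
    by auto
  then show ?thesis unfolding ncosdvd_def ncos_def
    using assms finite_rcosets by (simp only:) (rule card_UN_disjoint, auto)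
qed

lemma ncos_nonzero: 
  assumes "ncos s \<noteq> 0" shows "s dvd ord x" "s > 0"
proof -
  obtain C where C: "C \<in> rcosets A" "card (act.orb C) = s"
    using assms unfolding ncos_def by (metis (mono_tags, lifting) Collect_empty_eq card.empty)
  show "s dvd ord x" using act.card_orb_stab[OF C(1)] C(2) card_A by (metis dvd_triv_left)
  show "s > 0" using card_orb_pos[OF C(1)] C(2) by simp
qed

lemma ncosdvd_le: "ncosdvd m \<le> index"
  unfolding ncosdvd_def index_def by (rule card_mono[OF finite_rcosets]) auto

lemma ncos_1: "ncos 1 = ncosdvd 1" "ncosdvd 1 > 0"
proof -
  show "ncos 1 = ncosdvd 1" by (simp add: ncos_def ncosdvd_def)
  have "\<one> \<in> nmz (K 1)" using subgroup_nmz_K subgroup.one_closed by blast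
  then have "card (nmz (K 1)) \<noteq> 0" using finite_subgroup[OF finite_G subgroup_nmz_K] by auto
  then show "ncosdvd 1 > 0" using card_nmz_K[of 1] by (metis gr_zeroI mult_0)
qed

lemma sum_ncos: "(\<Sum>s | s dvd ord x. ncos s) = index"
proof -
  have "ncosdvd (ord x) = index" unfolding ncosdvd_def index_def
    using act.card_orb_stab card_A by (metis (mono_tags, lifting) Collect_mem_eq Collect_cong dvd_triv_left)
  then show ?thesis using ncosdvd_eq_sum ord_pos by simp
qed

lemma sschain_K: "K m \<lhd> G \<Longrightarrow> sschain G (K m)"
  unfolding K_def by (rule sschain_generate[OF finite_G]) auto

end

section \<open>Small indices\<close>

context group
begin

text \<open>Modulo \<open>F\<close> any element of \<open>E\<close> outside \<open>F\<close> has
  order \<open>p\<close> and so generates the factor.\<close>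

lemma sschain_prime_step:
  assumes fin: "finite (carrier G)" and F: "sschain G F" and E: "E \<lhd> G" "F \<subseteq> E"
    and card: "card E = p * card F" "prime p"
  shows "sschain G E"
proof -
  have nF: "F \<lhd> G" using sschain_normal[OF F] .
  interpret E: normal E G by (rule E)
  have finE: "finite E" using finite_subgroup[OF fin E.is_subgroup] .
  have "card F > 0" using nF fin normal_imp_subgroup subgroup.finite_imp_card_positive by blast
  then have "card F < card E" using card prime_gt_1_nat[of p] by simp
  then obtain z where z: "z \<in> E" "z \<notin> F" using E(2) finE by (metis card_mono finite_subset leD subsetI)
  have zc: "z \<in> carrier G" using z(1) E.subset by blast
  obtain H :: "'a monoid" and h where h: "group_epi G H h" "kernel G H h = F"
    using quotient_epi[OF nF] .
  interpret h: group_epi G H h by fact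
  have "card E = card (h ` E) * card F" using h.card_image_subgroup[OF E.is_subgroup] h(2) E(2) fin by simp
  then have cp: "card (h ` E) = p" using card(1) \<open>card F > 0\<close> by simp
  have sub: "subgroup (h ` E) H" using h.subgroup_img_is_subgroup[OF E.is_subgroup] .
  have finH: "finite (carrier H)" using h.finite_image[OF fin] .
  have hz: "h z \<in> h ` E" "h z \<in> carrier H" using z(1) zc by auto
  have "h z [^]\<^bsub>H\<^esub> p = \<one>\<^bsub>H\<^esub>" using h.H.pow_card_subgroup[OF sub hz(1)] cp by simp
  then have "h.H.ord (h z) dvd p" using hz(2) h.H.pow_eq_id by blast
  moreover have "h.H.ord (h z) \<noteq> 1"
  proof
    assume "h.H.ord (h z) = 1"
    then have "h z = \<one>\<^bsub>H\<^esub>" using hz(2) h.H.ord_eq_1 by blast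
    then have "z \<in> kernel G H h" using zc unfolding kernel_def by blast
    then show False using h(2) z(2) by simp
  qed
  ultimately have op: "h.H.ord (h z) = p" using card(2) by (metis prime_nat_iff)
  have "generate H {h z} \<subseteq> h ` E" using h.H.generate_subgroup_incl[OF _ sub] hz(1) by simp
  then have gen: "generate H {h z} = h ` E"
    using cp op h.H.generate_pow_card[OF hz(2)] finE by (intro card_subset_eq) auto
  show ?thesis
  proof (rule sschain.step[OF F E z(1)])
    fix y assume y: "y \<in> E"
    then have yc: "y \<in> carrier G" using E.subset by blast
    have "h y \<in> generate H {h z}" using y gen by blast
    then obtain j :: int where "h y = h z [^]\<^bsub>H\<^esub> j" using h.H.generate_pow[OF hz(2)] by blast
    then have "h y = h (z [^] j)" using zc h.hom_int_pow by simp
    then have "y \<in> F #> (z [^] j)" using h.fibre[of "z [^] j"] h(2) yc zc by blast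
    then show "\<exists>j::int. y \<in> F #> (z [^] j)" ..
  qed
qed

lemma sschain_prime:
  assumes "finite (carrier G)" "N \<lhd> G" "prime (card N)" shows "sschain G N"
  by (rule sschain_prime_step[OF assms(1) sschain.one assms(2) _ _ assms(3)])
    (use assms(2) normal_imp_subgroup subgroup.one_closed in auto)

text \<open>Coprimality keeps the order of \<open>z\<close> unchanged modulo \<open>P\<close>; that
  order is the order of the quotient, so \<open>z\<close> generates it.\<close>

lemma sschain_complement:
  assumes fin: "finite (carrier G)" and P: "sschain G P" and z: "z \<in> carrier G"
    and card: "order G = card P * ord z" "coprime (card P) (ord z)"
  shows "sschain G (carrier G)"
proof -
  have nP: "P \<lhd> G" using sschain_normal[OF P] .
  interpret P: normal P G by (rule nP)
  obtain H :: "'a monoid" and h where h: "group_epi G H h" "kernel G H h = P"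
    using quotient_epi[OF nP] .
  interpret h: group_epi G H h by fact
  have finH: "finite (carrier H)" using h.finite_image[OF fin] .
  have "card P > 0" using P.finite_imp_card_positive[OF fin] .
  then have oH: "order H = ord z" using h.order_epi[OF fin] h(2) card(1) by (simp add: mult.commute)
  have hz: "h z \<in> carrier H" using z by simp
  have "h z [^]\<^bsub>H\<^esub> h.H.ord (h z) = \<one>\<^bsub>H\<^esub>" using hz by simp
  then have "h (z [^] h.H.ord (h z)) = \<one>\<^bsub>H\<^esub>" using z h.hom_nat_pow by simp
  then have "z [^] h.H.ord (h z) \<in> P" using z h(2) unfolding kernel_def by blast
  then have "(z [^] h.H.ord (h z)) [^] card P = \<one>" by (rule pow_card_subgroup[OF P.is_subgroup])
  then have "ord z dvd h.H.ord (h z) * card P" using z by (simp add: nat_pow_pow pow_eq_id)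
  then have "ord z dvd h.H.ord (h z)" using card(2) by (metis coprime_commute coprime_dvd_mult_left_iff)
  moreover have "h.H.ord (h z) dvd ord z" using h.H.ord_dvd_group_order[OF hz] oH by simp
  ultimately have "h.H.ord (h z) = ord z" by (metis dvd_antisym)
  then have gen: "generate H {h z} = carrier H"
    using h.H.generate_pow_card[OF hz] oH finH h.H.generate_incl[of "{h z}"] hz
    by (intro card_subset_eq) (auto simp: order_def)
  show ?thesis
  proof (rule sschain.step[OF P _ P.subset z])
    show "carrier G \<lhd> G" by (simp add: normal_inv_iff subgroup_self)
    fix y assume y: "y \<in> carrier G"
    then have "h y \<in> generate H {h z}" using gen by simp
    then obtain j :: int where "h y = h z [^]\<^bsub>H\<^esub> j" using h.H.generate_pow[OF hz] by blast
    then have "h y = h (z [^] j)" using z h.hom_int_pow by simp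
    then have "y \<in> P #> (z [^] j)" using h.fibre[of "z [^] j"] h(2) y z by blast
    then show "\<exists>j::int. y \<in> P #> (z [^] j)" ..
  qed
qed

text \<open>Neither 3 nor 9 is 1 modulo 5, so the Sylow 5-subgroup is normal of prime order, and the
  quotient is a 3-group.\<close>

lemma supersolvable_order_15_45:
  assumes fin: "finite (carrier G)" and o: "order G = 5 * m" "m = 3 \<or> m = 9"
  shows "supersolvable G"
proof -
  have p5: "prime (5::nat)" by simp
  obtain P where P: "subgroup P G" "card P = 5 ^ 1"
    using sylow_thm[OF p5 is_group, of 1 m] o fin by auto
  have "P \<lhd> G"
  proof (rule sylow_normal[OF fin P p5])
    show "order G = 5 ^ 1 * m" using o by simp
    show "\<not> 5 dvd m" using o(2) by auto
    fix d assume d: "d dvd m" "d mod 5 = 1"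
    then have "d \<le> 9" using o(2) by (auto dest!: dvd_imp_le)
    then have "d \<in> {0,1,2,3,4,5,6,7,8,9}" by auto
    then show "d = 1" using d o(2) by auto
  qed
  then have ss: "sschain G P" using sschain_prime[OF fin] P(2) by simp
  obtain H :: "'a monoid" and h where h: "group_epi G H h" "kernel G H h = P"
    using quotient_epi[OF \<open>P \<lhd> G\<close>] .
  interpret h: group_epi G H h by fact
  have "order H = m" using h.order_epi[OF fin] h(2) o(1) P(2) by simp
  then have "order H = 3 ^ (if m = 3 then 1 else 2)" using o(2) by auto
  then have "supersolvable H"
    by (rule p_group_supersolvable[OF h.H.group_axioms h.finite_image[OF fin]]) simp
  then show ?thesis using h.supersolvable_vimage h(2) ss by simp
qed

lemma conj_action:
  assumes "finite (carrier G)" "subgroup B G" "E \<subseteq> carrier G"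
    "\<And>e b. e \<in> E \<Longrightarrow> b \<in> B \<Longrightarrow> inv b \<otimes> e \<otimes> b \<in> E"
  shows "finite_right_action G B E (\<lambda>e b. inv b \<otimes> e \<otimes> b)"
proof -
  interpret B: subgroup B G by fact
  have [simp]: "e \<in> carrier G" if "e \<in> E" for e using that assms(3) by auto
  show ?thesis
  proof unfold_locales
    show "finite B" using assms finite_subgroup by blast
    show "finite E" using assms finite_subset by blast
  qed (use assms(4) in \<open>auto simp: m_assoc inv_mult_group\<close>)
qed

lemma prime_generate:
  assumes fin: "finite (carrier G)" and P: "subgroup P G" "prime (card P)" and u: "u \<in> P" "u \<noteq> \<one>"
  shows "generate G {u} = P" "ord u = card P"
proof -
  have uc: "u \<in> carrier G" using subgroup.mem_carrier[OF P(1) u(1)] .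
  have "ord u dvd card P" using pow_card_subgroup[OF P(1) u(1)] pow_eq_id[OF uc] by blast
  moreover have "ord u \<noteq> 1" using ord_eq_1[OF uc] u(2) by blast
  ultimately show o: "ord u = card P" using P(2) by (metis prime_nat_iff)
  show "generate G {u} = P"
    using generate_subgroup_incl[OF _ P(1), of "{u}"] u(1) generate_pow_card[OF uc] o finite_subgroup[OF fin P(1)]
    by (intro card_subset_eq) auto
qed

text \<open>A fixed point of \<open>P\<close> on \<open>Q\<close> would normalise \<open>P\<close>.\<close>

lemma self_normalizing_not_normal:
  assumes fin: "finite (carrier G)" and P: "subgroup P G" "prime (card P)" "nmz P = P"
    and Q: "Q \<lhd> G" "prime (card Q)" "card Q \<noteq> card P" "card Q mod card P \<noteq> 1"
  shows False
proof -
  interpret P: subgroup P G by (rule P)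
  interpret Q: normal Q G by (rule Q)
  interpret act: finite_right_action G P Q "\<lambda>e b. inv b \<otimes> e \<otimes> b"
    using Q.inv_op_closed1 P.subset by (intro conj_action[OF fin P(1) Q.subset]) auto
  \<comment> \<open>This excludes that the identity is the only fixed point; another one centralises
    \<open>P\<close>, hence lies in \<open>P\<close>, and would have order both |P| and |Q|.\<close>
  have mod: "card act.fixpoints mod card P \<noteq> 1"
    using act.card_fixpoints_mod[OF P(2), of 1] Q(4) by simp
  have one: "\<one> \<in> act.fixpoints" using P.subset unfolding act.fixpoints_def by auto
  have "act.fixpoints \<noteq> {\<one>}"
  proof
    assume "act.fixpoints = {\<one>}"
    then have "card act.fixpoints = 1" by simp
    then show False using mod prime_gt_1_nat[OF P(2)] by simp
  qed
  then obtain u where u: "u \<in> act.fixpoints" "u \<noteq> \<one>" using one by blast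
  then have uQ: "u \<in> Q" by (simp add: act.fixpoints_def)
  have uc: "u \<in> carrier G" using uQ Q.subset by blast
  have "u \<otimes> b \<otimes> inv u = b" if b: "b \<in> P" for b
  proof -
    have bc: "b \<in> carrier G" using b P.subset by blast
    have "inv b \<otimes> u \<otimes> b = u" using u(1) b by (simp add: act.fixpoints_def)
    then have "b \<otimes> (inv b \<otimes> (u \<otimes> b)) = b \<otimes> u" using bc uc by (simp add: m_assoc)
    then have "u \<otimes> b = b \<otimes> u" using bc uc by (simp flip: m_assoc)
    then show ?thesis using bc uc by (simp add: m_assoc)
  qed
  then have "u \<in> P" using uc P(3) by (auto simp: nmz_def)
  then have "ord u = card P" using prime_generate(2)[OF fin P(1,2)] u(2) by blast
  moreover have "ord u = card Q" using prime_generate(2)[OF fin Q.is_subgroup Q(2) uQ u(2)] .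
  ultimately show False using Q(3) by simp
qed

text \<open>Conjugates of \<open>P\<close> meet as in a Frobenius group: an element conjugating one
  nontrivial member of \<open>P\<close> into \<open>P\<close> normalises \<open>P\<close>, so lies
  in \<open>P\<close>. Each nontrivial member thus has centraliser \<open>P\<close> and a class of
  size \<open>m\<close>, and different members have disjoint classes because \<open>P\<close> is
  abelian.\<close>

lemma card_ord_self_normalizing:
  assumes fin: "finite (carrier G)" and P: "subgroup P G" "prime (card P)" "nmz P = P"
    and o: "order G = card P * m"
  shows "card {y \<in> carrier G. ord y = card P} \<ge> (card P - 1) * m"
proof -
  interpret P: subgroup P G by (rule P)
  interpret act: finite_right_action G "carrier G" "carrier G" "\<lambda>e b. inv b \<otimes> e \<otimes> b"
    by (intro conj_action[OF fin subgroup_self]) auto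
  have comm: "a \<otimes> b = b \<otimes> a" if a: "a \<in> P" and b: "b \<in> P" for a b
  proof (cases "a = \<one>")
    case False
    then have "b \<in> generate G {a}" using prime_generate(1)[OF fin P(1,2) a] b by simp
    then obtain j :: int where j: "b = a [^] j" using generate_pow[of a] P.mem_carrier[OF a] by auto
    then show ?thesis using P.mem_carrier[OF a]
      by (metis int_pow_1 int_pow_mult add.commute)
  qed (use P.mem_carrier[OF b] in simp)
  \<comment> \<open>A nontrivial \<open>u\<close> generates \<open>P\<close>, since the order of
    \<open>P\<close> is prime.\<close>
  have nm: "g \<in> P" if g: "g \<in> carrier G" and u: "u \<in> P" "u \<noteq> \<one>" "g \<otimes> u \<otimes> inv g \<in> P" for g u
  proof -
    have uc: "u \<in> carrier G" using P.mem_carrier[OF u(1)] .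
    have "g \<otimes> y \<otimes> inv g \<in> P" if "y \<in> P" for y
    proof -
      have "y \<in> generate G {u}" using prime_generate(1)[OF fin P(1,2) u(1,2)] that by simp
      then obtain j :: nat where j: "y = u [^] j"
        using generate_pow_nat[OF uc] ord_ge_1[OF fin uc] by auto
      have "(g \<otimes> u \<otimes> inv g) [^] int j \<in> P" by (rule subgroup_int_pow_closed[OF P(1) u(3)])
      then show ?thesis using conj_pow[OF g uc, of j] j by (simp add: int_pow_int)
    qed
    then have "g \<in> nmz P" using g by (simp add: nmz_def)
    then show ?thesis using P(3) by simp
  qed
  have inv_conj: "inv b \<otimes> u \<otimes> b = inv b \<otimes> u \<otimes> inv (inv b)" if "b \<in> carrier G" for b u
    using that by simp
  have orb: "card (act.orb u) = m" if u: "u \<in> P" "u \<noteq> \<one>" for u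
  proof -
    have uc: "u \<in> carrier G" using P.mem_carrier[OF u(1)] .
    have "act.stab u = P"
    proof (intro equalityI subsetI)
      fix b assume b: "b \<in> act.stab u"
      then have bc: "b \<in> carrier G" and e: "inv b \<otimes> u \<otimes> b = u" by (auto simp: act.stab_def)
      have "inv b \<in> P" using nm[of "inv b" u] u bc e by simp
      then show "b \<in> P" using P.m_inv_closed bc by (metis inv_inv)
    next
      fix b assume b: "b \<in> P"
      then have bc: "b \<in> carrier G" by (rule P.mem_carrier)
      have "inv b \<otimes> u \<otimes> b = inv b \<otimes> (b \<otimes> u)" using comm[OF u(1) b] bc uc by (simp add: m_assoc)
      then have "inv b \<otimes> u \<otimes> b = u" using bc uc by (simp flip: m_assoc)
      then show "b \<in> act.stab u" using bc by (simp add: act.stab_def)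
    qed
    then have "card (act.orb u) * card P = card P * m"
      using act.card_orb_stab[OF uc] o by (simp add: order_def)
    then show ?thesis using prime_gt_0_nat[OF P(2)] by simp
  qed
  have disj: "act.orb u \<inter> act.orb v = {}" if uv: "u \<in> P - {\<one>}" "v \<in> P - {\<one>}" "u \<noteq> v" for u v
  proof (rule ccontr)
    assume "act.orb u \<inter> act.orb v \<noteq> {}"
    then obtain w where w: "w \<in> act.orb u" "w \<in> act.orb v" by blast
    have c: "u \<in> carrier G" "v \<in> carrier G" using uv P.subset by auto
    have "v \<in> act.orb u" using act.orb_eq[OF c(1) w(1)] act.orb_eq[OF c(2) w(2)] act.orb_self[OF c(2)] by simp
    then obtain b where b: "b \<in> carrier G" "v = inv b \<otimes> u \<otimes> b" by (auto simp: act.orb_def)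
    have "inv b \<in> P" using nm[of "inv b" u] b uv by simp
    then have "inv b \<otimes> u = u \<otimes> inv b" using comm uv by blast
    then have "v = u" using b c by (simp add: m_assoc)
    then show False using uv by simp
  qed
  have sub: "(\<Union>u\<in>P - {\<one>}. act.orb u) \<subseteq> {y \<in> carrier G. ord y = card P}"
  proof safe
    fix u y assume u: "u \<in> P" "y \<in> act.orb u" and n: "u \<noteq> \<one>"
    have uc: "u \<in> carrier G" using P.mem_carrier[OF u(1)] .
    obtain b where b: "b \<in> carrier G" "y = inv b \<otimes> u \<otimes> b" using u(2) by (auto simp: act.orb_def)
    show yc: "y \<in> carrier G" using b uc by simp
    have "y [^] i = \<one> \<longleftrightarrow> u [^] i = \<one>" for i :: nat
    proof -
      have y: "y [^] i = inv b \<otimes> u [^] i \<otimes> b" using conj_pow[of "inv b" u i] b uc by simp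
      have "b \<otimes> (inv b \<otimes> u [^] i \<otimes> b) \<otimes> inv b = (b \<otimes> inv b) \<otimes> u [^] i \<otimes> (b \<otimes> inv b)"
        using b(1) uc by (simp only: m_assoc m_closed inv_closed nat_pow_closed)
      then have unconj: "b \<otimes> (inv b \<otimes> u [^] i \<otimes> b) \<otimes> inv b = u [^] i" using b(1) uc by simp
      show ?thesis
      proof
        assume "y [^] i = \<one>"
        then show "u [^] i = \<one>" using unconj b(1) unfolding y by simp
      qed (use b(1) in \<open>simp add: y\<close>)
    qed
    then have "ord y = ord u" using yc uc by (subst ord_unique) (auto simp: pow_eq_id)
    then show "ord y = card P" using prime_generate(2)[OF fin P(1,2) u(1)] n by simp
  qed
  have finP: "finite P" using finite_subgroup[OF fin P(1)] .
  have "(card P - 1) * m = (\<Sum>u\<in>P - {\<one>}. card (act.orb u))"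
    using orb finP P.one_closed by simp
  also have "\<dots> = card (\<Union>u\<in>P - {\<one>}. act.orb u)"
    using disj finP fin by (intro card_UN_disjoint[symmetric]) (auto simp: act.orb_def)
  also have "\<dots> \<le> card {y \<in> carrier G. ord y = card P}"
    using sub fin by (intro card_mono) auto
  finally show ?thesis .
qed

text \<open>Let P have order 5 or 7 and let Q be a Sylow subgroup for the other of these primes. Q
  cannot be normal, and the only nontrivial Sylow number possible for it, 15 or 21, makes it
  self-normalising too. This yields 4 * 21 + 6 * 15 = 174 elements of order 5 or 7, more than
  105.\<close>

lemma no_self_normalizing_order_105:
  assumes fin: "finite (carrier G)" and o: "order G = 105"
    and P: "subgroup P G" "nmz P = P" "card P = 5 \<or> card P = 7"
  shows False
proof -
  \<comment> \<open>As 5 + 7 = 12, \<open>q\<close> is the other prime, and \<open>m\<close> is 105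
    / q.\<close>
  define q where "q = 12 - card P"
  define m where "m = 3 * card P"
  have q: "prime q" "order G = q ^ 1 * m" "\<not> q dvd m" "prime (card P)" "q \<noteq> card P" "q mod card P \<noteq> 1"
    using P(3) o by (auto simp: q_def m_def)
  obtain Q where Q: "subgroup Q G" "card Q = q ^ 1"
    using sylow_thm[OF q(1) is_group q(2) fin] by blast
  note NQ = subgroup_nmz[OF subgroup.subset[OF Q(1)] finite_subgroup[OF fin Q(1)]]
  let ?d = "card (rcosets (nmz Q))"
  have d: "?d mod q = 1" "?d dvd m" using sylow_index_mod[OF fin Q q(1-3)] by auto
  have "?d \<noteq> 1"
  proof
    assume "?d = 1"
    then have "Q \<lhd> G" using nmz_index_1[OF fin Q(1)] by simp
    moreover have "card Q = q" using Q(2) by simp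
    ultimately show False
      using self_normalizing_not_normal[OF fin P(1) q(4) P(2)] q(1,5,6) by blast
  qed
  have "?d = m"
  proof -
    have "?d \<le> m" using d(2) q(3) by (intro dvd_imp_le) (auto intro!: Nat.gr0I)
    moreover have "m \<le> 21" using P(3) by (auto simp: m_def)
    ultimately have "?d \<in> {0..21}" by simp
    then have "?d \<in> {0,1,2,3,4,5,6,7,8,9,10,11,12,13,14,15,16,17,18,19,20,21}"
      by (simp add: atLeastAtMost_iff) presburger
    then show ?thesis using d \<open>?d \<noteq> 1\<close> P(3) by (auto simp: q_def m_def)
  qed
  then have "card (nmz Q) = card Q" using lagrange[OF NQ] q(2) Q(2) q(3)
    by (metis mult.commute mult_cancel2 dvd_0_right)
  then have nQ: "nmz Q = Q"
    using card_subset_eq[OF finite_subgroup[OF fin NQ] subgroup_subset_nmz[OF Q(1)]] by simp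
  let ?X = "\<lambda>r. {y \<in> carrier G. ord y = r}"
  have "card (?X q) \<ge> (q - 1) * m"
    using card_ord_self_normalizing[OF fin Q(1) _ nQ, of m] Q(2) q by simp
  moreover have "card (?X (card P)) \<ge> (card P - 1) * (3 * q)"
    using P(3) o by (intro card_ord_self_normalizing[OF fin P(1) q(4) P(2)]) (auto simp: q_def)
  moreover have "card (?X q) + card (?X (card P)) = card (?X q \<union> ?X (card P))"
    using fin q(5) by (intro card_Un_disjoint[symmetric]) auto
  moreover have "\<dots> \<le> order G" unfolding order_def using fin by (intro card_mono) auto
  ultimately show False using P(3) o by (auto simp: q_def m_def)
qed

end

section \<open>Prime index, and Sylow subgroups contained in A\<close>

context cyclic_subgroup
begin

lemma card_K_dvd: assumes "m dvd ord x" shows "card (K m) * m = ord x"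
  using assms by (simp add: card_K ord_pow_gcd gcd_proj2_iff gcd.commute)

lemma pow_mem_K_iff:
  assumes "m dvd ord x" shows "x [^] j \<in> K m \<longleftrightarrow> m dvd j"
proof
  assume "x [^] j \<in> K m"
  then have "(x [^] j) [^] card (K m) = \<one>" by (rule pow_card_subgroup[OF subgroup_K])
  then have "ord x dvd j * card (K m)" by (simp add: nat_pow_pow pow_eq_id)
  then have "card (K m) * m dvd j * card (K m)" using card_K_dvd[OF assms] by simp
  moreover have "card (K m) \<noteq> 0" using card_K_dvd[OF assms] ord_pos[of x] by (metis mult_0 not_gr_zero x_closed)
  ultimately show "m dvd j" by (simp add: mult.commute)
next
  assume "m dvd j"
  then obtain i where "j = m * i" by (auto elim!: dvdE)
  then show "x [^] j \<in> K m"
    by (auto simp: K_def generate_range nat_pow_pow)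
qed

lemma order_quotient_K:
  assumes "K m \<lhd> G" "m dvd ord x" "group_epi G H h" "kernel G H h = K m"
  shows "order H = index * m"
proof -
  interpret h: group_epi G H h by fact
  have "order H * card (K m) = index * m * card (K m)"
  proof -
    have "order G = order H * card (K m)" using h.order_epi[OF finite_G] assms(4) by simp
    moreover have "order G = index * (card (K m) * m)" using index_mult card_K_dvd[OF assms(2)] by simp
    ultimately show ?thesis by (simp only: ac_simps)
  qed
  moreover have "card (K m) \<noteq> 0" using card_K_dvd[OF assms(2)] ord_pos[of x] by (metis mult_0 not_gr_zero x_closed)
  ultimately show ?thesis by (simp only: mult_cancel2) blast
qed

lemma ncosdvd_ge:
  assumes "1 < s" "s dvd m" "m > 0" shows "ncos 1 + ncos s \<le> ncosdvd m"
proof -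
  have "ncos 1 + ncos s = (\<Sum>s\<in>{1, s}. ncos s)" using assms by simp
  also have "\<dots> \<le> (\<Sum>s | s dvd m. ncos s)"
    using assms by (intro sum_mono2) auto
  finally show ?thesis using ncosdvd_eq_sum[OF assms(3)] by simp
qed

text \<open>Some normal \<open>K m\<close> has m < \<open>index\<close>: m = 1 if \<open>A\<close>
  is normal, otherwise the length of any nontrivial orbit, since the normaliser of that
  \<open>K m\<close> properly contains \<open>A\<close> and the index is prime. In the quotient, of
  order \<open>index\<close> times m, the Sylow subgroup for the prime \<open>index\<close> is
  normal because m is too small for another Sylow number, and the image of \<open>x\<close>
  generates a complement.\<close>

theorem supersolvable_prime_index:
  assumes k: "prime index" shows "supersolvable G"
proof -
  have "\<exists>m. m > 0 \<and> m < index \<and> m dvd ord x \<and> K m \<lhd> G"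
  proof (cases "ncosdvd 1 = index")
    case True
    then show ?thesis using normal_K[OF True] prime_gt_1_nat[OF k] by (intro exI[of _ 1]) auto
  next
    case False
    then have one: "ncos 1 = 1" using ncosdvd_dvd[of 1] k ncos_1 by (metis prime_nat_iff)
    have "\<exists>s. s \<noteq> 1 \<and> ncos s \<noteq> 0"
    proof (rule ccontr)
      assume "\<not> ?thesis"
      then have "(\<Sum>s | s dvd ord x. ncos s) = (\<Sum>s\<in>{1}. ncos s)"
        using ord_pos[of x] by (intro sum.mono_neutral_right) auto
      then show False using sum_ncos one prime_gt_1_nat[OF k] by simp
    qed
    then obtain s where s: "s \<noteq> 1" "ncos s \<noteq> 0" by blast
    then have s': "s dvd ord x" "s > 1" using ncos_nonzero[of s] by auto
    have ge: "1 + ncos s \<le> ncosdvd s" using ncosdvd_ge[of s s] s' one by simp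
    then have eq: "ncosdvd s = index" 
    proof -
      have "ncosdvd s \<noteq> 1" using ge s(2) by linarith
      then show ?thesis using ncosdvd_dvd[of s] k by (metis prime_nat_iff)
    qed
    \<comment> \<open>Together with the coset fixed by \<open>A\<close> this gives s <
      \<open>index\<close>.\<close>
    moreover have "s \<le> ncos s" using dvd_ncos[of s] s(2) by (intro dvd_imp_le) auto
    ultimately show ?thesis using ge s' normal_K[OF eq] by (intro exI[of _ s]) auto
  qed
  then obtain m where m: "m > 0" "m < index" "m dvd ord x" "K m \<lhd> G" by blast
  obtain H :: "'a monoid" and h where h: "group_epi G H h" "kernel G H h = K m"
    using quotient_epi[OF m(4)] .
  interpret h: group_epi G H h by fact
  have finH: "finite (carrier H)" using h.finite_image[OF finite_G] .
  have oH: "order H = index ^ 1 * m" using order_quotient_K[OF m(4,3) h] by simp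
  obtain P where P: "subgroup P H" "card P = index ^ 1"
    using sylow_thm[OF k h.H.group_axioms oH finH] by blast
  have ndvd: "\<not> index dvd m" using m(1,2) nat_dvd_not_less by blast
  have "P \<lhd> H"
  proof (rule h.H.sylow_normal[OF finH P k oH ndvd])
    fix d assume d: "d dvd m" "d mod index = 1"
    then have "d < index" using m(1,2) by (meson dvd_imp_le le_less_trans)
    then show "d = 1" using d(2) by simp
  qed
  then have ssP: "sschain H P" using h.H.sschain_prime[OF finH] P(2) k by simp
  have "h.H.ord (h x) = m"
  proof -
    have "h x [^]\<^bsub>H\<^esub> j = \<one>\<^bsub>H\<^esub> \<longleftrightarrow> m dvd j" for j :: nat
    proof -
      have "h x [^]\<^bsub>H\<^esub> j = \<one>\<^bsub>H\<^esub> \<longleftrightarrow> x [^] j \<in> kernel G H h"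
        using h.hom_nat_pow[OF x_closed, of j] by (simp add: kernel_def)
      then show ?thesis using h(2) pow_mem_K_iff[OF m(3)] by simp
    qed
    then show ?thesis using h.H.ord_unique[of "h x" m] by simp
  qed
  moreover have "coprime index m" using k ndvd by (rule prime_imp_coprime)
  ultimately have "sschain H (carrier H)"
    using h.H.sschain_complement[OF finH ssP, of "h x"] P(2) oH by simp
  then have "supersolvable H" by (simp add: h.H.supersolvable_iff_sschain)
  then show ?thesis using h.supersolvable_vimage h(2) sschain_K[OF m(4)] by simp
qed

text \<open>As \<open>r\<close> does not divide the index of \<open>A\<close>, the Sylow r-subgroup
  of \<open>A\<close> is one of \<open>G\<close>. It equals \<open>K m\<close> for \<open>m\<close>
  the part of the order of \<open>x\<close> prime to \<open>r\<close>, and \<open>d\<close> is its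
  Sylow number.\<close>

lemma sylow_data:
  assumes r: "prime r" "r dvd order G" "\<not> r dvd index"
  obtains m d a where "ncosdvd m * d = index" "d mod r = 1" "d dvd order G" "d = 1 \<Longrightarrow> K m \<lhd> G"
    "card (K m) = r ^ a" "a > 0" "order G = card (K m) * (index * m)" "\<not> r dvd index * m"
    "m dvd ord x" "m > 0"
proof -
  obtain m a where m: "ord x = m * r ^ a" "\<not> r dvd m"
    using prime_power_canonical[OF r(1), of "ord x"] ord_pos[of x] by auto
  have m0: "m > 0" using m(2) by (auto intro!: Nat.gr0I)
  have a: "a > 0"
  proof (rule Nat.gr0I)
    assume "a = 0"
    then have "order G = index * m" using index_mult m(1) by simp
    then show False using r m(2) by (simp add: prime_dvd_mult_iff)
  qed
  have mx: "m dvd ord x" using m(1) by simp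
  have cK: "card (K m) = r ^ a" using card_K_dvd[OF mx] m(1) m0 by simp
  have o: "order G = r ^ a * (index * m)" using index_mult m(1) by (simp add: ac_simps)
  have nd: "\<not> r dvd index * m" using r m(2) by (simp add: prime_dvd_mult_iff)
  let ?d = "card (rcosets (nmz (K m)))"
  have d: "?d mod r = 1" using sylow_index_mod(1)[OF finite_G subgroup_K cK r(1) o nd] .
  have "ncosdvd m * ord x * ?d = index * ord x"
    using lagrange[OF subgroup_nmz_K[of m]] card_nmz_K[of m] index_mult by (simp add: mult.commute)
  then have dd: "ncosdvd m * ?d = index" using ord_pos[of x] by (simp add: ac_simps)
  have "?d dvd order G" using lagrange[OF subgroup_nmz_K[of m]] by (metis dvd_triv_left)
  moreover have "?d = 1 \<Longrightarrow> K m \<lhd> G" using nmz_index_1[OF finite_G subgroup_K] by simp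
  ultimately show thesis using that[of m ?d a] d dd cK a o nd mx m0 by simp
qed

text \<open>Here \<open>A\<close> is self-normalising, and since \<open>K r\<close> is contained in
  \<open>A\<close> this survives in the quotient by \<open>K r\<close>, of order 105, where the
  image of \<open>A\<close> has order \<open>r\<close>.\<close>

lemma index_105_contradiction:
  assumes one: "ncos 1 = 1" and r: "r = 5 \<or> r = 7" "r dvd ord x" "ncosdvd r = index" "index * r = 105"
  shows False
proof -
  have n: "K r \<lhd> G" by (rule normal_K[OF r(3)])
  obtain H :: "'a monoid" and h where h: "group_epi G H h" "kernel G H h = K r"
    using quotient_epi[OF n] .
  interpret h: group_epi G H h by fact
  have finH: "finite (carrier H)" using h.finite_image[OF finite_G] .
  have oH: "order H = 105" using order_quotient_K[OF n r(2) h] r(4) by simp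
  have "card A = card (h ` A) * card (K r)"
    using h.card_image_subgroup[OF subgroup_A _ finite_G] h(2) K_subset_A by simp
  moreover have "card A = r * card (K r)" using card_K_dvd[OF r(2)] card_A by (simp add: mult.commute)
  ultimately have "card (h ` A) * card (K r) = r * card (K r)" by (rule trans[OF sym])
  moreover have "card (K r) \<noteq> 0" using card_K_dvd[OF r(2)] ord_pos[of x] by (metis mult_0 not_gr_zero x_closed)
  ultimately have cA: "card (h ` A) = r" by (metis mult_cancel2)
  have sub: "subgroup (h ` A) H" using h.subgroup_img_is_subgroup[OF subgroup_A] .
  have "card (nmz (K 1)) = card A" using card_nmz_K[of 1] one ncos_1 card_A by simp
  moreover have K1: "K 1 = A" by (simp add: K_def A_def)
  ultimately have nA: "nmz A = A"
    using card_subset_eq[OF finite_subgroup[OF finite_G subgroup_nmz_K[of 1]] A_subset_nmz[OF K_subset_A[of 1]]]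
    by simp
  have "h.H.nmz (h ` A) = h ` A"
  proof (intro equalityI subsetI)
    fix y assume y: "y \<in> h.H.nmz (h ` A)"
    then have "y \<in> carrier H" by (simp add: h.H.nmz_def)
    then obtain g where g: "g \<in> carrier G" "y = h g" using h.surj by (metis imageE)
    have "g \<otimes> a \<otimes> inv g \<in> A" if a: "a \<in> A" for a
    proof -
      have ac: "a \<in> carrier G" using subgroup.mem_carrier[OF subgroup_A a] .
      have "h g \<otimes>\<^bsub>H\<^esub> h a \<otimes>\<^bsub>H\<^esub> inv\<^bsub>H\<^esub> h g \<in> h ` A" using y g a by (simp add: h.H.nmz_def)
      then have "h (g \<otimes> a \<otimes> inv g) \<in> h ` A" using g ac by simp
      then obtain b where b: "b \<in> A" "h (g \<otimes> a \<otimes> inv g) = h b" by blast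
      have bc: "b \<in> carrier G" using subgroup.mem_carrier[OF subgroup_A b(1)] .
      have "g \<otimes> a \<otimes> inv g \<in> {y \<in> carrier G. h y = h b}" using b(2) g(1) ac by auto
      then have "g \<otimes> a \<otimes> inv g \<in> K r #> b" using h.fibre[OF bc] h(2) by simp
      then obtain k where k: "k \<in> K r" "g \<otimes> a \<otimes> inv g = k \<otimes> b" unfolding r_coset_def by blast
      have "k \<in> A" using K_subset_A k(1) by (rule subsetD)
      then show ?thesis unfolding k(2) by (rule subgroup.m_closed[OF subgroup_A _ b(1)])
    qed
    then have "g \<in> nmz A" using g(1) by (simp add: nmz_def)
    then show "y \<in> h ` A" using nA g(2) by simp
  qed (use h.H.subgroup_subset_nmz[OF sub] in blast)
  then show False using h.H.no_self_normalizing_order_105[OF finH oH sub] cA r(1) by simp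
qed

end

section \<open>Arithmetic and coset counts for indices 15 and 21\<close>

lemma sum_mod_periodic: "(\<Sum>j<k * m. f (j mod m)) = k * (\<Sum>j<m. f j)" for f :: "nat \<Rightarrow> nat"
proof (induction k)
  case (Suc k)
  have "(\<Sum>j<Suc k * m. f (j mod m)) = (\<Sum>j<k * m + m. f (j mod m))" by (simp add: add.commute)
  also have "\<dots> = (\<Sum>j<k * m. f (j mod m)) + (\<Sum>j<m. f ((k * m + j) mod m))"
  proof -
    have "(\<Sum>j<a + b. g j) = (\<Sum>j<a. g j) + (\<Sum>j<b. g (a + j))" for a b and g :: "nat \<Rightarrow> nat"
      by (induction b) auto
    then show ?thesis .
  qed
  also have "(\<Sum>j<m. f ((k * m + j) mod m)) = (\<Sum>j<m. f j)" by (intro sum.cong) auto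
  finally show ?case using Suc by simp
qed simp

lemma dvd_15: "d dvd 15 \<longleftrightarrow> d \<in> {1, 3, 5, 15 :: nat}"
proof
  assume d: "d dvd 15"
  then have "d \<le> 15" by (rule dvd_imp_le) simp
  then have "d \<in> {0,1,2,3,4,5,6,7,8,9,10,11,12,13,14,15}"
    unfolding insert_iff empty_iff by presburger
  then show "d \<in> {1, 3, 5, 15}" using d by (elim insertE) simp_all
qed auto

lemma dvd_21: "d dvd 21 \<longleftrightarrow> d \<in> {1, 3, 7, 21 :: nat}"
proof
  assume d: "d dvd 21"
  then have "d \<le> 21" by (rule dvd_imp_le) simp
  then have "d \<in> {0,1,2,3,4,5,6,7,8,9,10,11,12,13,14,15,16,17,18,19,20,21}"
    unfolding insert_iff empty_iff by presburger
  then show "d \<in> {1, 3, 7, 21}" using d by (elim insertE) simp_all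
qed auto

text \<open>The variables are the numbers of cosets with orbit lengths 1, 3, 5 and 9; the first
  three conditions say that normaliser indices divide 15. As differences of divisors of 15,
  \<open>q\<close> can only be 0 or 12 and \<open>r\<close> only 0 or 10. The last alternative is
  the pattern of C_5^2 : C_3.\<close>

lemma solve_15:
  fixes p q r t :: nat
  assumes "p \<in> {1, 3, 5, 15}" "p + q \<in> {1, 3, 5, 15}" "p + r \<in> {1, 3, 5, 15}"
    "3 dvd q" "5 dvd r" "9 dvd t" "p + q + r + t = 15"
  shows "p = 15 \<or> p + q = 15 \<and> q \<noteq> 0 \<or> p = 5 \<and> r = 10"
proof -
  have "q \<in> {0, 2, 4, 12, 14, 10}" "r \<in> {0, 2, 4, 12, 14, 10}" using assms(1-3) by auto
  then have q: "q = 0 \<or> q = 12" and r: "r = 0 \<or> r = 10" using assms(4,5) by auto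
  have t: "t = 0 \<or> t = 9"
  proof -
    obtain i where "t = 9 * i" using assms(6) by (auto elim!: dvdE)
    moreover have "t \<le> 15" using assms(7) by simp
    ultimately show ?thesis by (cases "i = 0"; cases "i = 1") auto
  qed
  show ?thesis using q r t assms(1)
    by (elim disjE insertE emptyE) (use assms(2,3,7) in simp_all)
qed

text \<open>Meant for odd powers \<open>u\<close> of 3 and \<open>z\<close> of 5. Equality holds at
  u = 3, z = 5, the group of order 75 itself; expanded around that point, the difference has only
  nonnegative coefficients.\<close>

lemma bound_75:
  fixes u z :: real
  assumes "u \<ge> 3" "z \<ge> 5"
  shows "(u + 1) * (145 * z + 1) / 24 + 10 * u * z \<le> 271 / 3647 * ((9 * u + 1) / 4 * ((625 * z + 1) / 6))"
proof -
  define s t where "s = u - 3" and "t = z - 5"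
  have st: "s \<ge> 0" "t \<ge> 0" "u = 3 + s" "z = 5 + t" using assms by (auto simp: s_def t_def)
  have "271 / 3647 * ((9 * u + 1) / 4 * ((625 * z + 1) / 6)) - ((u + 1) * (145 * z + 1) / 24 + 10 * u * z)
    = 15035/10941 * (s * t) + 48/7 * s + 25/1563 * t"
    unfolding st(3,4) by (simp add: field_simps)
  moreover have "s * t \<ge> 0" using st by simp
  ultimately show ?thesis using st(1,2) by linarith
qed

context group
begin

text \<open>Otherwise w = y^3 is an element of order 5 in \<open>P\<close>, and the group it
  generates is centralised by \<open>y\<close> and by the abelian group \<open>P\<close>, hence
  normal. The resulting series with factors of order 5, 5, 3 would make \<open>G\<close>
  supersolvable.\<close>

lemma order_75_cube:
  assumes fin: "finite (carrier G)" and o: "order G = 75" and ns: "\<not> supersolvable G"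
    and P: "P \<lhd> G" "card P = 25" "\<And>u v. u \<in> P \<Longrightarrow> v \<in> P \<Longrightarrow> u \<otimes> v = v \<otimes> u"
      "\<And>w. w \<in> P \<Longrightarrow> w [^] (5::nat) = \<one>"
    and y: "y \<in> carrier G" "y \<notin> P"
  shows "y [^] (3::nat) = \<one>"
proof (rule ccontr)
  define w where "w = y [^] (3::nat)"
  assume "y [^] (3::nat) \<noteq> \<one>"
  then have w1: "w \<noteq> \<one>" by (simp add: w_def)
  interpret P: normal P G by (rule P)
  have wP: "w \<in> P" unfolding w_def using o P(2) by (intro pow_index_normal[OF P(1) fin y(1)]) simp
  have wc: "w \<in> carrier G" using y by (simp add: w_def)
  have "ord w dvd 5" using P(4)[OF wP] wc pow_eq_id by blast
  moreover have "ord w \<noteq> 1" using ord_eq_1[OF wc] w1 by blast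
  moreover have "prime (5::nat)" by simp
  ultimately have ow: "ord w = 5" by (metis prime_nat_iff)
  define M where "M = generate G {w}"
  have M: "subgroup M G" unfolding M_def using wc by (intro generate_is_subgroup) simp
  have cM: "card M = 5" unfolding M_def using generate_pow_card[OF wc] ow by simp
  have MP: "M \<subseteq> P" unfolding M_def using generate_subgroup_incl[OF _ P.is_subgroup] wP by simp
  note N = subgroup_nmz[OF subgroup.subset[OF M] finite_subgroup[OF fin M]]
  have "P \<subseteq> nmz M"
  proof
    fix p assume p: "p \<in> P"
    have pc: "p \<in> carrier G" using p by (rule P.mem_carrier)
    have "p \<otimes> u \<otimes> inv p = u" if "u \<in> M" for u
    proof -
      have u: "u \<in> P" using that MP by blast
      then show ?thesis using P(3)[OF p u] pc P.mem_carrier[OF u] by (simp add: m_assoc)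
    qed
    then show "p \<in> nmz M" using pc by (simp add: nmz_def)
  qed
  moreover have "y \<in> nmz M"
  proof -
    have "y \<otimes> u \<otimes> inv y = u" if uM: "u \<in> M" for u
    proof -
      obtain j :: nat where "u = w [^] j"
        using uM generate_pow_nat[OF wc] ord_ge_1[OF fin wc] unfolding M_def by auto
      then have u: "u = y [^] (3 * j)" using y(1) by (simp add: w_def nat_pow_pow)
      have "y \<otimes> u = u \<otimes> y" unfolding u using y(1) by (metis nat_pow_Suc nat_pow_Suc2)
      then show ?thesis using y(1) u by (simp add: m_assoc)
    qed
    then show ?thesis using y(1) by (simp add: nmz_def)
  qed
  ultimately have sub: "P \<subset> nmz M" using y(2) by blast
  have "card (nmz M) = 75"
  proof -
    have "card P < card (nmz M)" using sub finite_subgroup[OF fin N] by (rule psubset_card_mono[rotated])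
    moreover have "card P dvd card (nmz M)"
      using lagrange_subgroup[OF P.is_subgroup N] sub by (metis dvd_triv_right psubset_imp_subset)
    then obtain k where k: "card (nmz M) = 25 * k" using P(2) by (auto elim!: dvdE)
    have "card (nmz M) dvd 75" using lagrange[OF N] o by (metis dvd_triv_right)
    then have "25 * k dvd 25 * 3" using k by simp
    then have "k dvd 3" by simp
    moreover have "prime (3::nat)" by simp
    ultimately have "k = 1 \<or> k = 3" by (metis prime_nat_iff)
    then show ?thesis using k \<open>card P < card (nmz M)\<close> P(2) by auto
  qed
  then have "nmz M = carrier G" using o fin by (intro card_subset_eq) (auto simp: nmz_def order_def)
  then have nM: "M \<lhd> G" using nmz_eq_carrier[OF M] by simp
  have ss: "sschain G M" using sschain_prime[OF fin nM] cM by simp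
  then have "sschain G P" using sschain_prime_step[OF fin ss P(1) MP, of 5] P(2) cM by simp
  then have "sschain G (carrier G)"
    using sschain_prime_step[OF fin _ _ P.subset, of 3] P(2) o
    by (simp add: order_def normal_inv_iff subgroup_self)
  then show False using ns supersolvable_iff_sschain by simp
qed

end

context cyclic_subgroup
begin

lemma sum_ncos_on:
  assumes "finite S" "\<And>s. ncos s \<noteq> 0 \<Longrightarrow> s \<in> S"
  shows "(\<Sum>s\<in>S. ncos s) = index"
proof -
  have "(\<Sum>s\<in>S. ncos s) = (\<Sum>s | s dvd ord x. ncos s)"
    using assms ncos_nonzero(1) ord_pos[of x] by (intro sum.mono_neutral_cong) auto
  then show ?thesis using sum_ncos by simp
qed

lemma ncos_add_le_index: "s > 1 \<Longrightarrow> ncos 1 + ncos s \<le> index"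
proof (cases "ncos s = 0")
  case True
  then show ?thesis using ncos_1(1) ncosdvd_le[of 1] by simp
next
  case False
  assume "s > 1"
  then show ?thesis
    using ncosdvd_ge[of s "ord x"] ncos_nonzero(1)[OF False] ncosdvd_le[of "ord x"] ord_pos[of x] by simp
qed

text \<open>A length that occurs does so for at least \<open>s\<close> cosets, in addition to the
  cosets fixed by \<open>A\<close>.\<close>

lemma ncos_size:
  assumes "ncos s \<noteq> 0" "s \<noteq> 1" shows "s > 1" "ncos 1 + s \<le> index"
proof -
  show s: "s > 1" using ncos_nonzero(2)[OF assms(1)] assms(2) by simp
  have "s \<le> ncos s" using dvd_ncos[of s] assms(1) by (intro dvd_imp_le) auto
  then show "ncos 1 + s \<le> index" using ncos_add_le_index[OF s] by simp
qed

lemma ncosdvd_prime: "prime p \<Longrightarrow> ncosdvd p = ncos 1 + ncos p"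
proof -
  assume p: "prime p"
  then have "{s. s dvd p} = {1, p}" by (auto simp: prime_nat_iff)
  then show ?thesis using ncosdvd_eq_sum[of p] p prime_gt_1_nat[OF p] by simp
qed



text \<open>The Sylow number for \<open>r\<close> divides the index and is 1 modulo
  \<open>r\<close>; being nontrivial it is the whole index, so \<open>A\<close> is the normaliser of
  its Sylow r-subgroup. Every nontrivial orbit length is then divisible by \<open>r\<close>, and
  parity and size leave 7 for index 15, and 5 or 15 for index 21. Counting makes \<open>K r\<close>
  normal with quotient of order 105.\<close>

lemma index_15_21_contradiction:
  assumes odd: "odd (order G)" and r: "index = 15 \<and> r = 7 \<or> index = 21 \<and> r = 5" "r dvd order G"
    and ns: "\<And>m a q. \<lbrakk>K m \<lhd> G; card (K m) = r ^ a; a > 0; order G = card (K m) * q; \<not> r dvd q\<rbrakk> \<Longrightarrow> False"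
  shows False
proof -
  have pr: "prime r" "\<not> r dvd index" using r(1) by auto
  obtain m d a where m: "ncosdvd m * d = index" "d mod r = 1" "d = 1 \<Longrightarrow> K m \<lhd> G"
    "card (K m) = r ^ a" "a > 0" "order G = card (K m) * (index * m)" "\<not> r dvd index * m"
    "m dvd ord x" "m > 0"
    using sylow_data[OF pr(1) r(2) pr(2)] by metis
  have "d \<noteq> 1" using ns m(3-7) by blast
  moreover have "d dvd index" using m(1) by (metis dvd_triv_right)
  ultimately have "d = index" using m(2) r(1) by (auto simp: dvd_15 dvd_21)
  then have nm: "ncosdvd m = 1" using m(1) r(1) by auto
  have "ncosdvd 1 \<le> ncosdvd m"
    unfolding ncosdvd_def using finite_rcosets by (intro card_mono) auto
  then have one: "ncos 1 = 1" using nm ncos_1 by simp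
  have ox: "ord x = r ^ a * m" using card_K_dvd[OF m(8)] m(4) by simp
  have rs: "r dvd s" if "ncos s \<noteq> 0" "s \<noteq> 1" for s
  proof (rule ccontr)
    assume "\<not> r dvd s"
    then have "coprime s (r ^ a)" using pr(1) by (metis coprime_commute coprime_power_left_iff prime_imp_coprime)
    then have "s dvd m" using ncos_nonzero(1)[OF that(1)] ox by (metis coprime_dvd_mult_right_iff)
    then have "ncos 1 + ncos s \<le> ncosdvd m" using ncosdvd_ge ncos_size(1)[OF that] m(9) by blast
    then show False using nm one that(1) by simp
  qed
  have od: "odd s" if "ncos s \<noteq> 0" for s
    using ncos_nonzero(1)[OF that] ord_dvd_group_order[of x] odd by (metis dvd_trans x_closed)
  show False
  proof (cases "r = 7")
    case True
    have "s \<in> {1, 7}" if "ncos s \<noteq> 0" for s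
    proof (rule ccontr)
      assume s: "s \<notin> {1, 7}"
      then have "s \<le> 14" "7 dvd s" "odd s" using ncos_size(2)[OF that] rs[OF that] od[OF that] one r(1) True by auto
      moreover then have "s \<in> {0,1,2,3,4,5,6,7,8,9,10,11,12,13,14}"
        unfolding insert_iff empty_iff by presburger
      ultimately show False using s by auto
    qed
    then have "(\<Sum>s\<in>{1, 7}. ncos s) = index" by (intro sum_ncos_on) auto
    moreover have i: "index = 15" using r(1) True by auto
    ultimately have "ncos 7 = 14" using one by simp
    then show False
      using index_105_contradiction[OF one, of 7] ncosdvd_prime[of 7] ncos_nonzero(1)[of 7] one i by simp
  next
    case False
    then have i: "index = 21" "r = 5" using r(1) by auto
    have "s \<in> {1, 5, 15}" if "ncos s \<noteq> 0" for s
    proof (rule ccontr)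
      assume s: "s \<notin> {1, 5, 15}"
      then have "s \<le> 20" "5 dvd s" "odd s" using ncos_size(2)[OF that] rs[OF that] od[OF that] one i by auto
      moreover then have "s \<in> {0,1,2,3,4,5,6,7,8,9,10,11,12,13,14,15,16,17,18,19,20}"
        unfolding insert_iff empty_iff by presburger
      ultimately show False using s by auto
    qed
    then have "(\<Sum>s\<in>{1, 5, 15}. ncos s) = index" by (intro sum_ncos_on) auto
    then have sum: "ncos 5 + ncos 15 = 20" using i one by simp
    \<comment> \<open>Divisibility by 5 leaves 0 or 20; the value 0 would give 20 cosets with orbit
      length 15, which is not a multiple of 15.\<close>
    have "1 + ncos 5 dvd 21" using ncosdvd_prime[of 5] ncosdvd_dvd[of 5] one i by simp
    then have "ncos 5 \<in> {0, 2, 6, 20}" unfolding dvd_21 by auto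
    then have "ncos 5 = 0 \<or> ncos 5 = 20" using dvd_ncos[of 5] by auto
    then have "ncos 5 = 20" using sum dvd_ncos[of 15] by auto
    then show False
      using index_105_contradiction[OF one, of 5] ncosdvd_prime[of 5] ncos_nonzero(1)[of 5] one i by simp
  qed
qed

text \<open>Orbit lengths have no prime factor besides 3 and 5 and are at most 14, since some coset
  is fixed. Only 1, 3, 5 and 9 remain.\<close>

lemma index_15_cases:
  assumes i: "index = 15" and o: "order G = 3 ^ a * 5 ^ b"
  shows "ncosdvd 1 = 15 \<or> ncosdvd 3 = 15 \<and> 3 dvd ord x \<or> ncosdvd 5 = 15 \<and> 5 dvd ord x \<and> ncos 1 = 5"
proof -
  have nd: "\<not> p dvd s" if "ncos s \<noteq> 0" "prime p" "p \<noteq> 3" "p \<noteq> 5" for p s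
  proof
    assume "p dvd s"
    then have "p dvd 3 ^ a * 5 ^ b"
      using ncos_nonzero(1)[OF that(1)] ord_dvd_group_order[of x] o by (metis dvd_trans x_closed)
    then have "p dvd 3 \<or> p dvd 5" using that(2) by (metis prime_dvd_mult_iff prime_dvd_power)
    moreover have "prime (3::nat)" "prime (5::nat)" by simp_all
    ultimately show False using that(2-4) primes_dvd_imp_eq by blast
  qed
  have c1: "ncos 1 \<in> {1, 3, 5, 15}" using ncosdvd_dvd[of 1] ncos_1(1) i by (simp only: dvd_15)
  have S: "s \<in> {1, 3, 5, 9}" if "ncos s \<noteq> 0" for s
  proof (rule ccontr)
    assume s: "s \<notin> {1, 3, 5, 9}"
    then have s14: "s \<le> 14" using ncos_size(2)[OF that] i c1 by auto
    have "\<not> 2 dvd s" "\<not> 7 dvd s" "\<not> 11 dvd s" "\<not> 13 dvd s" using nd[OF that] by auto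
    moreover have "s \<in> {0,1,2,3,4,5,6,7,8,9,10,11,12,13,14}"
      using s14 unfolding insert_iff empty_iff by presburger
    ultimately show False using s by auto
  qed
  have sum: "ncos 1 + ncos 3 + ncos 5 + ncos 9 = 15"
    using sum_ncos_on[of "{1,3,5,9}"] S i by simp
  have d3: "ncos 1 + ncos 3 \<in> {1,3,5,15}" using ncosdvd_prime[of 3] ncosdvd_dvd[of 3] i by (simp add: dvd_15)
  have d5: "ncos 1 + ncos 5 \<in> {1,3,5,15}" using ncosdvd_prime[of 5] ncosdvd_dvd[of 5] i by (simp add: dvd_15)
  have m: "3 dvd ncos 3" "5 dvd ncos 5" "9 dvd ncos 9" using dvd_ncos by auto
  have "ncos 1 = 15 \<or> ncos 1 + ncos 3 = 15 \<and> ncos 3 \<noteq> 0 \<or> ncos 1 = 5 \<and> ncos 5 = 10"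
    using c1 d3 d5 m sum by (rule solve_15)
  then show ?thesis
    using ncosdvd_prime[of 3] ncosdvd_prime[of 5] ncos_1(1) ncos_nonzero(1)[of 3] ncos_nonzero(1)[of 5] by auto
qed

end

section \<open>The quotient of order 75\<close>

text \<open>On a cyclic group of order s t, taking t-th powers maps t-to-one onto the subgroup of
  order \<open>s\<close>.\<close>

lemma (in cyclic_subgroup) sum_ord_pow_K:
  assumes K: "m dvd ord x" "card (K m) = s * t" and "coprime s t" "s > 0" "t > 0"
  shows "(\<Sum>u\<in>K m. ord (u [^] t)) = t * cyc_psi s"
proof -
  define g where "g = x [^] m"
  have gc: "g \<in> carrier G" by (simp add: g_def)
  have og: "ord g = s * t" using K(2) by (simp add: card_K g_def)
  have inj: "inj_on (\<lambda>j. g [^] j) {..<s * t}"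
    using ord_inj[of g] gc og assms(4,5) by (auto simp: inj_on_def)
  have "(\<lambda>j. g [^] j) ` {..<s * t} \<subseteq> K m"
    by (auto simp: K_def generate_range g_def)
  then have im: "(\<lambda>j. g [^] j) ` {..<s * t} = K m"
    using inj K(2) finite_subgroup[OF finite_G subgroup_K] by (intro card_subset_eq) (auto simp: card_image)
  have "(\<Sum>u\<in>K m. ord (u [^] t)) = (\<Sum>j<s * t. ord ((g [^] j) [^] t))"
    unfolding im[symmetric] by (subst sum.reindex[OF inj]) simp
  also have "\<dots> = (\<Sum>j<s * t. s div gcd s (j mod s))"
  proof (intro sum.cong refl)
    fix j
    have "ord ((g [^] j) [^] t) = s * t div gcd (s * t) (j * t)"
      using gc og assms(4,5) ord_pow_gen[of g "j * t"] by (simp add: nat_pow_pow)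
    also have "gcd (s * t) (j * t) = gcd s j * t" by (simp add: gcd_mult_distrib_nat mult.commute)
    also have "s * t div (gcd s j * t) = s div gcd s j" using assms(5) by simp
    finally show "ord ((g [^] j) [^] t) = s div gcd s (j mod s)"
      by (metis gcd.commute gcd_red_nat)
  qed
  also have "\<dots> = t * cyc_psi s"
    using sum_mod_periodic[where f = "\<lambda>j. s div gcd s j" and k = t and m = s] by (simp add: cyc_psi_def mult.commute)
  finally show ?thesis .
qed

context group
begin

text \<open>The centraliser of \<open>N\<close> in \<open>M\<close>, and the centre when both agree.
  Each use compares it, or its preimage, with a maximality property of subgroups containing
  \<open>A\<close>.\<close>

lemma normal_centralizer:
  assumes "M \<lhd> G" "N \<lhd> G"
  shows "{g \<in> M. \<forall>v\<in>N. v \<otimes> g = g \<otimes> v} \<lhd> G" (is "?C \<lhd> G")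
proof -
  interpret M: normal M G by fact
  interpret N: normal N G by fact
  show ?thesis unfolding normal_inv_iff
  proof (intro conjI ballI)
    show "subgroup ?C G"
    proof (rule subgroupI)
      show "?C \<subseteq> carrier G" using M.subset by blast
      have "\<one> \<in> ?C" using N.subset by auto
      then show "?C \<noteq> {}" by blast
      fix g assume g: "g \<in> ?C"
      then have gc: "g \<in> carrier G" using M.subset by blast
      have "v \<otimes> inv g = inv g \<otimes> v" if v: "v \<in> N" for v
      proof -
        have vc: "v \<in> carrier G" using N.mem_carrier[OF v] .
        have "v \<otimes> g = g \<otimes> v" using g v by blast
        then have "inv g \<otimes> (v \<otimes> g) \<otimes> inv g = inv g \<otimes> (g \<otimes> v) \<otimes> inv g" by simp
        moreover have "inv g \<otimes> (v \<otimes> g) \<otimes> inv g = inv g \<otimes> v \<otimes> (g \<otimes> inv g)"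
          "inv g \<otimes> (g \<otimes> v) \<otimes> inv g = (inv g \<otimes> g) \<otimes> v \<otimes> inv g"
          using gc vc by (simp_all only: m_assoc m_closed inv_closed)
        ultimately show ?thesis using gc vc by simp
      qed
      then show "inv g \<in> ?C" using g by blast
      fix g' assume g': "g' \<in> ?C"
      then have gc': "g' \<in> carrier G" using M.subset by blast
      have "v \<otimes> (g \<otimes> g') = g \<otimes> g' \<otimes> v" if v: "v \<in> N" for v
      proof -
        have vc: "v \<in> carrier G" using N.mem_carrier[OF v] .
        have e: "v \<otimes> g = g \<otimes> v" "v \<otimes> g' = g' \<otimes> v" using g g' v by blast+
        have "v \<otimes> (g \<otimes> g') = (v \<otimes> g) \<otimes> g'" using gc gc' vc by (simp add: m_assoc)
        also have "\<dots> = g \<otimes> (v \<otimes> g')" unfolding e(1) using gc gc' vc by (simp add: m_assoc)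
        also have "\<dots> = g \<otimes> g' \<otimes> v" unfolding e(2) using gc gc' vc by (simp add: m_assoc)
        finally show ?thesis .
      qed
      then show "g \<otimes> g' \<in> ?C" using g g' by blast
    qed
    fix y g assume y: "y \<in> carrier G" and g: "g \<in> ?C"
    then have gM: "g \<in> M" by blast
    have gc: "g \<in> carrier G" using M.mem_carrier[OF gM] .
    have "v \<otimes> (y \<otimes> g \<otimes> inv y) = y \<otimes> g \<otimes> inv y \<otimes> v" if v: "v \<in> N" for v
    proof -
      have vc: "v \<in> carrier G" using N.mem_carrier[OF v] .
      have w: "inv y \<otimes> v \<otimes> y \<in> N" using N.inv_op_closed1[OF y v] .
      have "y \<otimes> ((inv y \<otimes> v \<otimes> y) \<otimes> g) \<otimes> inv y = (y \<otimes> inv y) \<otimes> v \<otimes> (y \<otimes> g \<otimes> inv y)"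
        using y vc gc by (simp only: m_assoc m_closed inv_closed)
      then have "v \<otimes> (y \<otimes> g \<otimes> inv y) = y \<otimes> ((inv y \<otimes> v \<otimes> y) \<otimes> g) \<otimes> inv y"
        using y vc gc by simp
      also have "(inv y \<otimes> v \<otimes> y) \<otimes> g = g \<otimes> (inv y \<otimes> v \<otimes> y)" using g w by blast
      also have "y \<otimes> (g \<otimes> (inv y \<otimes> v \<otimes> y)) \<otimes> inv y = y \<otimes> g \<otimes> inv y \<otimes> v \<otimes> (y \<otimes> inv y)"
        using y vc gc by (simp only: m_assoc m_closed inv_closed)
      also have "\<dots> = y \<otimes> g \<otimes> inv y \<otimes> v" using y vc gc by simp
      finally show ?thesis .
    qed
    then show "y \<otimes> g \<otimes> inv y \<in> ?C" using M.inv_op_closed2[OF y gM] by blast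
  qed
qed

text \<open>Commutativity makes the n-th power map on \<open>N\<close> a homomorphism, and this set
  is its kernel.\<close>

lemma normal_torsion:
  assumes "N \<lhd> G" "\<And>u v. u \<in> N \<Longrightarrow> v \<in> N \<Longrightarrow> u \<otimes> v = v \<otimes> u"
  shows "{g \<in> N. g [^] (n::nat) = \<one>} \<lhd> G" (is "?C \<lhd> G")
proof -
  interpret N: normal N G by fact
  show ?thesis unfolding normal_inv_iff
  proof (intro conjI ballI)
    show "subgroup ?C G"
    proof (rule subgroupI)
      show "?C \<subseteq> carrier G" using N.subset by blast
      have "\<one> \<in> ?C" by simp
      then show "?C \<noteq> {}" by blast
      fix g assume g: "g \<in> ?C"
      then have gc: "g \<in> carrier G" using N.subset by blast
      show "inv g \<in> ?C" using g nat_pow_inv[OF gc, of n] by simp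
      fix g' assume g': "g' \<in> ?C"
      then have gc': "g' \<in> carrier G" using N.subset by blast
      have "(g \<otimes> g') [^] n = g [^] n \<otimes> g' [^] n" using pow_mult_distrib[of g g' n] assms(2) g g' gc gc' by blast
      then show "g \<otimes> g' \<in> ?C" using g g' by simp
    qed
    fix y g assume y: "y \<in> carrier G" and g: "g \<in> ?C"
    then have "g \<in> carrier G" using N.subset by blast
    then have "(y \<otimes> g \<otimes> inv y) [^] n = \<one>" using conj_pow[OF y, of g n] g y by simp
    then show "y \<otimes> g \<otimes> inv y \<in> ?C" using N.inv_op_closed2[OF y] g by simp
  qed
qed

end

text \<open>As \<open>u\<close> centralises \<open>D\<close>, the exponent q t ord(v^t) kills both
  \<open>v\<close> and \<open>u\<close>, hence v u. In the application \<open>t\<close> is the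
  5-part of |D| and \<open>u\<close> a 5-element, so that only the 3-part of \<open>v\<close>
  enlarges the order.\<close>

lemma (in group) sum_ord_coset_le:
  assumes fin: "finite (carrier G)" and D: "subgroup D G"
    and u: "u \<in> carrier G" "\<And>v. v \<in> D \<Longrightarrow> v \<otimes> u = u \<otimes> v" "u [^] (q * t) = \<one>" "q * t > 0"
  shows "(\<Sum>y\<in>D #> u. ord y) \<le> q * t * (\<Sum>v\<in>D. ord (v [^] (t::nat)))"
proof -
  interpret D: subgroup D G by fact
  have im: "D #> u = (\<lambda>v. v \<otimes> u) ` D" by (auto simp: r_coset_def)
  have inj: "inj_on (\<lambda>v. v \<otimes> u) D" using u(1) by (auto simp: inj_on_def)
  have "(\<Sum>y\<in>D #> u. ord y) = (\<Sum>v\<in>D. ord (v \<otimes> u))"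
    unfolding im by (subst sum.reindex[OF inj]) simp
  also have "\<dots> \<le> (\<Sum>v\<in>D. q * t * ord (v [^] t))"
  proof (intro sum_mono)
    fix v assume v: "v \<in> D"
    have vc: "v \<in> carrier G" using v by (rule D.mem_carrier)
    let ?e = "ord (v [^] t)"
    have "v [^] (t * ?e) = \<one>" using vc by (simp flip: nat_pow_pow)
    then have "(v [^] (t * ?e)) [^] q = \<one>" by simp
    then have v1: "v [^] (q * t * ?e) = \<one>" using vc by (simp add: nat_pow_pow ac_simps)
    have "(u [^] (q * t)) [^] ?e = \<one>" using u(3) by simp
    then have u1: "u [^] (q * t * ?e) = \<one>" using u(1) by (simp add: nat_pow_pow)
    have "(v \<otimes> u) [^] (q * t * ?e) = \<one>"
      using pow_mult_distrib[OF u(2)[OF v] vc u(1)] v1 u1 by simp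
    then have "ord (v \<otimes> u) dvd q * t * ?e" using vc u(1) by (simp add: pow_eq_id)
    moreover have "?e > 0" using ord_ge_1[OF fin, of "v [^] t"] vc by simp
    ultimately show "ord (v \<otimes> u) \<le> q * t * ?e" using u(4) by (intro dvd_imp_le) auto
  qed
  finally show ?thesis by (simp add: sum_distrib_left)
qed

context cyclic_subgroup
begin

text \<open>With \<open>E\<close> the preimage of the Sylow 5-subgroup \<open>P\<close> of the
  quotient by \<open>D\<close>, elements are counted in three layers: outside \<open>E\<close> the
  order is at most 3 d, E - D consists of 24 cosets of the central subgroup \<open>D\<close> of
  \<open>E\<close>, and \<open>D\<close> is cyclic. Centrality and the shape of \<open>P\<close>
  follow from \<open>A\<close> being maximal in a suitable sense.\<close>

theorem psi_le_order_75:
  assumes i: "index = 15" and c: "ncosdvd 5 = 15" "5 dvd ord x" "ncos 1 = 5"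
    and o: "order G = 3 ^ a * 5 ^ b" and ns: "\<not> supersolvable G"
  shows "real (psi G) \<le> 271 / 3647 * real (cyc_psi (order G))"
proof -
  have p5: "prime (5::nat)" and p3: "prime (3::nat)" by simp_all
  define D where "D = K 5"
  define d where "d = card D"
  have nD: "D \<lhd> G" unfolding D_def using normal_K c(1) i by simp
  interpret D: normal D G by (rule nD)
  have ox: "ord x = 5 * d" using card_K_dvd[OF c(2)] by (simp add: d_def D_def)
  have oG: "order G = 75 * d" using index_mult ox i by simp
  have d0: "d > 0" using ox ord_pos[of x] by simp
  obtain H :: "'a monoid" and h where h: "group_epi G H h" "kernel G H h = D"
    using quotient_epi[OF nD] .
  interpret h: group_epi G H h by fact
  have finH: "finite (carrier H)" using h.finite_image[OF finite_G] .
  have oH: "order H = 75" using order_quotient_K[of 5 H h] nD c(2) h i by (simp add: D_def)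
  have nsH: "\<not> supersolvable H" using h.supersolvable_vimage ns h(2) sschain_K nD by (auto simp: D_def)
  have h1: "h y = \<one>\<^bsub>H\<^esub> \<longleftrightarrow> y \<in> D" if "y \<in> carrier G" for y
    using that h(2) by (auto simp: kernel_def)
  obtain P where P: "subgroup P H" "card P = 5 ^ 2"
    using sylow_thm[OF p5 h.H.group_axioms, of 2 3] oH finH by auto
  have nP: "P \<lhd> H"
  proof (rule h.H.sylow_normal[OF finH P p5])
    show "order H = 5 ^ 2 * 3" using oH by simp
    fix e :: nat assume "e dvd 3" "e mod 5 = 1"
    then show "e = 1" using p3 by (auto simp: prime_nat_iff)
  qed simp
  interpret P: normal P H by (rule nP)
  \<comment> \<open>The quotient by \<open>P\<close> has order 3, so cubes lie in \<open>P\<close>;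
    an exponent prime to 3 then suffices.\<close>
  have mem_P: "h y \<in> P" if y: "y \<in> carrier G" "(h y) [^]\<^bsub>H\<^esub> (n::nat) \<in> P" "\<not> 3 dvd n" for y n
  proof (rule h.H.coprime_pow_mem[OF P(1) _ _ y(2) prime_imp_coprime[OF p3 y(3)]])
    show "h y [^]\<^bsub>H\<^esub> (3::nat) \<in> P"
      using y(1) P(2) oH by (intro h.H.pow_index_normal[OF nP finH]) auto
  qed (use y(1) in simp)
  define E where "E = {y \<in> carrier G. h y \<in> P}"
  have nE: "E \<lhd> G" unfolding E_def by (rule h.normal_vimage[OF nP])
  interpret E: normal E G by (rule nE)
  have cE: "card E = 25 * d"
    unfolding E_def using h.card_vimage[OF P.subset finite_G] P(2) h(2) by (simp add: d_def)
  have finE: "finite E" using finite_subgroup[OF finite_G E.is_subgroup] .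
  have AE: "A \<subseteq> E"
  proof
    fix y assume y: "y \<in> A"
    have yc: "y \<in> carrier G" using subgroup.mem_carrier[OF subgroup_A y] .
    obtain j :: nat where "y = x [^] j" using y by (auto simp: A_range)
    then have "y [^] (5::nat) = x [^] (5 * j)" by (simp add: nat_pow_pow mult.commute)
    then have "y [^] (5::nat) \<in> D" unfolding D_def using pow_mem_K_iff[OF c(2)] by simp
    then have "h (y [^] (5::nat)) = \<one>\<^bsub>H\<^esub>" using h1[of "y [^] (5::nat)"] yc by simp
    then have "h y [^]\<^bsub>H\<^esub> (5::nat) \<in> P" using h.hom_nat_pow[OF yc] by (simp add: P.one_closed)
    then have "h y \<in> P" using mem_P[OF yc, of 5] by simp
    then show "y \<in> E" using yc unfolding E_def by blast
  qed
  have DA: "D \<subseteq> A" unfolding D_def by (rule K_subset_A)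
  have DE: "D \<subseteq> E" using DA AE by blast
  have K1: "K 1 = A" by (simp add: K_def A_def)
  have cN: "card (nmz A) = card E" using card_nmz_K[of 1] K1 c(3) ncos_1 ox cE by simp
  \<comment> \<open>Since \<open>ncos 1 = 5\<close>, the normaliser of \<open>A\<close> has order 25
    d, the order of \<open>E\<close>. Its index over \<open>D\<close> is 25, so it maps into
    \<open>P\<close>.\<close>
  have NE: "nmz A = E"
  proof (rule card_subset_eq[OF finE _ cN])
    have N: "subgroup (nmz A) G" using subgroup_nmz_K[of 1] K1 by simp
    show "nmz A \<subseteq> E"
    proof
      fix y assume y: "y \<in> nmz A"
      have yc: "y \<in> carrier G" using y by (simp add: nmz_def)
      have "y [^] (25::nat) \<in> D"
      proof (rule pow_index_subgroup[OF D.is_subgroup N _ finite_G y])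
        show "D \<subseteq> nmz A" using DA A_subset_nmz[of A] by blast
        show "nmz A \<subseteq> nmz D" using nD unfolding normal_inv_iff by (auto simp: nmz_def)
        show "card (nmz A) = card D * 25" using cN cE by (simp add: d_def)
      qed
      then have "h (y [^] (25::nat)) = \<one>\<^bsub>H\<^esub>" using h1[of "y [^] (25::nat)"] yc by simp
      then have "h y [^]\<^bsub>H\<^esub> (25::nat) \<in> P" using h.hom_nat_pow[OF yc] by (simp add: P.one_closed)
      then have "h y \<in> P" using mem_P[OF yc, of 25] by simp
      then show "y \<in> E" using yc unfolding E_def by blast
    qed
  qed
  \<comment> \<open>|E : A| = 5 leaves only \<open>A\<close> and \<open>E\<close>, and
    \<open>A\<close> is not normal because its normaliser \<open>E\<close> is proper. So a normal
    subgroup of \<open>G\<close> inside \<open>E\<close> that contains \<open>A\<close> is all of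
    \<open>E\<close>; this is applied to the centraliser of \<open>D\<close>, then to the preimages
    of the centre and of the 5-torsion of \<open>P\<close>.\<close>
  have max: "C = E" if C: "C \<lhd> G" "A \<subseteq> C" "C \<subseteq> E" for C
  proof (rule ccontr)
    assume "C \<noteq> E"
    have sC: "subgroup C G" using C(1) normal_imp_subgroup by blast
    have cA: "card A = 5 * d" using card_A ox by simp
    obtain k where k: "card C = k * card A"
      using lagrange_subgroup[OF subgroup_A sC C(2)] by metis
    have "card C dvd card E" using lagrange_subgroup[OF sC E.is_subgroup C(3)] by (metis dvd_triv_right)
    then have "k dvd 5" using k cA cE d0 by (auto elim!: dvdE)
    moreover have "k \<noteq> 5"
    proof
      assume "k = 5"
      then have "card C = card E" using k cA cE by simp
      then show False using card_subset_eq[OF finE C(3)] \<open>C \<noteq> E\<close> by simp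
    qed
    ultimately have "k = 1" using p5 by (metis prime_nat_iff)
    then have "C = A" using k card_subset_eq[OF finite_subgroup[OF finite_G sC] C(2)] by simp
    then have "nmz A = carrier G" using C(1) unfolding normal_inv_iff by (auto simp: nmz_def)
    then have "card E = order G" using NE by (simp add: order_def)
    then show False using cE oG d0 by simp
  qed
  have cent: "v \<otimes> u = u \<otimes> v" if uv: "u \<in> E" "v \<in> D" for u v
  proof -
    define C where "C = {g \<in> E. \<forall>v\<in>D. v \<otimes> g = g \<otimes> v}"
    have "C \<lhd> G" unfolding C_def by (rule normal_centralizer[OF nE nD])
    moreover have "A \<subseteq> C" using AE DA A_comm by (auto simp: C_def)
    moreover have "C \<subseteq> E" by (auto simp: C_def)
    ultimately have "C = E" by (rule max)
    then show ?thesis using uv by (auto simp: C_def)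
  qed
  have hE: "h ` E = P"
    unfolding E_def using h.surj P.subset by (auto simp: image_iff)
  \<comment> \<open>The 5-group \<open>P\<close> acts on the image of \<open>A\<close>, a group of
    order 5; the number of fixed points is a positive multiple of 5, so all are fixed and the image
    is central in \<open>P\<close>.\<close>
  have A_fix: "inv\<^bsub>H\<^esub> p \<otimes>\<^bsub>H\<^esub> h g \<otimes>\<^bsub>H\<^esub> p = h g" if pg: "p \<in> P" "g \<in> A" for p g
  proof -
    have sA: "subgroup (h ` A) H" using h.subgroup_img_is_subgroup[OF subgroup_A] .
    have "card A = card (h ` A) * card D"
      using h.card_image_subgroup[OF subgroup_A _ finite_G] h(2) DA by simp
    then have cA: "card (h ` A) = 5" using card_A ox d0 by (simp add: d_def)
    interpret pact: finite_right_action H P "h ` A" "\<lambda>e b. inv\<^bsub>H\<^esub> b \<otimes>\<^bsub>H\<^esub> e \<otimes>\<^bsub>H\<^esub> b"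
    proof (rule h.H.conj_action[OF finH P(1) subgroup.subset[OF sA]])
      fix e q assume e: "e \<in> h ` A" and "q \<in> P"
      then obtain g y where g: "g \<in> A" "e = h g" and y: "y \<in> E" "q = h y" using hE by blast
      have yc: "y \<in> carrier G" and gc: "g \<in> carrier G"
        using E.mem_carrier[OF y(1)] subgroup.mem_carrier[OF subgroup_A g(1)] by auto
      have "inv y \<in> nmz A" using y(1) NE E.m_inv_closed by blast
      then have "inv y \<otimes> g \<otimes> inv (inv y) \<in> A" using g(1) unfolding nmz_def by blast
      then have "h (inv y \<otimes> g \<otimes> y) \<in> h ` A" using yc by simp
      then show "inv\<^bsub>H\<^esub> q \<otimes>\<^bsub>H\<^esub> e \<otimes>\<^bsub>H\<^esub> q \<in> h ` A" using yc gc y(2) g(2) by simp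
    qed
    have "5 dvd card pact.fixpoints"
      using pact.card_fixpoints_mod[OF p5 P(2)] cA by (simp add: dvd_eq_mod_eq_0)
    moreover have "card pact.fixpoints \<noteq> 0"
    proof -
      have "inv\<^bsub>H\<^esub> b \<otimes>\<^bsub>H\<^esub> \<one>\<^bsub>H\<^esub> \<otimes>\<^bsub>H\<^esub> b = \<one>\<^bsub>H\<^esub>" if "b \<in> P" for b
        using P.mem_carrier[OF that] by simp
      then have "\<one>\<^bsub>H\<^esub> \<in> pact.fixpoints"
        unfolding pact.fixpoints_def using subgroup.one_closed[OF sA] by blast
      moreover have "finite pact.fixpoints"
        using pact.finite_E by (rule rev_finite_subset) (auto simp: pact.fixpoints_def)
      ultimately have "card pact.fixpoints > 0" unfolding card_gt_0_iff by blast
      then show ?thesis by simp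
    qed
    ultimately have "card pact.fixpoints \<ge> 5" by (auto dest: dvd_imp_le)
    moreover have sub: "pact.fixpoints \<subseteq> h ` A" by (auto simp: pact.fixpoints_def)
    ultimately have "pact.fixpoints = h ` A" using cA pact.finite_E by (intro card_seteq) auto
    then have "h g \<in> pact.fixpoints" using pg(2) by blast
    then show ?thesis using pg(1) unfolding pact.fixpoints_def by blast
  qed
  have Pcomm: "p \<otimes>\<^bsub>H\<^esub> q = q \<otimes>\<^bsub>H\<^esub> p" if pq: "p \<in> P" "q \<in> P" for p q
  proof -
    define Z where "Z = {z \<in> P. \<forall>p\<in>P. p \<otimes>\<^bsub>H\<^esub> z = z \<otimes>\<^bsub>H\<^esub> p}"
    define C where "C = {g \<in> carrier G. h g \<in> Z}"
    have "C \<lhd> G" unfolding C_def Z_def by (rule h.normal_vimage[OF h.H.normal_centralizer[OF nP nP]])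
    moreover have "A \<subseteq> C"
    proof
      fix g assume g: "g \<in> A"
      have gE: "g \<in> E" using g AE by blast
      then have gc: "g \<in> carrier G" and gP: "h g \<in> P" unfolding E_def by blast+
      have "p \<otimes>\<^bsub>H\<^esub> h g = h g \<otimes>\<^bsub>H\<^esub> p" if p: "p \<in> P" for p
      proof -
        have pc: "p \<in> carrier H" and hc: "h g \<in> carrier H" using P.mem_carrier p gP by blast+
        have "p \<otimes>\<^bsub>H\<^esub> (inv\<^bsub>H\<^esub> p \<otimes>\<^bsub>H\<^esub> h g \<otimes>\<^bsub>H\<^esub> p) = (p \<otimes>\<^bsub>H\<^esub> inv\<^bsub>H\<^esub> p) \<otimes>\<^bsub>H\<^esub> (h g \<otimes>\<^bsub>H\<^esub> p)"
          using pc hc by (simp only: h.H.m_assoc h.H.m_closed h.H.inv_closed)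
        also have "\<dots> = h g \<otimes>\<^bsub>H\<^esub> p" using pc hc by (simp only: h.H.r_inv h.H.l_one h.H.m_closed)
        finally show ?thesis using A_fix[OF p g] by simp
      qed
      then show "g \<in> C" using gc gP unfolding C_def Z_def by blast
    qed
    moreover have "C \<subseteq> E" unfolding C_def Z_def E_def by blast
    ultimately have CE: "C = E" by (rule max)
    obtain y where y: "y \<in> E" "q = h y" using pq(2) hE by blast
    then have "y \<in> C" using CE by simp
    then show ?thesis using pq y(2) unfolding C_def Z_def by blast
  qed
  have P5: "w [^]\<^bsub>H\<^esub> (5::nat) = \<one>\<^bsub>H\<^esub>" if w: "w \<in> P" for w
  proof -
    define Z where "Z = {w \<in> P. w [^]\<^bsub>H\<^esub> (5::nat) = \<one>\<^bsub>H\<^esub>}"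
    define C where "C = {g \<in> carrier G. h g \<in> Z}"
    have "C \<lhd> G" unfolding C_def Z_def by (rule h.normal_vimage[OF h.H.normal_torsion[OF nP Pcomm]])
    moreover have "A \<subseteq> C"
    proof
      fix g assume g: "g \<in> A"
      have gE: "g \<in> E" using g AE by blast
      then have gc: "g \<in> carrier G" and gP: "h g \<in> P" unfolding E_def by blast+
      obtain j :: nat where "g = x [^] j" using g by (auto simp: A_range)
      then have "g [^] (5::nat) = x [^] (5 * j)" by (simp add: nat_pow_pow mult.commute)
      then have "g [^] (5::nat) \<in> D" unfolding D_def using pow_mem_K_iff[OF c(2)] by simp
      then have "h (g [^] (5::nat)) = \<one>\<^bsub>H\<^esub>" using h1[of "g [^] (5::nat)"] gc by simp
      then have "h g [^]\<^bsub>H\<^esub> (5::nat) = \<one>\<^bsub>H\<^esub>" using h.hom_nat_pow[OF gc] by simp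
      then show "g \<in> C" using gc gP unfolding C_def Z_def by blast
    qed
    moreover have "C \<subseteq> E" unfolding C_def Z_def E_def by blast
    ultimately have CE: "C = E" by (rule max)
    obtain y where y: "y \<in> E" "w = h y" using w hE by blast
    then have "y \<in> C" using CE by simp
    then show ?thesis using y(2) unfolding C_def Z_def by blast
  qed
  have outer: "ord y \<le> 3 * d" if y: "y \<in> carrier G - E" for y
  proof -
    have yc: "y \<in> carrier G" "h y \<in> carrier H" "h y \<notin> P" using y unfolding E_def by auto
    have "h y [^]\<^bsub>H\<^esub> (3::nat) = \<one>\<^bsub>H\<^esub>"
      by (rule h.H.order_75_cube[OF finH oH nsH nP _ Pcomm P5 yc(2,3)]) (use P(2) in auto)
    then have "h (y [^] (3::nat)) = \<one>\<^bsub>H\<^esub>" using h.hom_nat_pow[OF yc(1)] by simp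
    then have "y [^] (3::nat) \<in> D" using h1[of "y [^] (3::nat)"] yc(1) by simp
    then have "(y [^] (3::nat)) [^] d = \<one>" unfolding d_def by (rule pow_card_subgroup[OF D.is_subgroup])
    then have "ord y dvd 3 * d" using yc(1) by (simp add: nat_pow_pow pow_eq_id)
    then show ?thesis using d0 by (intro dvd_imp_le) auto
  qed
  \<comment> \<open>Compares 75 d with 3^a 5^b.\<close>
  have "\<exists>a' b'. a = Suc a' \<and> b = Suc (Suc b')"
  proof -
    have "3 * (25 * d) = 3 ^ a * 5 ^ b" using o oG by simp
    then have "3 dvd 3 ^ a * (5 ^ b :: nat)" by (metis dvd_triv_left)
    moreover have "\<not> 3 dvd (5 ^ b :: nat)" using p3 prime_dvd_power[of "3::nat" 5 b] by auto
    ultimately have "a \<noteq> 0" by (auto intro!: Nat.gr0I)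
    then obtain a' where a': "a = Suc a'" by (cases a) auto
    then have e: "25 * d = 3 ^ a' * 5 ^ b" using o oG by simp
    have no5: "\<not> 5 dvd (3 ^ a' :: nat)" using p5 prime_dvd_power[of "5::nat" 3 a'] by auto
    have "b \<noteq> 0"
    proof
      assume "b = 0"
      then have "3 ^ a' = 5 * (5 * d)" using e by simp
      then show False using no5 by (metis dvd_triv_left)
    qed
    moreover have "b \<noteq> 1"
    proof
      assume "b = 1"
      then have "3 ^ a' = 5 * d" using e by simp
      then show False using no5 by (metis dvd_triv_left)
    qed
    ultimately obtain b' where "b = Suc (Suc b')" by (metis One_nat_def not0_implies_Suc)
    then show ?thesis using a' by blast
  qed
  then obtain \<alpha> \<beta> where ab: "a = Suc \<alpha>" "b = Suc (Suc \<beta>)" by blast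
  then have d: "d = 3 ^ \<alpha> * 5 ^ \<beta>" using o oG by simp
  have cop: "coprime (3 ^ i) (5 ^ j :: nat)" for i j
  proof -
    have "coprime 3 (5::nat)" using primes_coprime[OF p3 p5] by simp
    then show ?thesis by simp
  qed
  have inner: "(\<Sum>y\<in>{y \<in> E - D. h y = p}. ord y) \<le> 5 ^ (2 * \<beta> + 1) * cyc_psi (3 ^ \<alpha>)"
    if p: "p \<in> P - {\<one>\<^bsub>H\<^esub>}" for p
  proof -
    obtain y where y: "y \<in> E" "p = h y" using p hE by blast
    have yc: "y \<in> carrier G" using E.mem_carrier[OF y(1)] .
    have pc: "p \<in> carrier H" using p P.mem_carrier by blast
    \<comment> \<open>An exponent that is 0 modulo 3^\<alpha> and 1 modulo 5 replaces
      \<open>y\<close> by a 5-element \<open>u\<close> of the same coset, as \<open>P\<close> has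
      exponent 5.\<close>
    obtain i j :: nat where ij: "3 ^ \<alpha> * i = 5 * j + 1"
      using bezout_nat[of "3 ^ \<alpha>" 5] cop[of \<alpha> 1] by auto
    define u where "u = y [^] (3 ^ \<alpha> * i)"
    have uc: "u \<in> carrier G" using yc by (simp add: u_def)
    have uE: "u \<in> E" unfolding u_def using subgroup_int_pow_closed[OF E.is_subgroup y(1)] by (metis int_pow_int)
    have "h u = p [^]\<^bsub>H\<^esub> (5 * j + 1)" unfolding u_def ij by (simp only: h.hom_nat_pow[OF yc] y(2))
    also have "\<dots> = (p [^]\<^bsub>H\<^esub> (5::nat)) [^]\<^bsub>H\<^esub> j \<otimes>\<^bsub>H\<^esub> p"
      using pc by (simp add: h.H.nat_pow_pow)
    also have "\<dots> = p" using P5[of p] p pc by simp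
    finally have hu: "h u = p" .
    have "h (y [^] (5::nat)) = \<one>\<^bsub>H\<^esub>" using h.hom_nat_pow[OF yc, of 5] P5[of p] p y(2) by simp
    then have "y [^] (5::nat) \<in> D" using h1[of "y [^] (5::nat)"] yc by simp
    then have "(y [^] (5::nat)) [^] d = \<one>" unfolding d_def by (rule pow_card_subgroup[OF D.is_subgroup])
    then have "((y [^] (5::nat)) [^] d) [^] i = \<one>" by simp
    then have u1: "u [^] (5 * 5 ^ \<beta> :: nat) = \<one>"
      using yc unfolding u_def d by (simp add: nat_pow_pow ac_simps)
    have "{y \<in> E - D. h y = p} = D #> u"
    proof -
      have "{y \<in> E - D. h y = p} = {y \<in> carrier G. h y = h u}"
        using p h1 unfolding hu E_def by blast
      then show ?thesis using h.fibre[OF uc] h(2) by simp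
    qed
    moreover have "(\<Sum>y\<in>D #> u. ord y) \<le> 5 * 5 ^ \<beta> * (\<Sum>v\<in>D. ord (v [^] (5 ^ \<beta> :: nat)))"
      using cent[OF uE] by (intro sum_ord_coset_le[OF finite_G D.is_subgroup uc _ u1]) auto
    moreover have "(\<Sum>v\<in>D. ord (v [^] (5 ^ \<beta> :: nat))) = 5 ^ \<beta> * cyc_psi (3 ^ \<alpha>)"
      using sum_ord_pow_K[OF c(2), of "3 ^ \<alpha>" "5 ^ \<beta>"] d cop by (simp add: d_def D_def)
    moreover have "5 * 5 ^ \<beta> * (5 ^ \<beta> * cyc_psi (3 ^ \<alpha>)) = 5 ^ (2 * \<beta> + 1) * cyc_psi (3 ^ \<alpha>)"
      by (simp add: mult_2 power_add)
    ultimately show ?thesis by simp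
  qed
  have S1: "(\<Sum>y\<in>carrier G - E. ord y) \<le> 150 * d ^ 2"
  proof -
    have "card (carrier G - E) = 50 * d"
      using cE oG finE E.subset by (simp add: card_Diff_subset order_def)
    moreover have "(\<Sum>y\<in>carrier G - E. ord y) \<le> card (carrier G - E) * (3 * d)"
      using sum_bounded_above[of "carrier G - E" ord "3 * d"] outer by simp
    ultimately have "(\<Sum>y\<in>carrier G - E. ord y) \<le> 50 * d * (3 * d)" by (simp only:)
    then show ?thesis by (simp add: power2_eq_square)
  qed
  have S2: "(\<Sum>y\<in>E - D. ord y) \<le> 24 * (5 ^ (2 * \<beta> + 1) * cyc_psi (3 ^ \<alpha>))"
  proof -
    have finP: "finite P" using P.subset finH finite_subset by blast
    have cP: "card (P - {\<one>\<^bsub>H\<^esub>}) = 24" using P(2) finP P.one_closed by simp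
    have "h ` (E - D) \<subseteq> P - {\<one>\<^bsub>H\<^esub>}"
    proof
      fix q assume "q \<in> h ` (E - D)"
      then obtain y where y: "y \<in> E" "y \<notin> D" "q = h y" by blast
      then have "h y \<in> P" "h y \<noteq> \<one>\<^bsub>H\<^esub>" using h1[OF E.mem_carrier[OF y(1)]] unfolding E_def by blast+
      then show "q \<in> P - {\<one>\<^bsub>H\<^esub>}" by (simp add: y(3))
    qed
    then have "(\<Sum>y\<in>E - D. ord y) = (\<Sum>p\<in>P - {\<one>\<^bsub>H\<^esub>}. \<Sum>y\<in>{y \<in> E - D. h y = p}. ord y)"
      using finE finP by (intro sum.group[symmetric]) auto
    also have "\<dots> \<le> (\<Sum>p\<in>P - {\<one>\<^bsub>H\<^esub>}. 5 ^ (2 * \<beta> + 1) * cyc_psi (3 ^ \<alpha>))"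
      by (intro sum_mono inner)
    finally show ?thesis using cP by simp
  qed
  have S3: "(\<Sum>y\<in>D. ord y) = cyc_psi d"
  proof -
    have "ord (x [^] (5::nat)) = d" using card_K[of 5] by (simp add: d_def D_def)
    then show ?thesis using sum_ord_generate[of "x [^] (5::nat)"] d0 by (simp add: D_def K_def)
  qed
  have "psi G = (\<Sum>y\<in>carrier G - E. ord y) + ((\<Sum>y\<in>E - D. ord y) + (\<Sum>y\<in>D. ord y))"
    unfolding psi_def using sum.subset_diff[OF E.subset finite_G] sum.subset_diff[OF DE finE] by metis
  then have le: "psi G \<le> 150 * d ^ 2 + (24 * (5 ^ (2 * \<beta> + 1) * cyc_psi (3 ^ \<alpha>)) + cyc_psi d)"
    using S1 S2 S3 by simp
  \<comment> \<open>In these variables every term of the estimate is bilinear.\<close>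
  define u z :: real where "u = 3 ^ (2 * \<alpha> + 1)" and "z = 5 ^ (2 * \<beta> + 1)"
  have c3: "real (cyc_psi (3 ^ \<alpha>)) = (u + 1) / 4" and c5: "real (cyc_psi (5 ^ \<beta>)) = (z + 1) / 6"
    using cyc_psi_prime_power[OF p3, of \<alpha>] cyc_psi_prime_power[OF p5, of \<beta>] by (simp_all add: u_def z_def)
  have cd: "cyc_psi d = cyc_psi (3 ^ \<alpha>) * cyc_psi (5 ^ \<beta>)" unfolding d by (rule cyc_psi_mult[OF cop]) auto
  have "cyc_psi (order G) = cyc_psi (3 ^ a) * cyc_psi (5 ^ b)" unfolding o by (rule cyc_psi_mult[OF cop]) auto
  moreover have "real (cyc_psi (3 ^ a)) = (9 * u + 1) / 4"
    using cyc_psi_prime_power[OF p3, of a] by (simp add: ab u_def)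
  moreover have "real (cyc_psi (5 ^ b)) = (625 * z + 1) / 6"
    using cyc_psi_prime_power[OF p5, of b] by (simp add: ab z_def)
  ultimately have cG: "real (cyc_psi (order G)) = (9 * u + 1) / 4 * ((625 * z + 1) / 6)" by (simp only: of_nat_mult)
  have dd: "150 * real d ^ 2 = 10 * u * z"
  proof -
    have "u = 3 * (3 ^ \<alpha>) ^ 2" "z = 5 * (5 ^ \<beta>) ^ 2"
      by (simp_all add: u_def z_def mult.commute flip: power_mult)
    moreover have "real d = 3 ^ \<alpha> * 5 ^ \<beta>" by (simp add: d)
    ultimately show ?thesis by (simp add: power_mult_distrib)
  qed
  have "real (psi G) \<le> 150 * real d ^ 2 + (24 * (z * real (cyc_psi (3 ^ \<alpha>))) + real (cyc_psi d))"
    using of_nat_mono[OF le, where 'a = real] by (simp add: z_def)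
  also have "\<dots> = (u + 1) * (145 * z + 1) / 24 + 10 * u * z"
    unfolding dd cd of_nat_mult c3 c5 by (simp add: field_simps)
  also have "\<dots> \<le> 271 / 3647 * ((9 * u + 1) / 4 * ((625 * z + 1) / 6))"
  proof (rule bound_75)
    have "(3::real) ^ 1 \<le> 3 ^ (2 * \<alpha> + 1)" "(5::real) ^ 1 \<le> 5 ^ (2 * \<beta> + 1)"
      by (intro power_increasing; simp)+
    then show "3 \<le> u" "5 \<le> z" by (simp_all add: u_def z_def)
  qed
  finally show ?thesis using cG by simp
qed

end

section \<open>The bound on the sum of element orders\<close>

lemma (in cyclic_subgroup) psi_le_max_ord:
  assumes "\<And>y. y \<in> carrier G \<Longrightarrow> ord y \<le> ord x"
  shows "index * psi G \<le> order G ^ 2"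
proof -
  have "psi G \<le> order G * ord x"
    unfolding psi_def order_def using sum_bounded_above[of "carrier G" ord "ord x"] assms by simp
  then have "index * psi G \<le> index * (order G * ord x)" by simp
  also have "\<dots> = order G ^ 2" using index_mult by (simp add: power2_eq_square ac_simps)
  finally show ?thesis .
qed

lemma (in cyclic_subgroup) supersolvable_if_quotient_K:
  assumes "K m \<lhd> G" "\<And>(H :: 'a monoid) h. group_epi G H h \<Longrightarrow> kernel G H h = K m \<Longrightarrow> supersolvable H"
  shows "supersolvable G"
proof -
  obtain H :: "'a monoid" and h where h: "group_epi G H h" "kernel G H h = K m"
    using quotient_epi[OF assms(1)] .
  interpret h: group_epi G H h by fact
  show ?thesis using h.supersolvable_vimage assms(2)[OF h] sschain_K[OF assms(1)] h(2) by simp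
qed

text \<open>Writing d = r j + 1, oddness of \<open>d\<close> and \<open>r\<close> makes j even, and
  j is not 0.\<close>

lemma mod_1_ge:
  fixes d r :: nat
  assumes "d mod r = 1" "d \<noteq> 1" "odd d" "odd r"
  shows "d \<ge> 2 * r + 1"
proof -
  define j where "j = d div r"
  have d: "d = r * j + 1" unfolding j_def using assms(1) by (metis mult_div_mod_eq)
  then have "even j" "j \<noteq> 0" using assms by auto
  then have "j \<ge> 2" by (auto elim!: evenE)
  then have "r * 2 \<le> r * j" by simp
  then show ?thesis using d by simp
qed

lemma prime_power_eqI:
  fixes n p :: nat
  assumes "n > 0" "prime p" "\<And>q. prime q \<Longrightarrow> q dvd n \<Longrightarrow> q = p"
  obtains a where "n = p ^ a"
proof -
  obtain m a where m: "n = m * p ^ a" "\<not> p dvd m"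
    using prime_power_canonical[OF assms(2,1)] by blast
  have "m = 1"
  proof (rule ccontr)
    assume "m \<noteq> 1"
    then obtain q where q: "prime q" "q dvd m" using prime_factor_nat by blast
    then have "q = p" using assms(3)[OF q(1)] m(1) by simp
    then show False using q(2) m(2) by simp
  qed
  then show thesis using m(1) that by simp
qed

lemma prime_less_17:
  fixes p :: nat
  assumes "prime p" "odd p" "p \<noteq> 3" "p < 17"
  shows "p \<in> {5, 7, 11, 13}"
proof -
  have "p \<in> {0,1,2,3,4,5,6,7,8,9,10,11,12,13,14,15,16}"
    using assms(4) unfolding insert_iff empty_iff by presburger
  moreover have "\<not> prime (9::nat)" "\<not> prime (15::nat)" by simp_all
  ultimately show ?thesis using assms(1-3) by auto
qed

text \<open>The lower ends are 2 p + 1 for p = 13, 11, 7, 5; the upper ends come from the numerical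
  bound on the index for these primes.\<close>

lemma odd_between:
  fixes k :: nat
  shows "odd k \<Longrightarrow> 27 \<le> k \<Longrightarrow> k < 29 \<Longrightarrow> k = 27"
    and "odd k \<Longrightarrow> 23 \<le> k \<Longrightarrow> k < 27 \<Longrightarrow> k = 23 \<or> k = 25"
    and "odd k \<Longrightarrow> 15 \<le> k \<Longrightarrow> k < 25 \<Longrightarrow> k = 15 \<or> k = 17 \<or> k = 19 \<or> k = 21 \<or> k = 23"
    and "odd k \<Longrightarrow> 11 \<le> k \<Longrightarrow> k < 22 \<Longrightarrow> k = 11 \<or> k = 13 \<or> k = 15 \<or> k = 17 \<or> k = 19 \<or> k = 21"
  by presburger+

lemma dvd_25: "d dvd 25 \<longleftrightarrow> d \<in> {1, 5, 25 :: nat}"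
proof
  assume "d dvd 25"
  then have "d dvd 5 ^ 2" by simp
  then obtain i where i: "i \<le> 2" "d = 5 ^ i" using divides_primepow_nat[of 5 d 2] by auto
  then have "i = 0 \<or> i = 1 \<or> i = 2" by arith
  then show "d \<in> {1, 5, 25}" using i by auto
qed auto

lemma dvd_27: "d dvd 27 \<longleftrightarrow> d \<in> {1, 3, 9, 27 :: nat}"
proof
  assume "d dvd 27"
  then have "d dvd 3 ^ 3" by simp
  then obtain i where i: "i \<le> 3" "d = 3 ^ i" using divides_primepow_nat[of 3 d 3] by auto
  then have "i = 0 \<or> i = 1 \<or> i = 2 \<or> i = 3" by arith
  then show "d \<in> {1, 3, 9, 27}" using i by auto
qed auto

theorem supersolvable_if_psi_large:
  fixes G :: "'a monoid"
  assumes "group G" "finite (carrier G)" "odd (order G)"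
    "real (psi G) > 271 / 3647 * real (cyc_psi (order G))"
  shows "supersolvable G"
  using assms
proof (induction "order G" arbitrary: G rule: less_induct)
  case less
  interpret group G by (rule less.prems)
  note fin = less.prems(2)
  show ?case
  proof (rule ccontr)
    assume ns: "\<not> supersolvable G"
    let ?n = "order G"
    have n0: "?n > 0" using fin order_gt_0_iff_finite by blast
    obtain x where x: "x \<in> carrier G" "\<And>y. y \<in> carrier G \<Longrightarrow> ord y \<le> ord x"
    proof -
      have "finite (ord ` carrier G)" "ord ` carrier G \<noteq> {}" using fin by auto
      then have "Max (ord ` carrier G) \<in> ord ` carrier G" by (rule Max_in)
      then obtain x where "x \<in> carrier G" "ord x = Max (ord ` carrier G)" by auto
      then show thesis using that[of x] fin by simp
    qed
    interpret cyclic_subgroup G x by unfold_locales (use fin x in auto)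
    let ?k = "index"
    have kn: "?k dvd ?n" using index_mult by (metis dvd_triv_left)
    have k_odd: "odd ?k" using kn less.prems(3) by (metis dvd_trans)
    have k0: "?k > 0" using kn n0 by (auto intro!: Nat.gr0I)
    \<comment> \<open>Dividing by the multiplicative factor \<psi>(C_(r^a)) carries the strict
      inequality over to the quotient, which is supersolvable by induction; the cyclic kernel then
      makes \<open>G\<close> supersolvable.\<close>
    have no_sylow: False
      if K: "K m \<lhd> G" "card (K m) = r ^ a" "a > 0" "?n = card (K m) * q" "\<not> r dvd q" "prime r" for m r a q
    proof -
      have cop: "coprime (r ^ a) q" using prime_imp_coprime[OF K(6,5)] by simp
      have r0: "r > 0" using prime_gt_0_nat[OF K(6)] .
      have q0: "q > 0" using n0 K(4) by (auto intro!: Nat.gr0I)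
      have r1: "r ^ a > 1" using one_less_power[OF prime_gt_1_nat[OF K(6)] K(3)] .
      have "supersolvable G"
      proof (rule supersolvable_if_quotient_K[OF K(1)])
        fix H :: "'a monoid" and h
        assume h: "group_epi G H h" "kernel G H h = K m"
        interpret h: group_epi G H h by fact
        have oH: "order H = q" using h.order_epi[OF fin] h(2) K(2,4) r0 by (simp add: mult.commute)
        have "psi G \<le> (\<Sum>u\<in>kernel G H h. ord u) * psi H"
        proof (rule h.psi_le_mult[OF fin])
          show "u \<otimes>\<^bsub>G\<^esub> v = v \<otimes>\<^bsub>G\<^esub> u" if "u \<in> kernel G H h" "v \<in> kernel G H h" for u v
            using that A_comm K_subset_A unfolding h(2) by blast
          show "coprime (card (kernel G H h)) (order H)" using cop h(2) K(2) oH by simp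
        qed
        moreover have "(\<Sum>u\<in>K m. ord u) = cyc_psi (r ^ a)"
          using sum_ord_generate[of "x [^]\<^bsub>G\<^esub> m"] ord_pos[of "x [^]\<^bsub>G\<^esub> m"] card_K[of m] K(2) by (simp add: K_def)
        ultimately have le: "psi G \<le> cyc_psi (r ^ a) * psi H" using h(2) by simp
        have e: "cyc_psi ?n = cyc_psi (r ^ a) * cyc_psi q"
          unfolding K(4) K(2) using cop q0 r0 by (intro cyc_psi_mult) auto
        have "real (cyc_psi (r ^ a)) * (271 / 3647 * real (cyc_psi q)) = 271 / 3647 * real (cyc_psi ?n)"
          by (simp add: e)
        also have "\<dots> < real (psi G)" by (rule less.prems(4))
        also have "\<dots> \<le> real (cyc_psi (r ^ a)) * real (psi H)" using le by (metis of_nat_le_iff of_nat_mult)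
        finally have "271 / 3647 * real (cyc_psi q) < real (psi H)"
          by (rule mult_left_less_imp_less) simp
        moreover have "q < ?n" using K(2,4) r1 q0 by simp
        moreover have "odd q" using less.prems(3) K(4) by simp
        ultimately show "supersolvable H"
          using less.hyps[of H] h.H.group_axioms h.finite_image[OF fin] oH by simp
      qed
      then show False using ns by simp
    qed
    \<comment> \<open>The set \<open>S\<close> is left open: usually all odd primes up to
      \<open>p\<close>, but a smaller set gives a sharper bound once further primes are
      excluded.\<close>
    have bound: "real ?k * (271 / 3647) * (\<Prod>p\<in>S. real p / (real p + 1)) < 1"
      if S: "finite S" "\<And>p. p \<in> S \<Longrightarrow> prime p" "\<And>p. prime p \<Longrightarrow> p dvd ?n \<Longrightarrow> p \<in> S" for S
    proof -
      let ?b = "\<Prod>p\<in>S. real p / (real p + 1)"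
      have "real ?n ^ 2 * (real ?k * (271 / 3647) * ?b) = real ?k * (271 / 3647 * (real ?n ^ 2 * ?b))"
        by (simp add: ac_simps)
      also have "\<dots> \<le> real ?k * (271 / 3647 * real (cyc_psi ?n))"
        using cyc_psi_lower_bound[OF S(1,2) n0 S(3)] by (intro mult_left_mono) auto
      also have "\<dots> < real ?k * real (psi G)" using less.prems(4) k0 by (intro mult_strict_left_mono) auto
      also have "\<dots> \<le> real ?n ^ 2" using psi_le_max_ord[OF x(2)] by (metis of_nat_le_iff of_nat_mult of_nat_power)
      finally have "real ?n ^ 2 * (real ?k * (271 / 3647) * ?b) < real ?n ^ 2 * 1" by simp
      then show ?thesis by (rule mult_left_less_imp_less) simp
    qed
    have kprime: "\<not> prime ?k" using supersolvable_prime_index ns by blast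
    have odd_n: "odd p" if "p dvd ?n" for p using that less.prems(3) by (metis dvd_trans)
    have R: "\<exists>d. d dvd ?k \<and> d mod r = 1 \<and> d \<noteq> 1 \<and> d \<ge> 2 * r + 1"
      if r: "prime r" "r dvd ?n" "\<not> r dvd ?k" for r
    proof -
      obtain m d a where m: "ncosdvd m * d = index" "d mod r = 1" "d dvd ?n" "d = 1 \<Longrightarrow> K m \<lhd> G"
        "card (K m) = r ^ a" "a > 0" "?n = card (K m) * (index * m)" "\<not> r dvd index * m"
        "m dvd ord x" "m > 0"
        using sylow_data[OF r] by metis
      have d1: "d \<noteq> 1" using no_sylow[OF _ m(5-8) r(1)] m(4) by blast
      moreover have "d \<ge> 2 * r + 1"
        using mod_1_ge[OF m(2) d1 odd_n[OF m(3)] odd_n[OF r(2)]] .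
      moreover have "d dvd ?k" using m(1) by (metis dvd_triv_right)
      ultimately show ?thesis using m(2) by blast
    qed
    have "?n \<noteq> 1"
    proof
      assume "?n = 1"
      then have "?n = 3 ^ 0" by simp
      then show False using p_group_supersolvable[OF group_axioms fin, of 3 0] ns by simp
    qed
    define p where "p = Max {q. prime q \<and> q dvd ?n}"
    have finp: "finite {q. prime q \<and> q dvd ?n}"
      using n0 by (intro finite_subset[OF _ finite_atMost[of ?n]]) (auto dest: dvd_imp_le)
    have "{q. prime q \<and> q dvd ?n} \<noteq> {}" using prime_factor_nat[OF \<open>?n \<noteq> 1\<close>] by auto
    then have "p \<in> {q. prime q \<and> q dvd ?n}" unfolding p_def using finp by (intro Max_in)
    then have p: "prime p" "p dvd ?n" by auto
    have p_max: "q \<le> p" if "prime q" "q dvd ?n" for q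
      unfolding p_def using that finp by (intro Max_ge) auto
    have p_odd: "odd p" using odd_n[OF p(2)] .
    have primes: "q \<in> oprimes p" if "prime q" "q dvd ?n" for q
      using that p_max odd_n by (simp add: oprimes_def)
    have p3: "p \<noteq> 3"
    proof
      assume "p = 3"
      then have "q = 3" if "prime q" "q dvd ?n" for q
        using p_max[OF that] odd_n[OF that(2)] prime_gt_1_nat[OF that(1)] by (cases "q = 2") auto
      then obtain a where "?n = 3 ^ a" using prime_power_eqI[OF n0, of 3] by auto
      then show False using p_group_supersolvable[OF group_axioms fin, of 3 a] ns by simp
    qed
    \<comment> \<open>If \<open>p\<close> divides the index, the cofactor is odd and not 1 because
      the index is not prime, so the index is at least 3 p. Otherwise a nontrivial Sylow number
      divides it.\<close>
    have kp: "2 * p + 1 \<le> ?k"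
    proof (cases "p dvd ?k")
      case True
      then obtain j where j: "?k = p * j" by (auto elim!: dvdE)
      have "odd j" "j \<noteq> 1" using k_odd kprime p(1) j by auto
      then have "j \<ge> 3" by (cases "j = 0"; cases "j = 2") auto
      then have "p * 3 \<le> ?k" unfolding j by simp
      then show ?thesis using prime_gt_1_nat[OF p(1)] by simp
    next
      case False
      then obtain d where "d dvd ?k" "d \<ge> 2 * p + 1" using R[OF p] by blast
      then show ?thesis using k0 dvd_imp_le[of d ?k] by simp
    qed
    have kb: "real ?k * (271 / 3647) * mertens p < 1"
      unfolding mertens_def
    proof (rule bound)
      show "prime q" if "q \<in> oprimes p" for q using that by (simp add: oprimes_def)
      show "q \<in> oprimes p" if "prime q" "q dvd ?n" for q using that by (rule primes)
    qed simp
    have kb': "real ?k * (271 / 3647) * t < 1" if "t \<le> mertens p" for t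
    proof -
      have "real ?k * (271 / 3647) * t \<le> real ?k * (271 / 3647) * mertens p"
        using that by (intro mult_left_mono) auto
      then show ?thesis using kb by linarith
    qed
    \<comment> \<open>Squaring makes the telescoped bound on \<open>mertens\<close> applicable. One
      factor 2 p + 1 is then replaced by 35, its value at p = 17, which leaves a linear inequality
      in p that fails.\<close>
    have "p < 17"
    proof (rule ccontr)
      assume "\<not> p < 17"
      then have p17: "p \<ge> 17" by simp
      have le: "(2 * real p + 1) * (271 / 3647) * mertens p \<le> real ?k * (271 / 3647) * mertens p"
        using kp mertens_pos[of p] by (intro mult_right_mono) auto
      then have "((2 * real p + 1) * (271 / 3647) * mertens p) ^ 2 < 1 ^ 2"
        using mertens_pos[of p] by (intro power_strict_mono[OF le_less_trans[OF le kb]]) simp_all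
      then have "(2 * real p + 1) ^ 2 * (271 / 3647) ^ 2 * mertens p ^ 2 < 1"
        by (simp only: power_mult_distrib power_one)
      then have less: "((2 * real p + 1) ^ 2 * (271 / 3647) ^ 2 * mertens p ^ 2) * real (p + 1) < 1 * real (p + 1)"
        by (intro mult_strict_right_mono) auto
      have "35 * (2 * real p + 1) \<le> (2 * real p + 1) ^ 2"
        using p17 unfolding power2_eq_square by (intro mult_right_mono) auto
      then have "35 * (2 * real p + 1) * ((271 / 3647) ^ 2 * ((35 / 64) ^ 2 * 10))
          \<le> (2 * real p + 1) ^ 2 * ((271 / 3647) ^ 2 * ((35 / 64) ^ 2 * 10))"
        by (rule mult_right_mono) simp
      also have "\<dots> \<le> (2 * real p + 1) ^ 2 * ((271 / 3647) ^ 2 * (mertens p ^ 2 * real (p + 1)))"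
        using mertens_lower_bound[OF p_odd] p17 by (intro mult_left_mono) auto
      also have "\<dots> < real (p + 1)" using less by (simp only: mult.assoc mult_1)
      finally show False using p17 by (simp add: power2_eq_square)
    qed
    then have "p \<in> {5, 7, 11, 13}" by (rule prime_less_17[OF p(1) p_odd p3])
    have two_primes: "q \<in> {3, 13} \<Longrightarrow> prime q" "q \<in> {3, 7} \<Longrightarrow> prime q" for q :: nat
      by (elim insertE; simp)+
    have m11: "mertens 11 \<ge> 35 / 64 * (11 / 12)"
      using mertens_Suc_Suc[of 9] by (simp add: mertens_small)
    have m13: "mertens 13 \<ge> 35 / 64 * (11 / 12) * (13 / 14)"
      using mertens_Suc_Suc[of 11] m11 by simp
    consider "p = 13" | "p = 11" | "p = 7" | "p = 5" using \<open>p \<in> {5, 7, 11, 13}\<close> by auto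
    then show False
    proof cases
      case 1
      then have "?k < 29" using kb'[of "35 / 64 * (11 / 12) * (13 / 14)"] m13 by simp
      then have k: "?k = 27" using odd_between(1)[OF k_odd] kp 1 by simp
      \<comment> \<open>None of 3, 9, 27 is 1 modulo 5, 7 or 11, so these primes cannot divide the
        order. With 3 and 13 alone the bound rules out 27.\<close>
      have "q \<in> {3, 13}" if q: "prime q" "q dvd ?n" for q
      proof (rule ccontr)
        assume q': "q \<notin> {3, 13}"
        have "q \<in> {5, 7, 11, 13}"
          using p_max[OF q] q' 1 by (intro prime_less_17[OF q(1) odd_n[OF q(2)]]) auto
        then have q5: "q \<in> {5, 7, 11}" using q' by auto
        then have "\<not> q dvd ?k" using k by auto
        then obtain d :: nat where "d dvd 27" "d mod q = 1" "d \<noteq> 1" using R[OF q] k by auto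
        then show False using q5 unfolding dvd_27 by auto
      qed
      then have "real ?k * (271 / 3647) * (\<Prod>q\<in>{3, 13}. real q / (real q + 1)) < 1"
        by (intro bound two_primes(1)) auto
      then show False using k by simp
    next
      case 2
      then have "?k < 27" using kb'[of "35 / 64 * (11 / 12)"] m11 by simp
      then have "?k = 23 \<or> ?k = 25" using odd_between(2)[OF k_odd] kp 2 by simp
      then have k: "?k = 25" using kprime by auto
      \<comment> \<open>Neither 5 nor 25 is 1 modulo 11.\<close>
      then obtain d :: nat where "d dvd 25" "d mod 11 = 1" "d \<noteq> 1" using R[OF p] 2 by auto
      then show False unfolding dvd_25 by auto
    next
      case 3
      then have "?k < 25" using kb'[of "35 / 64"] mertens_small by simp
      then have "?k = 15 \<or> ?k = 21" using odd_between(3)[OF k_odd] kp 3 kprime by auto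
      then show False
      proof
        assume "?k = 15"
        then show False
          using index_15_21_contradiction[OF less.prems(3), of 7] no_sylow[where r = 7] p(2) 3 by auto
      next
        assume k: "?k = 21"
        show False
        proof (cases "5 dvd ?n")
          case True
          then show False
            using index_15_21_contradiction[OF less.prems(3), of 5] no_sylow[where r = 5] k by auto
        next
          case False
          \<comment> \<open>Without the prime 5 the product gains a factor 6 / 5, just enough to
            rule out 21.\<close>
          have "q \<in> {3, 7}" if q: "prime q" "q dvd ?n" for q
          proof (rule ccontr)
            assume q': "q \<notin> {3, 7}"
            have "q \<in> {5, 7, 11, 13}"
              using p_max[OF q] q' 3 by (intro prime_less_17[OF q(1) odd_n[OF q(2)]]) auto
            then show False using p_max[OF q] q' 3 q(2) False by auto
          qed
          then have "real ?k * (271 / 3647) * (\<Prod>q\<in>{3, 7}. real q / (real q + 1)) < 1"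
            by (intro bound two_primes(2)) auto
          then show False using k by simp
        qed
      qed
    next
      case 4
      then have "?k < 22" using kb'[of "5 / 8"] mertens_small by simp
      then have "?k = 15 \<or> ?k = 21" using odd_between(4)[OF k_odd] kp 4 kprime by auto
      moreover have "?k \<noteq> 21"
      proof
        assume "?k = 21"
        then have "7 dvd ?k" by simp
        then have "7 dvd ?n" using kn by (rule dvd_trans)
        then show False using p_max[of 7] 4 by simp
      qed
      ultimately have k: "?k = 15" by simp
      have primes5: "q = 3 \<or> q = 5" if q: "prime q" "q dvd ?n" for q
        using prime_less_17[OF q(1) odd_n[OF q(2)]] p_max[OF q] 4 by (cases "q = 3") auto
      obtain m b where m: "?n = m * 5 ^ b" "\<not> 5 dvd m"
        using prime_power_canonical[of 5 ?n] n0 by auto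
      have "q = 3" if "prime q" "q dvd m" for q
        using primes5[OF that(1)] that m by auto
      moreover have "m > 0" using m(2) by (auto intro!: Nat.gr0I)
      ultimately obtain a where "m = 3 ^ a" using prime_power_eqI[of m 3] by auto
      then have o: "?n = 3 ^ a * 5 ^ b" using m(1) by simp
      \<comment> \<open>The quotient by \<open>K t\<close> has order 15 or 45.\<close>
      have quot: "supersolvable G" if "ncosdvd t = 15" "t dvd ord x" "t = 1 \<or> t = 3" for t
      proof (rule supersolvable_if_quotient_K)
        show nK: "K t \<lhd> G" using normal_K that(1) k by simp
        fix H :: "'a monoid" and h
        assume h: "group_epi G H h" "kernel G H h = K t"
        interpret h: group_epi G H h by fact
        have "order H = 5 * (3 * t)" using order_quotient_K[OF nK that(2) h] k by simp
        then show "supersolvable H"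
          using h.H.supersolvable_order_15_45[OF h.finite_image[OF fin], of "3 * t"] that(3) by auto
      qed
      from index_15_cases[OF k o] show False
      proof (elim disjE conjE)
        assume "ncosdvd 1 = 15"
        then show False using quot[of 1] ns by simp
      next
        assume "ncosdvd 3 = 15" "3 dvd ord x"
        then show False using quot[of 3] ns by simp
      next
        assume "ncosdvd 5 = 15" "5 dvd ord x" "ncos 1 = 5"
        then show False using psi_le_order_75[OF k _ _ _ o ns] less.prems(4) by linarith
      qed
    qed
  qed
qed

theorem theorem1p1:
  fixes G :: "('a, 'b) monoid_scheme" and n :: nat
  assumes "group G" and "finite (carrier G)"
    and "order G = n" and "odd n"
    and "real (psi G) > (271 / 3647) * real (psi (integer_mod_group n))"
  shows "supersolvable G"
proof -
  interpret group G by (rule assms(1))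
  \<comment> \<open>Dividing by the trivial subgroup replaces the record scheme by a plain monoid,
    the type over which the induction runs.\<close>
  obtain H :: "'a monoid" and h where h: "group_epi G H h" "kernel G H h = {\<one>\<^bsub>G\<^esub>}"
    using quotient_epi[OF one_is_normal] .
  interpret h: group_epi G H h by fact
  have oH: "order H = n" using h.order_epi[OF assms(2)] h(2) assms(3) by simp
  have "psi G \<le> psi H" using h.psi_le_mult[OF assms(2)] h(2) by simp
  moreover have "n > 0" using assms(4) by (auto intro!: Nat.gr0I)
  ultimately have "real (psi H) > 271 / 3647 * real (cyc_psi (order H))"
    using assms(5) psi_integer_mod_group[of n] oH by simp
  then have "supersolvable H"
    using supersolvable_if_psi_large[OF h.H.group_axioms h.finite_image[OF assms(2)]] oH assms(4) by simp
  then show ?thesis using h.supersolvable_vimage h(2) sschain.one[of G] by simp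
qed

end
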